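(* Let $C$ be a Finsler cylinder. Then $$ \mathrm{vol}_{HT}(C)\geq\frac{2}{\pi}\,\mathrm{sys}(C)\,h(C). $$
   Context: A (reversible) Finsler metric on a smooth manifold $M$ (possibly with boundary) is a continuous function $F: TM \to [0,+\infty)$, with restriction $F_x := F|_{T_xM}$, such that: (1) $F$ is smooth outside the zero section; (2) $F_x(tv)=|t|F_x(v)$ for all $v\in T_xM$, $t\in\mathbb{R}$; (3) for every $x$, $F_x^2$ has positive definite second derivatives on $T_xM\setminus\{0\}$. The length of a piecewise smooth curve $\gamma:[a,b]\to M$ is $\ell(\gamma)=\int_a^b F(\dot\gamma(t))\,dt$. A Finsler cylinder is a compact cylinder (diffeomorphic to $S^1\times[0,1]$) endowed with a Finsler metric. Holmes-Thompson volume of a Finsler surface $M$: $\mathrm{vol}_{HT}(M)=\int_M \frac{m^*(B_x^* )}{\pi}\,dx$, where $dx$ is any volume form on $M$, $m^*$ is the restriction to $T_x^*M$ of the volume form dual to $dx$, and $B_x^*=\{f\in T_x^*M \mid F_x^*(f)\leq 1\}$ is the unit ball of the dual norm $F_x^*$; the integral does not depend on the choice of $dx$. The systole $\mathrm{sys}(M)$ is the infimum of the lengths of noncontractible loops of $M$. The height of a compact Finsler surface $M$ with boundary is $$h(M):=\inf\{\ell(\gamma) \mid \gamma:[0,1]\to M,\ \gamma(0),\gamma(1)\in\partial M,\ [\gamma]\neq 0\in\pi_1(M,\partial M)\},$$ i.e. the minimal length of arcs with endpoints on $\partial M$ that are not homotopic (with endpoints kept in $\partial M$) to an arc in $\partial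 M$. *)

theory Defs
  imports "HOL-Analysis.Analysis"
begin

section \<open>Smooth functions\<close>

primrec Ck_on :: "nat \<Rightarrow> 'a::real_normed_vector set \<Rightarrow> ('a \<Rightarrow> 'b::real_normed_vector) \<Rightarrow> bool" where
  "Ck_on 0 S f \<longleftrightarrow> continuous_on S f"
| "Ck_on (Suc k) S f \<longleftrightarrow>
     (\<forall>x\<in>S. f differentiable (at x)) \<and> (\<forall>v. Ck_on k S (\<lambda>x. frechet_derivative f (at x) v))"

text \<open>On a set that need not be open (a relatively open part of a half-plane, a compact interval,
  an embedded submanifold) smooth means locally extendable to a \<open>C\<^sup>\<infinity>\<close> function on an open set of
  the ambient space.\<close>

definition smooth_on :: "'a::real_normed_vector set \<Rightarrow> ('a \<Rightarrow> 'b::real_normed_vector) \<Rightarrow> bool" where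
  "smooth_on S f \<longleftrightarrow>
     (\<forall>x\<in>S. \<exists>U g. open U \<and> x \<in> U \<and> (\<forall>k. Ck_on k U g) \<and> (\<forall>y\<in>U \<inter> S. g y = f y))"


section \<open>Smooth surfaces with boundary\<close>

text \<open>A chart consists of its domain and of its coordinate map into the closed upper half-plane.\<close>

type_synonym 'a chart = "'a set \<times> ('a \<Rightarrow> real \<times> real)"

abbreviation chart_dom :: "'a chart \<Rightarrow> 'a set" where "chart_dom c \<equiv> fst c"
abbreviation chart_map :: "'a chart \<Rightarrow> 'a \<Rightarrow> real \<times> real" where "chart_map c \<equiv> snd c"
abbreviation chart_img :: "'a chart \<Rightarrow> (real \<times> real) set" where
  "chart_img c \<equiv> chart_map c ` chart_dom c"
abbreviation chart_inv :: "'a chart \<Rightarrow> real \<times> real \<Rightarrow> 'a" where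
  "chart_inv c \<equiv> inv_into (chart_dom c) (chart_map c)"

definition half_plane :: "(real \<times> real) set" where
  "half_plane = {x. 0 \<le> snd x}"

definition smooth_surface :: "'a::topological_space set \<Rightarrow> 'a chart set \<Rightarrow> bool" where
  "smooth_surface M A \<longleftrightarrow>
     Hausdorff_space (top_of_set M) \<and> second_countable (top_of_set M) \<and>
     (\<forall>c\<in>A. openin (top_of_set M) (chart_dom c) \<and>
            openin (top_of_set half_plane) (chart_img c) \<and>
            homeomorphism (chart_dom c) (chart_img c) (chart_map c) (chart_inv c)) \<and>
     (\<Union>c\<in>A. chart_dom c) = M \<and>
     (\<forall>c\<in>A. \<forall>d\<in>A. smooth_on (chart_map c ` (chart_dom c \<inter> chart_dom d)) (chart_map d \<circ> chart_inv c))"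

definition surface_boundary :: "'a chart set \<Rightarrow> 'a set" where
  "surface_boundary A = {p. \<exists>c\<in>A. p \<in> chart_dom c \<and> snd (chart_map c p) = 0}"

text \<open>Diffeomorphism from the surface onto a smooth submanifold with boundary \<open>N\<close> of a Euclidean
  space: smoothness of the inverse with respect to the smooth structure that \<open>N\<close> inherits from the
  ambient space is expressed by local smooth extensions.\<close>

definition diffeomorphic_to :: "'a::topological_space set \<Rightarrow> 'a chart set \<Rightarrow> 'b::euclidean_space set \<Rightarrow> bool" where
  "diffeomorphic_to M A N \<longleftrightarrow>
     (\<exists>\<Phi> \<Psi>. homeomorphism M N \<Phi> \<Psi> \<and>
       (\<forall>c\<in>A. smooth_on (chart_img c) (\<Phi> \<circ> chart_inv c) \<and>
              smooth_on (\<Phi> ` chart_dom c) (chart_map c \<circ> \<Psi>)))"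

definition standard_cylinder :: "(complex \<times> real) set" where
  "standard_cylinder = sphere 0 1 \<times> {0..1}"


section \<open>Tangent vectors and curves\<close>

text \<open>A tangent vector at \<open>p\<close> is the family of its components in all charts around \<open>p\<close> (and \<open>0\<close> in
  the other places); the components are related by the differentials of the coordinate changes.
  \<open>tangent_vector A c p \<xi>\<close> is the vector with components \<open>\<xi>\<close> in the chart \<open>c\<close>.\<close>

type_synonym 'a tvec = "'a chart \<Rightarrow> real \<times> real"

definition tangent_vector :: "'a chart set \<Rightarrow> 'a chart \<Rightarrow> 'a \<Rightarrow> real \<times> real \<Rightarrow> 'a tvec" where
  "tangent_vector A c p \<xi> = (\<lambda>d. if d \<in> A \<and> p \<in> chart_dom d
     then frechet_derivative (chart_map d \<circ> chart_inv c)
            (at (chart_map c p) within chart_map c ` (chart_dom c \<inter> chart_dom d)) \<xi>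
     else 0)"

definition tangent_space :: "'a chart set \<Rightarrow> 'a \<Rightarrow> 'a tvec set" where
  "tangent_space A p = {tangent_vector A c p \<xi> |c \<xi>. c \<in> A \<and> p \<in> chart_dom c}"

definition velocity :: "'a chart set \<Rightarrow> real \<Rightarrow> real \<Rightarrow> (real \<Rightarrow> 'a) \<Rightarrow> real \<Rightarrow> 'a tvec" where
  "velocity A a b \<gamma> t = (\<lambda>d. if d \<in> A \<and> \<gamma> t \<in> chart_dom d
     then vector_derivative (chart_map d \<circ> \<gamma>) (at t within {a..b}) else 0)"

text \<open>The finite set \<open>S\<close> contains the break points.\<close>

definition piecewise_smooth :: "'a::topological_space set \<Rightarrow> 'a chart set \<Rightarrow> real \<Rightarrow> real \<Rightarrow> (real \<Rightarrow> 'a) \<Rightarrow> bool" where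
  "piecewise_smooth M A a b \<gamma> \<longleftrightarrow>
     continuous_on {a..b} \<gamma> \<and> \<gamma> ` {a..b} \<subseteq> M \<and>
     (\<exists>S. finite S \<and>
       (\<forall>s t. a \<le> s \<and> s \<le> t \<and> t \<le> b \<and> {s<..<t} \<inter> S = {} \<longrightarrow>
         (\<forall>c\<in>A. smooth_on ({s..t} \<inter> \<gamma> -` chart_dom c) (chart_map c \<circ> \<gamma>))))"


section \<open>Finsler metrics\<close>

text \<open>\<open>F p v\<close> is only meaningful for \<open>p \<in> M\<close> and \<open>v \<in> tangent_space A p\<close>.
  \<open>in_chart A F c x \<xi>\<close> is the expression of \<open>F\<close> in the coordinates \<open>(x, \<xi>)\<close> on the tangent bundle
  induced by the chart \<open>c\<close>.\<close>

definition in_chart :: "'a chart set \<Rightarrow> ('a \<Rightarrow> 'a tvec \<Rightarrow> real) \<Rightarrow> 'a chart \<Rightarrow>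
    real \<times> real \<Rightarrow> real \<times> real \<Rightarrow> real" where
  "in_chart A F c x \<xi> = F (chart_inv c x) (tangent_vector A c (chart_inv c x) \<xi>)"

definition second_derivative :: "('b::real_normed_vector \<Rightarrow> real) \<Rightarrow> 'b \<Rightarrow> 'b \<Rightarrow> 'b \<Rightarrow> real" where
  "second_derivative g x u w =
     frechet_derivative (\<lambda>y. frechet_derivative g (at y) u) (at x) w"

definition finsler_metric :: "'a::topological_space set \<Rightarrow> 'a chart set \<Rightarrow> ('a \<Rightarrow> 'a tvec \<Rightarrow> real) \<Rightarrow> bool" where
  "finsler_metric M A F \<longleftrightarrow>
     (\<forall>p\<in>M. \<forall>v\<in>tangent_space A p. 0 \<le> F p v) \<and>
     (\<forall>c\<in>A. continuous_on (chart_img c \<times> UNIV) (\<lambda>(x, \<xi>). in_chart A F c x \<xi>)) \<and>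
     (\<forall>c\<in>A. smooth_on (chart_img c \<times> (- {0})) (\<lambda>(x, \<xi>). in_chart A F c x \<xi>)) \<and>
     (\<forall>p\<in>M. \<forall>v\<in>tangent_space A p. \<forall>t. F p (\<lambda>d. t *\<^sub>R v d) = \<bar>t\<bar> * F p v) \<and>
     (\<forall>c\<in>A. \<forall>x\<in>chart_img c. \<forall>\<xi>. \<xi> \<noteq> 0 \<longrightarrow>
        (\<forall>w. w \<noteq> 0 \<longrightarrow> 0 < second_derivative (\<lambda>\<eta>. (in_chart A F c x \<eta>)\<^sup>2) \<xi> w w))"

definition finsler_cylinder :: "'a::topological_space set \<Rightarrow> 'a chart set \<Rightarrow> ('a \<Rightarrow> 'a tvec \<Rightarrow> real) \<Rightarrow> bool" where
  "finsler_cylinder C A F \<longleftrightarrow>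
     smooth_surface C A \<and> compact C \<and> diffeomorphic_to C A standard_cylinder \<and> finsler_metric C A F"


section \<open>Length, systole and height\<close>

definition curve_length :: "'a chart set \<Rightarrow> ('a \<Rightarrow> 'a tvec \<Rightarrow> real) \<Rightarrow> real \<Rightarrow> real \<Rightarrow> (real \<Rightarrow> 'a) \<Rightarrow> real" where
  "curve_length A F a b \<gamma> = integral {a..b} (\<lambda>t. F (\<gamma> t) (velocity A a b \<gamma> t))"

definition contractible_loop :: "'a::topological_space set \<Rightarrow> (real \<Rightarrow> 'a) \<Rightarrow> bool" where
  "contractible_loop M \<gamma> \<longleftrightarrow> (\<exists>p. homotopic_loops M \<gamma> (\<lambda>_. p))"

definition systole :: "'a::topological_space set \<Rightarrow> 'a chart set \<Rightarrow> ('a \<Rightarrow> 'a tvec \<Rightarrow> real) \<Rightarrow> real" where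
  "systole M A F = Inf {curve_length A F 0 1 \<gamma> |\<gamma>.
     piecewise_smooth M A 0 1 \<gamma> \<and> \<gamma> 0 = \<gamma> 1 \<and> \<not> contractible_loop M \<gamma>}"

definition trivial_rel_boundary :: "'a::topological_space set \<Rightarrow> 'a set \<Rightarrow> (real \<Rightarrow> 'a) \<Rightarrow> bool" where
  "trivial_rel_boundary M B \<gamma> \<longleftrightarrow>
     (\<exists>\<eta>. path \<eta> \<and> path_image \<eta> \<subseteq> B \<and>
       homotopic_with_canon (\<lambda>\<beta>. \<beta> 0 \<in> B \<and> \<beta> 1 \<in> B) {0..1} M \<gamma> \<eta>)"

definition height :: "'a::topological_space set \<Rightarrow> 'a chart set \<Rightarrow> ('a \<Rightarrow> 'a tvec \<Rightarrow> real) \<Rightarrow> real" where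
  "height M A F = Inf {curve_length A F 0 1 \<gamma> |\<gamma>.
     piecewise_smooth M A 0 1 \<gamma> \<and> \<gamma> 0 \<in> surface_boundary A \<and> \<gamma> 1 \<in> surface_boundary A \<and>
     \<not> trivial_rel_boundary M (surface_boundary A) \<gamma>}"


section \<open>Holmes--Thompson volume\<close>

text \<open>Covectors are written in the dual coordinates, so that evaluation is the inner product.\<close>

definition dual_norm :: "('b::real_inner \<Rightarrow> real) \<Rightarrow> 'b \<Rightarrow> real" where
  "dual_norm N f = (SUP v\<in>{v. N v \<le> 1}. f \<bullet> v)"

text \<open>In a chart, take for \<open>dx\<close> the coordinate volume form; the dual volume \<open>m\<^sup>*\<close> on covectors is then
  Lebesgue measure in the dual coordinates. Multiplying \<open>dx\<close> by a positive function divides \<open>m\<^sup>*\<close> by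
  it, so the density does not depend on this choice.\<close>

definition HT_density :: "'a chart set \<Rightarrow> ('a \<Rightarrow> 'a tvec \<Rightarrow> real) \<Rightarrow> 'a chart \<Rightarrow> real \<times> real \<Rightarrow> real" where
  "HT_density A F c x = measure lborel {f. dual_norm (in_chart A F c x) f \<le> 1} / pi"

text \<open>The integral of a density over a compact surface is computed by cutting the surface into
  finitely many Borel pieces, each in the domain of a chart; \<open>HT_volume\<close> is the common value of
  the resulting sums.\<close>

definition chart_partition :: "'a set \<Rightarrow> 'a chart set \<Rightarrow> nat \<Rightarrow> (nat \<Rightarrow> 'a chart) \<Rightarrow> (nat \<Rightarrow> 'a set) \<Rightarrow> bool" where
  "chart_partition M A n c B \<longleftrightarrow>
     (\<forall>i<n. c i \<in> A \<and> B i \<subseteq> chart_dom (c i) \<and> chart_map (c i) ` B i \<in> sets borel) \<and>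
     disjoint_family_on B {..<n} \<and> (\<Union>i<n. B i) = M"

definition HT_volume :: "'a set \<Rightarrow> 'a chart set \<Rightarrow> ('a \<Rightarrow> 'a tvec \<Rightarrow> real) \<Rightarrow> real" where
  "HT_volume M A F = (THE v. \<forall>n c B. chart_partition M A n c B \<longrightarrow>
     v = (\<Sum>i<n. set_lebesgue_integral lborel (chart_map (c i) ` B i) (HT_density A F (c i))))"

end

theory Submission
  imports Defs "HOL-Complex_Analysis.Winding_Numbers"
begin

text \<open>Pull the metric back to the universal cover \<open>\<real> \<times> [0,1]\<close>, where the deck transformation is
  \<open>x \<mapsto> x + (1,0)\<close>, and write \<open>L\<close> and \<open>h\<close> for systole and height. Let \<open>f\<close> be the distance to
  the bottom truncated at \<open>h\<close>, and let \<open>g x\<close> be the infimum over \<open>n\<close> of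
  \<open>d ((n,0), x) + n * L\<close>. Both are \<open>1\<close>-Lipschitz for the Finsler distance, \<open>f\<close> is periodic, and
  \<open>g (x + (1,0)) = g x + L\<close>. The infimum is finite because \<open>d (x, x + (n,0)) \<ge> n * L\<close>: a path from
  \<open>x\<close> to \<open>x + (2m,0)\<close> has a subpath from some \<open>y\<close> to \<open>y + (m,0)\<close>, which settles the powers of two,
  and subadditivity does the rest.

  The dual unit ball contains \<open>\<plusminus>df\<close> and \<open>\<plusminus>dg\<close>, hence a parallelogram of area \<open>2 * \<bar>df \<and> dg\<bar>\<close>, so that
  the volume is at least \<open>2 / pi\<close> times the integral of \<open>df \<and> dg = d (f dg)\<close> up to sign, which is
  \<open>h * L\<close> by Stokes. To have derivatives at all, \<open>f\<close> and \<open>g\<close> are first averaged over small squares;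
  this spoils the Lipschitz constant by a factor arbitrarily close to \<open>1\<close>.\<close>

text \<open>The definition of the systole bounds a loop of winding number \<open>n\<close> below by
  \<open>L\<close> only, so the growth \<open>n * L\<close> has to be extracted from planar
  topology. Lengths are measured on polygons in the strip. Systole and height are infima, so upper
  bounds by lengths of projected polygons are all that is required, and on polygons cutting,
  concatenation and translation preserve length exactly. A metric that varies from point to point is
  not invariant under the translations used for averaging; its uniform continuity, made relative by
  its positive minimum on unit vectors, is the source of the factor \<open>1 + \<eta>\<close>. The
  averaging squares extend forward, from \<open>z\<close> to
  \<open>z + (\<delta>, \<delta>)\<close>, and must stay in the strip, whence Stokes is applied for
  heights between \<open>\<delta>\<close> and \<open>1 - 2 * \<delta>\<close>. A box kernel is
  enough: the first partial derivatives of the average are differences of one-dimensional averages,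
  and the mixed second derivatives exist and agree, which is what Stokes asks.\<close>

section \<open>Logarithms, chords and winding numbers\<close>

lemma exp_constant_imp_endpoints_eq:
  fixes h :: "real \<Rightarrow> complex"
  assumes "continuous_on {0..1} h" "\<And>t. t \<in> {0..1} \<Longrightarrow> exp (h t) = K"
  shows "h 0 = h 1"
proof -
  have "h constant_on {0..1}"
  proof (rule continuous_discrete_range_constant)
    fix x :: real assume x: "x \<in> {0..1}"
    \<comment> \<open>Two logarithms of \<open>K\<close> differ by a multiple of
      \<open>2 * pi * \<i>\<close>, so distinct values of \<open>h\<close> are at least
      \<open>2 * pi\<close> apart and a continuous \<open>h\<close> cannot jump between
      them.\<close>
    have "2 * pi \<le> norm (h y - h x)" if y: "y \<in> {0..1}" "h y \<noteq> h x" for y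
    proof -
      obtain n :: int where n: "h y = h x + (of_int (2 * n) * pi) * \<i>"
        using assms(2)[OF x] assms(2)[OF y(1)] exp_eq by metis
      with y have "1 \<le> \<bar>n\<bar>" by auto
      then have "1 \<le> \<bar>real_of_int n\<bar>" by linarith
      then show ?thesis using n by (simp add: norm_mult)
    qed
    then show "\<exists>e>0. \<forall>y. y \<in> {0..1} \<and> h y \<noteq> h x \<longrightarrow> e \<le> norm (h y - h x)"
      by (intro exI[of _ "2 * pi"]) auto
  qed (use assms in auto)
  then show ?thesis by (auto simp: constant_on_def)
qed

text \<open>Otherwise \<open>u t - u s - c\<close> has a continuous logarithm \<open>w\<close> on the triangle \<open>s \<le> t\<close>. It is constant
  on the diagonal, and \<open>w (t,1) - w (0,t)\<close> is a constant odd multiple of \<open>\<i> * pi\<close> because the two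
  values differ by a sign; its values at \<open>t = 0\<close> and \<open>t = 1\<close> sum to zero, a contradiction.\<close>

lemma half_chord:
  fixes u :: "real \<Rightarrow> complex"
  assumes u: "continuous_on {0..1} u" and end1: "u 1 = u 0 + 2 * c" and c: "c \<noteq> 0"
  obtains s t where "0 \<le> s" "s \<le> t" "t \<le> 1" "u t = u s + c"
proof (rule ccontr)
  assume no: "\<not> thesis"
  note hyp = that
  define T where "T = {p::real \<times> real. 0 \<le> fst p \<and> fst p \<le> snd p \<and> snd p \<le> 1}"
  have T: "convex T"
    unfolding T_def convex_def
    by (auto intro!: add_nonneg_nonneg add_mono mult_left_mono convex_bound_le)
  have log1: "continuous_on T (\<lambda>p. u (snd p) - u (fst p) - c)"
    by (intro continuous_intros continuous_on_compose2[OF u]) (auto simp: T_def)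
  have log2: "u (snd p) - u (fst p) - c \<noteq> 0" if p: "p \<in> T" for p
  proof
    assume "u (snd p) - u (fst p) - c = 0"
    then have "u (snd p) = u (fst p) + c" by (simp add: algebra_simps)
    then show False
      using no hyp[of "fst p" "snd p"] p by (simp add: T_def)
  qed
  obtain w where w: "continuous_on T w"
    and ew: "\<And>p. p \<in> T \<Longrightarrow> u (snd p) - u (fst p) - c = exp (w p)"
    by (rule continuous_logarithm_on_contractible[OF log1 convex_imp_contractible[OF T] log2]) auto
  have d: "w (0,0) = w (1,1)"
  proof (rule exp_constant_imp_endpoints_eq[where h = "\<lambda>t. w (t,t)"])
    show "continuous_on {0..1} (\<lambda>t. w (t, t))"
      by (intro continuous_on_compose2[OF w] continuous_intros) (auto simp: T_def)
    show "exp (w (t,t)) = - c" if "t \<in> {0..1}" for t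
      using that ew[of "(t,t)"] by (auto simp: T_def)
  qed
  have e: "exp (w (t,1) - w (0,t)) = -1" if "t \<in> {0..1}" for t
  proof -
    have "exp (w (t,1)) = - exp (w (0,t))"
      using that ew[of "(t,1)", symmetric] ew[of "(0,t)", symmetric] end1 by (simp add: T_def)
    then show ?thesis by (simp add: exp_diff)
  qed
  have "w (0,1) - w (0,0) = w (1,1) - w (0,1)"
  proof (rule exp_constant_imp_endpoints_eq[where h = "\<lambda>t. w (t,1) - w (0,t)"])
    show "continuous_on {0..1} (\<lambda>t. w (t,1) - w (0,t))"
      by (intro continuous_on_compose2[OF w] continuous_intros) (auto simp: T_def)
  qed (use e in auto)
  with d have "2 * (w (0,1) - w (0,0)) = 0" by (simp add: algebra_simps)
  then have "w (0,1) - w (0,0) = 0" by simp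
  with e[of 0] show False by simp
qed

text \<open>The curve factors as \<open>exp \<circ> p\<close> with \<open>p\<close> on the imaginary
  axis, so its winding number about 0 is read off from the endpoints of \<open>p\<close> and equals
  \<open>k\<close>. A constant loop has winding number 0, and a homotopy inside the circle avoids
  0.\<close>

lemma cis_loop_noncontractible:
  assumes \<theta>: "continuous_on {0..1} \<theta>" and k: "\<theta> 1 = \<theta> 0 + of_int k" "k \<noteq> 0"
  shows "\<not> homotopic_loops (sphere 0 1) (\<lambda>t. cis (2 * pi * \<theta> t)) (\<lambda>_. z)"
proof
  define p where "p = (\<lambda>t. \<i> * complex_of_real (2 * pi * \<theta> t))"
  assume "homotopic_loops (sphere 0 1) (\<lambda>t. cis (2 * pi * \<theta> t)) (\<lambda>_. z)"
  moreover have "(\<lambda>t. cis (2 * pi * \<theta> t)) = exp \<circ> p"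
    by (auto simp: p_def cis_conv_exp)
  ultimately have H: "homotopic_loops (sphere 0 1) (exp \<circ> p) (\<lambda>_. z)" by simp
  then have "z \<in> sphere 0 1"
    using homotopic_loops_imp_subset by (fastforce simp: path_image_def)
  then have "winding_number (\<lambda>_. z) 0 = 0"
    by (intro winding_number_constI) auto
  moreover have "winding_number (exp \<circ> p) 0 = winding_number (\<lambda>_. z) 0"
    by (rule winding_number_homotopic_loops)
       (rule homotopic_loops_subset[OF H], auto)
  moreover have "path p"
    unfolding path_def p_def by (intro continuous_intros \<theta>)
  then have "winding_number (exp \<circ> p) 0 = (pathfinish p - pathstart p) / (2 * of_real pi * \<i>)"
    by (rule winding_number_compose_exp)
  moreover have "\<dots> = of_int k"
    by (simp add: p_def pathfinish_def pathstart_def k field_simps)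
  ultimately show False using k by simp
qed

subsection \<open>Mollification by a box kernel\<close>

definition slide1 :: "real \<Rightarrow> (real \<times> real \<Rightarrow> real) \<Rightarrow> real \<times> real \<Rightarrow> real" where
  "slide1 \<delta> \<phi> z = integral {0..\<delta>} (\<lambda>a. \<phi> (fst z + a, snd z))"

definition slide2 :: "real \<Rightarrow> (real \<times> real \<Rightarrow> real) \<Rightarrow> real \<times> real \<Rightarrow> real" where
  "slide2 \<delta> \<phi> z = integral {0..\<delta>} (\<lambda>b. \<phi> (fst z, snd z + b))"

text \<open>With a local antiderivative \<open>g\<close> of \<open>\<psi>\<close> the integral is
  \<open>g (y + \<delta>) - g y\<close> for \<open>y\<close> near \<open>x\<close>, so mere
  continuity of the integrand yields a derivative.\<close>

lemma has_derivative_sliding_integral: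
  fixes \<psi> :: "real \<Rightarrow> real"
  assumes \<psi>: "continuous_on UNIV \<psi>" and \<delta>: "0 < \<delta>"
  shows "((\<lambda>x. integral {0..\<delta>} (\<lambda>a. \<psi> (x + a))) has_real_derivative (\<psi> (x + \<delta>) - \<psi> x)) (at x)"
proof -
  \<comment> \<open>The margin 1 on both sides makes \<open>y\<close> and
    \<open>y + \<delta>\<close> interior points for all \<open>y\<close> near
    \<open>x\<close>.\<close>
  obtain g where g: "\<And>y. y \<in> {x-1..x+\<delta>+1} \<Longrightarrow> (g has_vector_derivative \<psi> y) (at y within {x-1..x+\<delta>+1})"
    using antiderivative_continuous[of "x-1" "x+\<delta>+1" \<psi>] continuous_on_subset[OF \<psi>] by blast
  have g': "(g has_real_derivative \<psi> y) (at y)" if "y \<in> {x-1<..<x+\<delta>+1}" for y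
    using g[of y] that at_within_interior[of y "{x-1..x+\<delta>+1}"]
    by (auto simp: has_real_derivative_iff_has_vector_derivative)
  have eq: "integral {0..\<delta>} (\<lambda>a. \<psi> (y + a)) = g (y + \<delta>) - g y" if y: "y \<in> {x-1<..<x+1}" for y
  proof -
    have "((\<lambda>a. \<psi> (y + a)) has_integral (g (y + \<delta>) - g (y + 0))) {0..\<delta>}"
    proof (rule fundamental_theorem_of_calculus)
      fix a assume a: "a \<in> {0..\<delta>}"
      have "((\<lambda>a. g (y + a)) has_real_derivative \<psi> (y + a) * (0 + 1)) (at a)"
        by (rule DERIV_chain2[OF g']) (use y a in \<open>auto intro!: derivative_eq_intros\<close>)
      then show "((\<lambda>a. g (y + a)) has_vector_derivative \<psi> (y + a)) (at a within {0..\<delta>})"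
        by (simp add: has_real_derivative_iff_has_vector_derivative has_vector_derivative_at_within)
    qed (use \<delta> in auto)
    then show ?thesis by (simp add: integral_unique)
  qed
  have "((\<lambda>y. g (y + \<delta>) - g y) has_real_derivative (\<psi> (x + \<delta>) * (1 + 0) - \<psi> x)) (at x)"
    by (intro DERIV_diff DERIV_chain2[OF g'] g') (use \<delta> in \<open>auto intro!: derivative_eq_intros\<close>)
  then have d: "((\<lambda>y. g (y + \<delta>) - g y) has_real_derivative (\<psi> (x + \<delta>) - \<psi> x)) (at x)" by simp
  show ?thesis
    by (rule has_field_derivative_transform_within_open[OF d, of "{x-1<..<x+1}"]) (use eq in auto)
qed

lemma slide1_derivative:
  assumes "continuous_on UNIV \<phi>" "0 < \<delta>"
  shows "((\<lambda>x. slide1 \<delta> \<phi> (x, y)) has_real_derivative (\<phi> (x + \<delta>, y) - \<phi> (x, y))) (at x)"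
  unfolding slide1_def fst_conv snd_conv
  by (rule has_derivative_sliding_integral[where \<psi> = "\<lambda>x. \<phi> (x, y)"])
     (use assms in \<open>auto intro!: continuous_on_compose2[OF assms(1)] continuous_intros\<close>)

lemma slide2_derivative:
  assumes "continuous_on UNIV \<phi>" "0 < \<delta>"
  shows "((\<lambda>y. slide2 \<delta> \<phi> (x, y)) has_real_derivative (\<phi> (x, y + \<delta>) - \<phi> (x, y))) (at y)"
  unfolding slide2_def fst_conv snd_conv
  by (rule has_derivative_sliding_integral[where \<psi> = "\<lambda>y. \<phi> (x, y)"])
     (use assms in \<open>auto intro!: continuous_on_compose2[OF assms(1)] continuous_intros\<close>)

lemma continuous_slide1: "continuous_on UNIV \<phi> \<Longrightarrow> continuous_on UNIV (slide1 \<delta> \<phi>)"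
  unfolding slide1_def[abs_def] box_real(2)[symmetric]
  by (rule integral_continuous_on_param)
     (auto simp: case_prod_unfold intro!: continuous_on_compose2[of UNIV \<phi>] continuous_intros)

lemma continuous_slide2: "continuous_on UNIV \<phi> \<Longrightarrow> continuous_on UNIV (slide2 \<delta> \<phi>)"
  unfolding slide2_def[abs_def] box_real(2)[symmetric]
  by (rule integral_continuous_on_param)
     (auto simp: case_prod_unfold intro!: continuous_on_compose2[of UNIV \<phi>] continuous_intros)

text \<open>Fubini for continuous functions; it lets either coordinate be the outermost integral,
  which is the one that gets differentiated.\<close>

lemma slide_commute:
  assumes "continuous_on UNIV \<phi>"
  shows "slide2 \<delta> (slide1 \<delta> \<phi>) = slide1 \<delta> (slide2 \<delta> \<phi>)"
proof
  fix z
  show "slide2 \<delta> (slide1 \<delta> \<phi>) z = slide1 \<delta> (slide2 \<delta> \<phi>) z"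
    unfolding slide1_def slide2_def fst_conv snd_conv box_real(2)[symmetric]
    by (rule integral_swap_continuous)
       (auto simp: case_prod_unfold intro!: continuous_on_compose2[OF assms] continuous_intros)
qed

definition mollify :: "real \<Rightarrow> (real \<times> real \<Rightarrow> real) \<Rightarrow> real \<times> real \<Rightarrow> real" where
  "mollify \<delta> \<phi> z = slide2 \<delta> (slide1 \<delta> \<phi>) z / \<delta>\<^sup>2"

text \<open>\<open>moll1\<close>, \<open>moll2\<close> and \<open>moll12\<close> are the first
  partial derivatives of \<open>mollify\<close> and their common mixed derivative in closed form:
  differentiating a slide leaves the difference of its end values, and the other slide
  remains.\<close>

definition moll1 :: "real \<Rightarrow> (real \<times> real \<Rightarrow> real) \<Rightarrow> real \<times> real \<Rightarrow> real" where
  "moll1 \<delta> \<phi> z = (slide2 \<delta> \<phi> (fst z + \<delta>, snd z) - slide2 \<delta> \<phi> z) / \<delta>\<^sup>2"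

definition moll2 :: "real \<Rightarrow> (real \<times> real \<Rightarrow> real) \<Rightarrow> real \<times> real \<Rightarrow> real" where
  "moll2 \<delta> \<phi> z = (slide1 \<delta> \<phi> (fst z, snd z + \<delta>) - slide1 \<delta> \<phi> z) / \<delta>\<^sup>2"

definition moll12 :: "real \<Rightarrow> (real \<times> real \<Rightarrow> real) \<Rightarrow> real \<times> real \<Rightarrow> real" where
  "moll12 \<delta> \<phi> z = (\<phi> (fst z + \<delta>, snd z + \<delta>) - \<phi> (fst z + \<delta>, snd z) - \<phi> (fst z, snd z + \<delta>) + \<phi> z) / \<delta>\<^sup>2"

context
  fixes \<phi> :: "real \<times> real \<Rightarrow> real" and \<delta> :: real
  assumes \<phi>: "continuous_on UNIV \<phi>" and \<delta>: "0 < \<delta>"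
begin

lemma mollify_deriv1: "((\<lambda>x. mollify \<delta> \<phi> (x, y)) has_real_derivative moll1 \<delta> \<phi> (x, y)) (at x)"
  unfolding mollify_def moll1_def slide_commute[OF \<phi>] fst_conv snd_conv
  by (intro DERIV_cdivide slide1_derivative continuous_slide2 \<phi> \<delta>)

lemma mollify_deriv2: "((\<lambda>y. mollify \<delta> \<phi> (x, y)) has_real_derivative moll2 \<delta> \<phi> (x, y)) (at y)"
  unfolding mollify_def moll2_def fst_conv snd_conv
  by (intro DERIV_cdivide slide2_derivative continuous_slide1 \<phi> \<delta>)

lemma moll1_deriv2: "((\<lambda>y. moll1 \<delta> \<phi> (x, y)) has_real_derivative moll12 \<delta> \<phi> (x, y)) (at y)"
proof -
  have "((\<lambda>y. (slide2 \<delta> \<phi> (x + \<delta>, y) - slide2 \<delta> \<phi> (x, y)) / \<delta>\<^sup>2) has_real_derivative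
     ((\<phi> (x + \<delta>, y + \<delta>) - \<phi> (x + \<delta>, y)) - (\<phi> (x, y + \<delta>) - \<phi> (x, y))) / \<delta>\<^sup>2) (at y)"
    by (intro DERIV_cdivide DERIV_diff slide2_derivative \<phi> \<delta>)
  then show ?thesis by (simp add: moll1_def moll12_def algebra_simps)
qed

lemma moll2_deriv1: "((\<lambda>x. moll2 \<delta> \<phi> (x, y)) has_real_derivative moll12 \<delta> \<phi> (x, y)) (at x)"
proof -
  have "((\<lambda>x. (slide1 \<delta> \<phi> (x, y + \<delta>) - slide1 \<delta> \<phi> (x, y)) / \<delta>\<^sup>2) has_real_derivative
     ((\<phi> (x + \<delta>, y + \<delta>) - \<phi> (x, y + \<delta>)) - (\<phi> (x + \<delta>, y) - \<phi> (x, y))) / \<delta>\<^sup>2) (at x)"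
    by (intro DERIV_cdivide DERIV_diff slide1_derivative \<phi> \<delta>)
  then show ?thesis by (simp add: moll2_def moll12_def algebra_simps)
qed

lemma continuous_mollify: "continuous_on UNIV (mollify \<delta> \<phi>)"
  unfolding mollify_def[abs_def]
  by (intro continuous_intros continuous_slide1 continuous_slide2 \<phi>) (use \<delta> in auto)

lemma continuous_moll1: "continuous_on UNIV (moll1 \<delta> \<phi>)"
  unfolding moll1_def[abs_def]
  by (intro continuous_intros continuous_slide2 continuous_on_compose2[OF continuous_slide2] \<phi>)
     (use \<delta> in auto)

lemma continuous_moll2: "continuous_on UNIV (moll2 \<delta> \<phi>)"
  unfolding moll2_def[abs_def]
  by (intro continuous_intros continuous_slide1 continuous_on_compose2[OF continuous_slide1] \<phi>)
     (use \<delta> in auto)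

lemma continuous_moll12: "continuous_on UNIV (moll12 \<delta> \<phi>)"
  unfolding moll12_def[abs_def]
  by (intro continuous_intros continuous_on_compose2[OF \<phi>]) (use \<delta> in auto)

text \<open>Continuity of the partial derivatives upgrades them to a total derivative. The second
  partial is passed as a bounded linear function because the criterion asks for its continuity in
  that form.\<close>

lemma mollify_has_derivative:
  "(mollify \<delta> \<phi> has_derivative (\<lambda>v. fst v * moll1 \<delta> \<phi> z + snd v * moll2 \<delta> \<phi> z)) (at z)"
proof -
  obtain x y where z: "z = (x, y)" by (cases z)
  have "((\<lambda>(x, y). mollify \<delta> \<phi> (x, y)) has_derivative
      (\<lambda>(tx, ty). moll1 \<delta> \<phi> (x, y) * tx + blinfun_scaleR_left (moll2 \<delta> \<phi> (x, y)) ty))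
      (at (x, y) within UNIV \<times> UNIV)"
  proof (rule has_derivative_partialsI)
    show "((\<lambda>x. mollify \<delta> \<phi> (x, y)) has_derivative (\<lambda>tx. moll1 \<delta> \<phi> (x, y) * tx)) (at x within UNIV)"
      using mollify_deriv1 by (simp add: has_field_derivative_def)
    show "((\<lambda>y. mollify \<delta> \<phi> (x, y)) has_derivative
        blinfun_apply (blinfun_scaleR_left (moll2 \<delta> \<phi> (x, y)))) (at y within UNIV)" for x y
      by (rule has_derivative_eq_rhs[OF mollify_deriv2[unfolded has_field_derivative_def]])
         (auto simp: mult.commute)
    have "isCont (\<lambda>z. blinfun_scaleR_left (moll2 \<delta> \<phi> z)) (x, y)"
      by (intro continuous_intros bounded_linear.isCont[OF bounded_linear_blinfun_scaleR_left])
         (use continuous_moll2 in \<open>auto simp: continuous_on_eq_continuous_at\<close>)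
    then show "continuous (at (x, y) within UNIV \<times> UNIV) (\<lambda>(x, y). blinfun_scaleR_left (moll2 \<delta> \<phi> (x, y)))"
      by (simp add: case_prod_unfold)
  qed auto
  then show ?thesis
    by (simp add: z case_prod_unfold mult.commute)
qed

end

section \<open>Green's formula on a rectangle\<close>

text \<open>Stokes for the form \<open>P dQ\<close>. The mixed second derivative of \<open>Q\<close>
  cancels between the two iterated integrals, which is why one common \<open>Qxy\<close> is demanded
  for both orders of differentiation.\<close>

lemma integral_jacobian_rectangle:
  fixes P :: "real \<times> real \<Rightarrow> real"
  assumes ab: "a \<le> b" and cd: "c \<le> d"
    and Px: "\<And>x y. ((\<lambda>x. P (x, y)) has_real_derivative Px (x, y)) (at x)"
    and Py: "\<And>x y. ((\<lambda>y. P (x, y)) has_real_derivative Py (x, y)) (at y)"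
    and Qxy: "\<And>x y. ((\<lambda>y. Qx (x, y)) has_real_derivative Qxy (x, y)) (at y)"
    and Qyx: "\<And>x y. ((\<lambda>x. Qy (x, y)) has_real_derivative Qxy (x, y)) (at x)"
    and cont: "continuous_on UNIV P" "continuous_on UNIV Px" "continuous_on UNIV Py"
      "continuous_on UNIV Qx" "continuous_on UNIV Qy" "continuous_on UNIV Qxy"
  shows "integral (cbox (a, c) (b, d)) (\<lambda>z. Px z * Qy z - Py z * Qx z) =
     integral {c..d} (\<lambda>y. P (b, y) * Qy (b, y) - P (a, y) * Qy (a, y)) -
     integral {a..b} (\<lambda>x. P (x, d) * Qx (x, d) - P (x, c) * Qx (x, c))"
proof -
  let ?R = "cbox (a, c) (b, d)"
  note cont' = continuous_on_subset[OF cont(1) subset_UNIV] continuous_on_subset[OF cont(2) subset_UNIV]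
    continuous_on_subset[OF cont(3) subset_UNIV] continuous_on_subset[OF cont(4) subset_UNIV]
    continuous_on_subset[OF cont(5) subset_UNIV] continuous_on_subset[OF cont(6) subset_UNIV]
  \<comment> \<open>Adding \<open>P * Qxy\<close> to both terms makes \<open>U\<close> the
    \<open>x\<close>-derivative of \<open>P * Qy\<close> and \<open>V\<close> the
    \<open>y\<close>-derivative of \<open>P * Qx\<close>.\<close>
  define U where "U = (\<lambda>z. Px z * Qy z + P z * Qxy z)"
  define V where "V = (\<lambda>z. Py z * Qx z + P z * Qxy z)"
  have cU: "continuous_on X U" for X unfolding U_def by (intro continuous_intros cont')
  have cV: "continuous_on X V" for X unfolding V_def by (intro continuous_intros cont')
  have "integral ?R (\<lambda>z. Px z * Qy z - Py z * Qx z) = integral ?R (\<lambda>z. U z - V z)"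
    by (rule arg_cong[where f = "integral _"]) (auto simp: U_def V_def)
  also have "\<dots> = integral ?R U - integral ?R V"
    by (intro integral_diff integrable_continuous cU cV)
  also have "integral ?R V = integral (cbox a b) (\<lambda>x. integral (cbox c d) (\<lambda>y. V (x, y)))"
    by (rule integral_prod_continuous[OF cV])
  also have "\<dots> = integral {a..b} (\<lambda>x. P (x, d) * Qx (x, d) - P (x, c) * Qx (x, c))"
  proof (simp, rule integral_cong, rule integral_unique)
    fix x
    show "((\<lambda>y. V (x, y)) has_integral P (x, d) * Qx (x, d) - P (x, c) * Qx (x, c)) {c..d}"
    proof (rule fundamental_theorem_of_calculus[OF cd])
      fix y
      have "((\<lambda>y. P (x, y) * Qx (x, y)) has_real_derivative V (x, y)) (at y)"
        unfolding V_def by (rule DERIV_cong[OF DERIV_mult[OF Py Qxy]]) (simp add: algebra_simps)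
      then show "((\<lambda>y. P (x, y) * Qx (x, y)) has_vector_derivative V (x, y)) (at y within {c..d})"
        by (simp add: has_real_derivative_iff_has_vector_derivative has_vector_derivative_at_within)
    qed
  qed
  also have "integral ?R U = integral (cbox a b) (\<lambda>x. integral (cbox c d) (\<lambda>y. U (x, y)))"
    by (rule integral_prod_continuous[OF cU])
  also have "\<dots> = integral (cbox c d) (\<lambda>y. integral (cbox a b) (\<lambda>x. U (x, y)))"
    by (rule integral_swap_continuous) (auto simp: case_prod_unfold cU)
  also have "\<dots> = integral {c..d} (\<lambda>y. P (b, y) * Qy (b, y) - P (a, y) * Qy (a, y))"
  proof (simp, rule integral_cong, rule integral_unique)
    fix y
    show "((\<lambda>x. U (x, y)) has_integral P (b, y) * Qy (b, y) - P (a, y) * Qy (a, y)) {a..b}"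
    proof (rule fundamental_theorem_of_calculus[OF ab])
      fix x
      have "((\<lambda>x. P (x, y) * Qy (x, y)) has_real_derivative U (x, y)) (at x)"
        unfolding U_def by (rule DERIV_cong[OF DERIV_mult[OF Px Qyx]]) (simp add: algebra_simps)
      then show "((\<lambda>x. P (x, y) * Qy (x, y)) has_vector_derivative U (x, y)) (at x within {a..b})"
        by (simp add: has_real_derivative_iff_has_vector_derivative has_vector_derivative_at_within)
    qed
  qed
  finally show ?thesis .
qed

subsection \<open>Change of variables and polar bodies in the plane\<close>

text \<open>Charts take values in \<open>real \<times> real\<close>, whereas determinants and the
  change of variables theorem live on \<open>real ^ 2\<close>; \<open>to_vec\<close> and
  \<open>of_vec\<close> carry statements across.\<close>

definition to_vec :: "real \<times> real \<Rightarrow> real ^ 2" where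
  "to_vec p = (\<chi> i. if i = 1 then fst p else snd p)"

definition of_vec :: "real ^ 2 \<Rightarrow> real \<times> real" where
  "of_vec v = (v $ 1, v $ 2)"

lemma of_to_vec [simp]: "of_vec (to_vec p) = p"
  by (simp add: to_vec_def of_vec_def)

lemma to_of_vec [simp]: "to_vec (of_vec v) = v"
  using exhaust_2 by (auto simp: to_vec_def of_vec_def vec_eq_iff)

lemma linear_to_vec: "linear to_vec"
  by (rule linearI) (auto simp: to_vec_def vec_eq_iff)

lemma linear_of_vec: "linear of_vec"
  by (rule linearI) (auto simp: of_vec_def)

lemma of_vec_vimage_eq: "of_vec -` X = to_vec ` X"
proof (intro set_eqI iffI)
  fix v assume "v \<in> of_vec -` X"
  then show "v \<in> to_vec ` X" by (intro image_eqI[of _ _ "of_vec v"]) auto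
qed auto

lemma borel_measurable_of_vec [measurable]: "of_vec \<in> borel_measurable borel"
  using linear_of_vec by (intro borel_measurable_continuous_onI linear_continuous_on linear_conv_bounded_linear[THEN iffD1])

text \<open>A measure that gives every box the product of its side lengths is Lebesgue measure, and
  \<open>of_vec\<close> matches boxes with boxes of the same sides.\<close>

lemma lborel_eq_distr_of_vec: "lborel = distr lborel borel of_vec"
proof (rule lborel_eqI)
  fix l u :: "real \<times> real"
  assume lu: "\<And>b. b \<in> Basis \<Longrightarrow> l \<bullet> b \<le> u \<bullet> b"
  have le: "fst l \<le> fst u" "snd l \<le> snd u"
    using lu[of "(1,0)"] lu[of "(0,1)"] by (auto simp: Basis_prod_def inner_prod_def)
  have box: "of_vec -` box l u = box (to_vec l) (to_vec u)"
    by (cases l; cases u) (auto simp: of_vec_def to_vec_def mem_box_cart forall_2 box_prod)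
  have B: "(\<Prod>b\<in>Basis. (to_vec u - to_vec l) \<bullet> b) = (fst u - fst l) * (snd u - snd l)"
  proof -
    have B: "(Basis :: (real ^ 2) set) = {axis 1 1, axis 2 1}"
      by (auto simp: Basis_vec_def UNIV_2)
    show ?thesis
      unfolding B by (simp add: axis_eq_axis inner_axis to_vec_def)
  qed
  have B': "(\<Prod>b\<in>Basis. (u - l) \<bullet> b) = (fst u - fst l) * (snd u - snd l)"
  proof -
    have B: "(Basis :: (real \<times> real) set) = {(1,0), (0,1)}"
      by (auto simp: Basis_prod_def)
    show ?thesis unfolding B by (simp add: inner_prod_def)
  qed
  have "emeasure (distr lborel borel of_vec) (box l u) = emeasure lborel (box (to_vec l) (to_vec u))"
    by (subst emeasure_distr) (auto simp: box)
  also have "\<dots> = (\<Prod>b\<in>Basis. (to_vec u - to_vec l) \<bullet> b)"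
    by (rule emeasure_lborel_box) (use le in \<open>auto simp: Basis_vec_def inner_axis to_vec_def\<close>)
  finally show "emeasure (distr lborel borel of_vec) (box l u) = (\<Prod>b\<in>Basis. (u - l) \<bullet> b)"
    by (simp add: B B')
qed auto

definition jac :: "(real \<times> real \<Rightarrow> real \<times> real) \<Rightarrow> real" where
  "jac T = fst (T (1,0)) * snd (T (0,1)) - fst (T (0,1)) * snd (T (1,0))"

lemma to_vec_axis: "of_vec (axis 1 1) = (1,0)" "of_vec (axis 2 1) = (0,1)"
  by (auto simp: of_vec_def axis_def)

lemma det_matrix_eq_jac: "det (matrix (to_vec \<circ> T \<circ> of_vec)) = jac T"
  by (simp add: det_2 matrix_def jac_def to_vec_axis) (simp add: to_vec_def)

lemma integrable_lborel_plane_iff: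
  fixes f :: "real \<times> real \<Rightarrow> real"
  assumes "f \<in> borel_measurable borel"
  shows "integrable lborel f \<longleftrightarrow> integrable lborel (f \<circ> of_vec)"
    and "integral\<^sup>L lborel f = integral\<^sup>L lborel (f \<circ> of_vec)"
proof -
  show "integrable lborel f \<longleftrightarrow> integrable lborel (f \<circ> of_vec)"
    by (subst lborel_eq_distr_of_vec, subst integrable_distr_eq) (use assms in \<open>auto simp: o_def\<close>)
  show "integral\<^sup>L lborel f = integral\<^sup>L lborel (f \<circ> of_vec)"
    by (subst lborel_eq_distr_of_vec, subst integral_distr) (use assms in \<open>auto simp: o_def\<close>)
qed

lemma absolutely_integrable_on_borel_iff:
  fixes f :: "'a::euclidean_space \<Rightarrow> real"
  assumes "(\<lambda>x. indicator S x * f x) \<in> borel_measurable borel"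
  shows "f absolutely_integrable_on S \<longleftrightarrow> integrable lborel (\<lambda>x. indicator S x * f x)"
  unfolding set_integrable_def by (subst integrable_completion) (use assms in auto)

lemma integral_on_borel_eq:
  fixes f :: "'a::euclidean_space \<Rightarrow> real"
  assumes "integrable lborel (\<lambda>x. indicator S x * f x)"
  shows "integral S f = integral\<^sup>L lborel (\<lambda>x. indicator S x * f x)"
  using set_borel_integral_eq_integral(2)[of S f] assms
  by (simp add: set_integrable_def set_lebesgue_integral_def)

text \<open>Conjugation with \<open>to_vec\<close> reduces this to \<open>real ^ 2\<close>.
  Derivatives are taken within \<open>S\<close>, which need not be open, because pieces of a surface
  with boundary are not; indicators under \<open>lborel\<close> match the way volumes are
  defined.\<close>

lemma plane_change_of_variables:
  fixes f :: "real \<times> real \<Rightarrow> real" and g :: "real \<times> real \<Rightarrow> real \<times> real"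
  assumes S: "S \<in> sets borel"
    and g': "\<And>x. x \<in> S \<Longrightarrow> (g has_derivative g' x) (at x within S)"
    and inj: "inj_on g S"
    and f: "(\<lambda>y. indicator (g ` S) y * f y) \<in> borel_measurable borel"
    and int: "integrable lborel (\<lambda>x. indicator S x * (\<bar>jac (g' x)\<bar> * f (g x)))"
  shows "integrable lborel (\<lambda>y. indicator (g ` S) y * f y)"
    and "integral\<^sup>L lborel (\<lambda>y. indicator (g ` S) y * f y) =
         integral\<^sup>L lborel (\<lambda>x. indicator S x * (\<bar>jac (g' x)\<bar> * f (g x)))"
proof -
  define S2 where "S2 = to_vec ` S"
  define g2 where "g2 = to_vec \<circ> g \<circ> of_vec"
  define g2' where "g2' = (\<lambda>v. to_vec \<circ> g' (of_vec v) \<circ> of_vec)"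
  define f2 where "f2 = f \<circ> of_vec"
  have im: "g2 ` S2 = to_vec ` (g ` S)"
    by (force simp: g2_def S2_def)
  have mem: "to_vec p \<in> to_vec ` X \<longleftrightarrow> p \<in> X" for p X
    by (metis image_iff of_to_vec)
  have ind: "indicator (to_vec ` X) v = (indicator X (of_vec v) :: real)" for X v
    using mem[of "of_vec v" X] by (simp add: indicator_def)
  have S2: "S2 \<in> sets borel"
    unfolding S2_def of_vec_vimage_eq[symmetric] using measurable_sets[OF borel_measurable_of_vec S] by simp
  have m1: "(\<lambda>x. indicator S2 x * (\<bar>det (matrix (g2' x))\<bar> * f2 (g2 x))) =
      (\<lambda>x. indicator S x * (\<bar>jac (g' x)\<bar> * f (g x))) \<circ> of_vec"
    by (auto simp: fun_eq_iff S2_def ind g2'_def det_matrix_eq_jac f2_def g2_def)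
  have m2: "(\<lambda>y. indicator (g2 ` S2) y * f2 y) = (\<lambda>y. indicator (g ` S) y * f y) \<circ> of_vec"
    by (auto simp: fun_eq_iff im ind f2_def)
  have mint: "(\<lambda>x. indicator S x * (\<bar>jac (g' x)\<bar> * f (g x))) \<in> borel_measurable borel"
    using borel_measurable_integrable[OF int] by simp
  have bm1: "(\<lambda>x. indicator S2 x * (\<bar>det (matrix (g2' x))\<bar> * f2 (g2 x))) \<in> borel_measurable borel"
    unfolding m1 using measurable_comp[OF borel_measurable_of_vec mint] by (simp add: o_def)
  have bm2: "(\<lambda>y. indicator (g2 ` S2) y * f2 y) \<in> borel_measurable borel"
    unfolding m2 using measurable_comp[OF borel_measurable_of_vec f] by (simp add: o_def)
  have I1: "integrable lborel (\<lambda>x. indicator S2 x * (\<bar>det (matrix (g2' x))\<bar> * f2 (g2 x)))"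
    unfolding m1 by (rule integrable_lborel_plane_iff(1)[OF mint, THEN iffD1, OF int])
  have der2: "(g2 has_derivative g2' v) (at v within S2)" if v: "v \<in> S2" for v
  proof -
    obtain x where x: "x \<in> S" "v = to_vec x" using v unfolding S2_def by blast
    have oS: "of_vec ` S2 = S" unfolding S2_def by force
    have d1: "(of_vec has_derivative of_vec) (at v within S2)"
      by (rule linear_imp_has_derivative[OF linear_of_vec])
    have d2: "(g has_derivative g' x) (at (of_vec v) within of_vec ` S2)"
      using g'[OF x(1)] x oS by simp
    have d3: "((g \<circ> of_vec) has_derivative (g' x \<circ> of_vec)) (at v within S2)"
      by (rule diff_chain_within[OF d1 d2])
    have d4: "(to_vec has_derivative to_vec) (at ((g \<circ> of_vec) v) within (g \<circ> of_vec) ` S2)"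
      by (rule linear_imp_has_derivative[OF linear_to_vec])
    show ?thesis
      using diff_chain_within[OF d3 d4] x by (simp only: g2_def g2'_def o_assoc of_to_vec)
  qed
  have inj2: "inj_on g2 S2"
    unfolding inj_on_def g2_def S2_def
    using inj by (auto simp: inj_on_def) (metis of_to_vec)
  have S2l: "S2 \<in> sets lebesgue" using S2 by simp
  \<comment> \<open>The theorem speaks of vector-valued functions, hence the passage through
    \<open>real ^ 1\<close>. Its equivalence for every \<open>b\<close> transports integrability and
    the value of the integral at once.\<close>
  have CV: "(\<lambda>x. \<bar>det (matrix (g2' x))\<bar> *\<^sub>R (vec (f2 (g2 x)) :: real ^ 1)) absolutely_integrable_on S2 \<and>
           integral S2 (\<lambda>x. \<bar>det (matrix (g2' x))\<bar> *\<^sub>R (vec (f2 (g2 x)) :: real ^ 1)) = vec b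
     \<longleftrightarrow> (\<lambda>v. vec (f2 v) :: real ^ 1) absolutely_integrable_on (g2 ` S2) \<and>
         integral (g2 ` S2) (\<lambda>v. vec (f2 v) :: real ^ 1) = vec b" for b
    by (rule has_absolute_integral_change_of_variables[OF S2l der2 inj2])
  have CV': "(\<lambda>x. \<bar>det (matrix (g2' x))\<bar> * f2 (g2 x)) absolutely_integrable_on S2 \<and>
           integral S2 (\<lambda>x. \<bar>det (matrix (g2' x))\<bar> * f2 (g2 x)) = b
     \<longleftrightarrow> f2 absolutely_integrable_on (g2 ` S2) \<and> integral (g2 ` S2) f2 = b" for b
    using CV[of b] by (simp add: absolutely_integrable_on_1_iff integral_on_1_eq)
  have "(\<lambda>x. \<bar>det (matrix (g2' x))\<bar> * f2 (g2 x)) absolutely_integrable_on S2"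
    using I1 absolutely_integrable_on_borel_iff[OF bm1] by simp
  then have A2: "f2 absolutely_integrable_on (g2 ` S2)"
    and eq: "integral (g2 ` S2) f2 = integral S2 (\<lambda>x. \<bar>det (matrix (g2' x))\<bar> * f2 (g2 x))"
    using CV' by blast+
  have I2: "integrable lborel (\<lambda>y. indicator (g2 ` S2) y * f2 y)"
    using A2 absolutely_integrable_on_borel_iff[OF bm2] by simp
  show "integrable lborel (\<lambda>y. indicator (g ` S) y * f y)"
    using I2 integrable_lborel_plane_iff(1)[OF f] by (simp add: m2)
  have "integral\<^sup>L lborel (\<lambda>y. indicator (g ` S) y * f y) = integral\<^sup>L lborel (\<lambda>y. indicator (g2 ` S2) y * f2 y)"
    unfolding m2 by (rule integrable_lborel_plane_iff(2)[OF f])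
  also have "\<dots> = integral\<^sup>L lborel (\<lambda>x. indicator S2 x * (\<bar>det (matrix (g2' x))\<bar> * f2 (g2 x)))"
    using eq integral_on_borel_eq[OF I2] integral_on_borel_eq[OF I1] by simp
  also have "\<dots> = integral\<^sup>L lborel (\<lambda>x. indicator S x * (\<bar>jac (g' x)\<bar> * f (g x)))"
    unfolding m1 by (rule integrable_lborel_plane_iff(2)[OF mint, symmetric])
  finally show "integral\<^sup>L lborel (\<lambda>y. indicator (g ` S) y * f y) =
         integral\<^sup>L lborel (\<lambda>x. indicator S x * (\<bar>jac (g' x)\<bar> * f (g x)))" .
qed

lemma measure_plane_linear_image:
  assumes T: "linear T" "inj T" and S: "compact S"
  shows "measure lborel (T ` S) = \<bar>jac T\<bar> * measure lborel S"
proof -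
  have cT: "continuous_on S T" using T by (simp add: linear_continuous_on linear_conv_bounded_linear)
  have S': "S \<in> sets borel" and TS: "T ` S \<in> sets borel"
    using S compact_continuous_image[OF cT S] by (auto intro: borel_compact)
  have fin: "emeasure lborel S < \<infinity>"
    using S by (rule emeasure_compact_finite)
  have 1: "integrable lborel (\<lambda>x. indicator S x * (\<bar>jac T\<bar> * 1))"
    using S' fin by (intro integrable_mult_left integrable_real_indicator) auto
  have "integral\<^sup>L lborel (\<lambda>y. indicator (T ` S) y * 1) =
         integral\<^sup>L lborel (\<lambda>x. indicator S x * (\<bar>jac T\<bar> * 1))"
    by (rule plane_change_of_variables(2)[where g' = "\<lambda>_. T"])
       (use 1 S' TS T in \<open>auto intro: linear_imp_has_derivative inj_on_subset\<close>)
  then show ?thesis using S' TS by (simp add: mult.commute)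
qed

section \<open>Norms on the plane and their polar bodies\<close>

text \<open>The unit ball of the dual norm, written by inequalities so that inclusions and linear
  images can be checked vector by vector; \<open>dual_ball_eq_polar_body\<close> ties it to the
  supremum.\<close>

definition polar_body :: "(real \<times> real \<Rightarrow> real) \<Rightarrow> (real \<times> real) set" where
  "polar_body N = {f. \<forall>v. f \<bullet> v \<le> N v}"

lemma polar_bodyI: "(\<And>v. f \<bullet> v \<le> N v) \<Longrightarrow> f \<in> polar_body N"
  by (simp add: polar_body_def)

lemma polar_bodyD: "f \<in> polar_body N \<Longrightarrow> f \<bullet> v \<le> N v"
  unfolding polar_body_def by blast

definition normlike :: "(real \<times> real \<Rightarrow> real) \<Rightarrow> bool" where
  "normlike N \<longleftrightarrow> continuous_on UNIV N \<and> (\<forall>t v. N (t *\<^sub>R v) = \<bar>t\<bar> * N v) \<and> (\<forall>v. v \<noteq> 0 \<longrightarrow> 0 < N v)"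

lemma normlike_scale: "normlike N \<Longrightarrow> N (t *\<^sub>R v) = \<bar>t\<bar> * N v"
  unfolding normlike_def by blast

lemma normlike_pos: "normlike N \<Longrightarrow> v \<noteq> 0 \<Longrightarrow> 0 < N v"
  unfolding normlike_def by blast

lemma normlike_zero: "normlike N \<Longrightarrow> N 0 = 0"
  using normlike_scale[of N 0 0] by simp

lemma normlike_nonneg: "normlike N \<Longrightarrow> 0 \<le> N v"
  by (cases "v = 0") (auto simp: normlike_pos normlike_zero less_imp_le)

lemma normlike_minus: "normlike N \<Longrightarrow> N (- v) = N v"
  using normlike_scale[of N "-1" v] by simp

text \<open>Continuity gives a positive minimum on the unit circle, and homogeneity spreads it over
  the plane.\<close>

lemma normlike_lower:
  assumes "normlike N"
  obtains m where "0 < m" "\<And>v. m * norm v \<le> N v"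
proof -
  have ne: "sphere (0::real \<times> real) 1 \<noteq> {}" by simp
  obtain u where u: "u \<in> sphere 0 1" "\<And>v. v \<in> sphere 0 1 \<Longrightarrow> N u \<le> N v"
    using continuous_attains_inf[OF compact_sphere ne, of N] assms
    by (metis continuous_on_subset normlike_def subset_UNIV)
  have "N u * norm v \<le> N v" for v
  proof (cases "v = 0")
    case False
    then have "N v = norm v * N (v /\<^sub>R norm v)"
      using normlike_scale[OF assms, of "norm v" "v /\<^sub>R norm v"] by simp
    moreover have "N u \<le> N (v /\<^sub>R norm v)" using False by (intro u) auto
    ultimately show ?thesis
      using mult_left_mono[of "N u" "N (v /\<^sub>R norm v)" "norm v"] by (simp add: mult.commute[of _ "norm v"])
  qed (simp add: normlike_zero[OF assms])
  moreover have "u \<noteq> 0" using u(1) by auto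
  then have "0 < N u" by (rule normlike_pos[OF assms])
  ultimately show ?thesis using that by blast
qed

lemma normlike_upper:
  assumes "normlike N"
  obtains M where "0 < M" "\<And>v. N v \<le> M * norm v"
proof -
  have ne: "sphere (0::real \<times> real) 1 \<noteq> {}" by simp
  obtain u where u: "u \<in> sphere 0 1" "\<And>v. v \<in> sphere 0 1 \<Longrightarrow> N v \<le> N u"
    using continuous_attains_sup[OF compact_sphere ne, of N] assms
    by (metis continuous_on_subset normlike_def subset_UNIV)
  have "N v \<le> N u * norm v" for v
  proof (cases "v = 0")
    case False
    then have "N v = norm v * N (v /\<^sub>R norm v)"
      using normlike_scale[OF assms, of "norm v" "v /\<^sub>R norm v"] by simp
    moreover have "N (v /\<^sub>R norm v) \<le> N u" using False by (intro u) auto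
    ultimately show ?thesis
      using mult_left_mono[of "N (v /\<^sub>R norm v)" "N u" "norm v"] by (simp add: mult.commute[of _ "norm v"])
  qed (simp add: normlike_zero[OF assms])
  moreover have "u \<noteq> 0" using u(1) by auto
  then have "0 < N u" by (rule normlike_pos[OF assms])
  ultimately show ?thesis using that by blast
qed

lemma dual_ball_eq_polar_body:
  assumes N: "normlike N"
  shows "{f. (SUP v\<in>{v. N v \<le> 1}. f \<bullet> v) \<le> 1} = polar_body N"
proof -
  obtain m where m: "0 < m" "\<And>v. m * norm v \<le> N v" using normlike_lower[OF N] by metis
  have "0 \<in> {v. N v \<le> 1}" unfolding mem_Collect_eq normlike_zero[OF N] by simp
  then have ne: "{v. N v \<le> 1} \<noteq> {}" by blast
  \<comment> \<open>A real supremum carries information only for a set bounded above; the estimate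
    by \<open>m\<close> makes the unit ball of \<open>N\<close> bounded.\<close>
  have bdd: "bdd_above ((\<bullet>) f ` {v. N v \<le> 1})" for f
  proof (rule bdd_aboveI2)
    fix v assume "v \<in> {v. N v \<le> 1}"
    then have "m * norm v \<le> 1" using m(2)[of v] by simp
    then have "norm v \<le> 1 / m" using m by (simp add: field_simps)
    have "f \<bullet> v \<le> norm f * norm v" by (rule norm_cauchy_schwarz)
    also have "\<dots> \<le> norm f * (1 / m)" by (rule mult_left_mono) (simp_all add: \<open>norm v \<le> 1 / m\<close>)
    finally show "f \<bullet> v \<le> norm f * (1 / m)" .
  qed
  show ?thesis
  proof (intro set_eqI iffI)
    fix f assume f: "f \<in> {f. (SUP v\<in>{v. N v \<le> 1}. f \<bullet> v) \<le> 1}"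
    have "f \<bullet> v \<le> N v" for v
    proof (cases "v = 0")
      case False
      then have p: "0 < N v" by (rule normlike_pos[OF N])
      have "f \<bullet> (v /\<^sub>R N v) \<le> (SUP v\<in>{v. N v \<le> 1}. f \<bullet> v)"
        using p by (intro cSUP_upper bdd) (auto simp: normlike_scale[OF N])
      then have "f \<bullet> (v /\<^sub>R N v) \<le> 1" using f by simp
      then show ?thesis using p by (simp add: field_simps)
    qed (simp add: normlike_zero[OF N])
    then show "f \<in> polar_body N" by (rule polar_bodyI)
  next
    fix f assume "f \<in> polar_body N"
    then have "f \<bullet> v \<le> N v" for v by (rule polar_bodyD)
    then have "(SUP v\<in>{v. N v \<le> 1}. f \<bullet> v) \<le> 1"
      by (intro cSUP_least ne) (auto intro: order_trans)
    then show "f \<in> {f. (SUP v\<in>{v. N v \<le> 1}. f \<bullet> v) \<le> 1}" by simp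
  qed
qed

lemma compact_polar_body:
  assumes N: "normlike N"
  shows "compact (polar_body N)"
proof -
  obtain M where M: "0 < M" "\<And>v. N v \<le> M * norm v" using normlike_upper[OF N] by metis
  have "norm f \<le> M" if "f \<in> polar_body N" for f
  proof (cases "f = 0")
    case False
    \<comment> \<open>Testing \<open>f\<close> on the vector \<open>f\<close> itself bounds its
      length.\<close>
    have "norm f * norm f \<le> M * norm f"
      using polar_bodyD[OF that, of f] M(2)[of f] by (simp add: dot_square_norm power2_eq_square)
    then show ?thesis using False by simp
  qed (use M in simp)
  then have "bounded (polar_body N)" by (rule boundedI)
  moreover have "closed (polar_body N)"
    unfolding polar_body_def Collect_all_eq
    by (intro closed_INT ballI closed_Collect_le continuous_intros)
  ultimately show ?thesis by (simp add: compact_eq_bounded_closed)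
qed

lemma polar_body_borel: "normlike N \<Longrightarrow> polar_body N \<in> sets borel"
  by (simp add: borel_compact compact_polar_body)

lemma polar_body_finite: "normlike N \<Longrightarrow> polar_body N \<in> fmeasurable lborel"
  using emeasure_compact_finite[OF compact_polar_body] polar_body_borel by (auto simp: fmeasurable_def)

lemma polar_area_mono:
  assumes "normlike N" "normlike N'" "\<And>v. N v \<le> N' v"
  shows "measure lborel (polar_body N) \<le> measure lborel (polar_body N')"
proof (intro measure_mono_fmeasurable polar_body_finite assms)
  show "polar_body N \<subseteq> polar_body N'"
  proof (intro subsetI polar_bodyI)
    fix f v assume "f \<in> polar_body N"
    from polar_bodyD[OF this, of v] assms(3)[of v] show "f \<bullet> v \<le> N' v" by (rule order_trans)
  qed
qed (use assms polar_body_borel in auto)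

lemma normlike_mult: "normlike N \<Longrightarrow> 0 < c \<Longrightarrow> normlike (\<lambda>v. c * N v)"
  by (auto simp: normlike_def intro!: continuous_intros)

lemma polar_area_scale:
  assumes N: "normlike N" and c: "0 < c"
  shows "measure lborel (polar_body (\<lambda>v. c * N v)) = c\<^sup>2 * measure lborel (polar_body N)"
proof -
  have "polar_body (\<lambda>v. c * N v) = (\<lambda>f. c *\<^sub>R f) ` polar_body N"
  proof (intro set_eqI iffI)
    fix f assume "f \<in> polar_body (\<lambda>v. c * N v)"
    then have "f \<bullet> v \<le> c * N v" for v by (rule polar_bodyD)
    then have "f /\<^sub>R c \<in> polar_body N" using c by (intro polar_bodyI) (simp add: field_simps)
    moreover have "f = c *\<^sub>R (f /\<^sub>R c)" using c by simp
    ultimately show "f \<in> (\<lambda>f. c *\<^sub>R f) ` polar_body N" by blast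
  next
    fix f assume "f \<in> (\<lambda>f. c *\<^sub>R f) ` polar_body N"
    then obtain g where g: "g \<in> polar_body N" "f = c *\<^sub>R g" by blast
    show "f \<in> polar_body (\<lambda>v. c * N v)"
      by (rule polar_bodyI) (use c polar_bodyD[OF g(1)] in \<open>simp add: g(2) mult_left_mono\<close>)
  qed
  moreover have "measure lborel ((\<lambda>f. c *\<^sub>R f) ` polar_body N) = \<bar>jac (\<lambda>f. c *\<^sub>R f)\<bar> * measure lborel (polar_body N)"
    by (rule measure_plane_linear_image[OF _ _ compact_polar_body[OF N]])
       (use c in \<open>auto simp: inj_on_def linear_iff algebra_simps\<close>)
  ultimately show ?thesis by (simp add: jac_def power2_eq_square)
qed

text \<open>Pulling a norm back along \<open>J\<close> replaces its polar body by the image under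
  the adjoint, whose determinant is that of \<open>J\<close>. This transformation law is what makes
  the Holmes-Thompson density a density.\<close>

lemma polar_area_linear:
  assumes N: "normlike N" and J: "linear J" "inj J"
  shows "measure lborel (polar_body (\<lambda>v. N (J v))) = \<bar>jac J\<bar> * measure lborel (polar_body N)"
proof -
  obtain K where K: "linear K" "\<And>v. J (K v) = v" "\<And>v. K (J v) = v"
    using linear_injective_isomorphism[OF J] by blast
  have ad: "adjoint J f \<bullet> v = f \<bullet> J v" "adjoint K f \<bullet> v = f \<bullet> K v" for f v
    using adjoint_works[OF J(1)] adjoint_works[OF K(1)] by (auto simp: inner_commute)
  have inv: "adjoint J (adjoint K f) = f" "adjoint K (adjoint J f) = f" for f
    by (rule vector_eq_rdot[THEN iffD1]; auto simp: ad K)+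
  have "polar_body (\<lambda>v. N (J v)) = adjoint J ` polar_body N"
  proof (intro set_eqI iffI)
    fix f assume f: "f \<in> polar_body (\<lambda>v. N (J v))"
    have "f \<bullet> K v \<le> N (J (K v))" for v by (rule polar_bodyD[OF f])
    then have "adjoint K f \<in> polar_body N" by (intro polar_bodyI) (simp add: ad K)
    then show "f \<in> adjoint J ` polar_body N" using inv by (metis image_eqI)
  next
    fix f assume "f \<in> adjoint J ` polar_body N"
    then obtain g where g: "g \<in> polar_body N" "f = adjoint J g" by blast
    show "f \<in> polar_body (\<lambda>v. N (J v))"
      by (rule polar_bodyI) (use polar_bodyD[OF g(1)] in \<open>simp add: g(2) ad\<close>)
  qed
  moreover have "measure lborel (adjoint J ` polar_body N) = \<bar>jac (adjoint J)\<bar> * measure lborel (polar_body N)"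
    by (rule measure_plane_linear_image[OF _ _ compact_polar_body[OF N]])
       (rule adjoint_linear[OF J(1)], rule inj_on_inverseI[where g = "adjoint K"], rule inv(2))
  moreover have "jac (adjoint J) = jac J"
  proof -
    have "fst (adjoint J f) = f \<bullet> J (1,0)" "snd (adjoint J f) = f \<bullet> J (0,1)" for f
      using ad(1)[of f "(1,0)"] ad(1)[of f "(0,1)"] by (auto simp: inner_prod_def)
    then show ?thesis by (simp add: jac_def inner_prod_def)
  qed
  ultimately show ?thesis by simp
qed

text \<open>Being convex and symmetric, the polar body contains the parallelogram with vertices
  \<open>\<plusminus>p\<close> and \<open>\<plusminus>q\<close>, whose area is twice the
  determinant.\<close>

lemma polar_area_ge_det:
  assumes N: "normlike N" and p: "p \<in> polar_body N" and q: "q \<in> polar_body N"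
  shows "2 * \<bar>fst p * snd q - fst q * snd p\<bar> \<le> measure lborel (polar_body N)"
proof (cases "fst p * snd q - fst q * snd p = 0")
  case False
  \<comment> \<open>\<open>T\<close> sends the corners \<open>(1,1)\<close> and
    \<open>(1,-1)\<close> of the square to \<open>p\<close> and \<open>q\<close>.\<close>
  define T where "T = (\<lambda>z::real \<times> real. ((fst z + snd z) / 2) *\<^sub>R p + ((fst z - snd z) / 2) *\<^sub>R q)"
  have T: "linear T"
    by (rule linearI) (auto simp: T_def algebra_simps add_divide_distrib diff_divide_distrib)
  have jT: "jac T = - (fst p * snd q - fst q * snd p) / 2"
    by (simp add: jac_def T_def field_simps)
  have injT: "inj T"
    unfolding linear_injective_0[OF T]
  proof (intro allI impI)
    fix z assume "T z = 0"
    then have e: "(fst z + snd z) * fst p + (fst z - snd z) * fst q = 0"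
      "(fst z + snd z) * snd p + (fst z - snd z) * snd q = 0"
      by (auto simp: T_def prod_eq_iff field_simps)
    have "(fst z + snd z) * (fst p * snd q - fst q * snd p) = 0"
      "(fst z - snd z) * (fst p * snd q - fst q * snd p) = 0"
      using e by algebra+
    with False have "fst z + snd z = 0" "fst z - snd z = 0" by auto
    then show "z = 0" by (auto simp: prod_eq_iff)
  qed
  let ?Q = "cbox (-1,-1) (1,1) :: (real \<times> real) set"
  have "T ` ?Q \<subseteq> polar_body N"
  proof
    fix f assume "f \<in> T ` ?Q"
    then obtain z where z: "z \<in> ?Q" "f = T z" by blast
    define a b where "a = fst z" and "b = snd z"
    have ab: "\<bar>a\<bar> \<le> 1" "\<bar>b\<bar> \<le> 1"
      using z(1) by (cases z; auto simp: a_def b_def)+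
    have f: "f = T (a, b)" by (simp add: z a_def b_def)
    have "f \<bullet> v \<le> N v" for v
    proof -
      have pv: "\<bar>r \<bullet> v\<bar> \<le> N v" if "r \<in> polar_body N" for r
        using polar_bodyD[OF that, of v] polar_bodyD[OF that, of "-v"] normlike_minus[OF N, of v]
        by (simp add: abs_le_iff)
      have prod_le: "x * y \<le> \<bar>x\<bar> * N v" if "\<bar>y\<bar> \<le> N v" for x y
        using mult_left_mono[OF that abs_ge_zero[of x]] abs_ge_self[of "x * y"] by (simp add: abs_mult)
      have "f \<bullet> v = ((a + b) / 2) * (p \<bullet> v) + ((a - b) / 2) * (q \<bullet> v)"
        by (simp add: f T_def inner_add_left)
      also have "\<dots> \<le> \<bar>(a + b) / 2\<bar> * N v + \<bar>(a - b) / 2\<bar> * N v"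
        by (intro add_mono prod_le pv p q)
      also have "\<dots> = (\<bar>(a + b) / 2\<bar> + \<bar>(a - b) / 2\<bar>) * N v" by (simp add: algebra_simps)
      \<comment> \<open>\<open>\<bar>a + b\<bar> / 2 + \<bar>a - b\<bar> / 2\<close> is the larger
        of \<open>\<bar>a\<bar>\<close> and \<open>\<bar>b\<bar>\<close>.\<close>
      also have "\<dots> \<le> 1 * N v"
        using ab by (intro mult_right_mono normlike_nonneg[OF N]) (auto simp: abs_if field_simps)
      finally show ?thesis by simp
    qed
    then show "f \<in> polar_body N" by (rule polar_bodyI)
  qed
  moreover have "T ` ?Q \<in> sets borel"
    by (intro borel_compact compact_continuous_image linear_continuous_on compact_cbox)
       (use T in \<open>simp add: linear_conv_bounded_linear\<close>)
  ultimately have "measure lborel (T ` ?Q) \<le> measure lborel (polar_body N)"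
    by (intro measure_mono_fmeasurable polar_body_finite N) auto
  moreover have "measure lborel (T ` ?Q) = \<bar>jac T\<bar> * measure lborel ?Q"
    by (rule measure_plane_linear_image[OF T injT compact_cbox])
  moreover have "measure lborel ?Q = 4"
    by (simp only: content_Pair) simp
  moreover have "\<bar>jac T\<bar> = \<bar>fst p * snd q - fst q * snd p\<bar> / 2"
    unfolding jT by (simp add: abs_minus_commute)
  ultimately show ?thesis by simp
qed simp

text \<open>By compactness of the unit circle \<open>N x\<close> is uniformly close to
  \<open>N x0\<close> on it, hence within factors \<open>1 \<plusminus> \<epsilon>\<close>
  everywhere by homogeneity, and areas scale by the squares of these factors.\<close>

lemma continuous_on_polar_area:
  fixes N :: "'a::metric_space \<Rightarrow> real \<times> real \<Rightarrow> real"
  assumes cont: "continuous_on (X \<times> UNIV) (\<lambda>(x, v). N x v)"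
    and N: "\<And>x. x \<in> X \<Longrightarrow> normlike (N x)"
  shows "continuous_on X (\<lambda>x. measure lborel (polar_body (N x)))"
  unfolding continuous_on_iff
proof (intro ballI allI impI)
  fix x0 and e :: real assume x0: "x0 \<in> X" and e: "0 < e"
  define a where "a = measure lborel (polar_body (N x0))"
  \<comment> \<open>The area error is at most \<open>2 * \<epsilon> * a + \<epsilon>\<^sup>2 * a
    \<le> 3 * \<epsilon> * a\<close>; the summand 1 in \<open>a + 1\<close> covers the case
    \<open>a = 0\<close>.\<close>
  define \<epsilon> where "\<epsilon> = min (1/2) (e / (4 * (a + 1)))"
  have a: "0 \<le> a" by (simp add: a_def)
  have \<epsilon>: "0 < \<epsilon>" "\<epsilon> < 1" using e a by (auto simp: \<epsilon>_def)
  have "\<epsilon> \<le> e / (4 * (a + 1))" by (simp add: \<epsilon>_def)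
  then have "\<epsilon> * (4 * (a + 1)) \<le> e"
    using a by (subst (asm) pos_le_divide_eq) auto
  then have \<epsilon>e: "4 * \<epsilon> * a < e" using \<epsilon> by (simp add: algebra_simps)
  obtain m where m: "0 < m" "\<And>v. m * norm v \<le> N x0 v" using normlike_lower[OF N[OF x0]] by metis
  have "continuous_on (X \<times> sphere 0 1) (\<lambda>(x, v). N x v)"
    by (rule continuous_on_subset[OF cont]) auto
  \<comment> \<open>On unit vectors \<open>m \<le> N x0 v\<close>, so the tolerance
    \<open>\<epsilon> * m\<close> is a relative error of at most \<open>\<epsilon>\<close>.\<close>
  then obtain X0 where X0: "x0 \<in> X0" "open X0"
    and close: "\<And>x v. x \<in> X0 \<inter> X \<Longrightarrow> v \<in> sphere 0 1 \<Longrightarrow> dist (N x v) (N x0 v) \<le> \<epsilon> * m"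
    by (rule continuous_on_prod_compactE[OF _ compact_sphere x0, of _ _ _ "\<epsilon> * m"]) (use \<epsilon> m in auto)
  have close': "\<bar>N x v - N x0 v\<bar> \<le> \<epsilon> * N x0 v" if x: "x \<in> X0 \<inter> X" for x v
  proof (cases "v = 0")
    case False
    have s: "N y v = norm v * N y (v /\<^sub>R norm v)" if "y \<in> X" for y
      using normlike_scale[OF N[OF that], of "norm v" "v /\<^sub>R norm v"] False by simp
    have "\<bar>N x v - N x0 v\<bar> = norm v * \<bar>N x (v /\<^sub>R norm v) - N x0 (v /\<^sub>R norm v)\<bar>"
      using s[of x] s[of x0] x x0 by (simp add: abs_mult right_diff_distrib[symmetric])
    also have "\<dots> \<le> norm v * (\<epsilon> * m)"
      using close[OF x, of "v /\<^sub>R norm v"] False by (intro mult_left_mono) (auto simp: dist_real_def)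
    also have "\<dots> = \<epsilon> * (m * norm v)" by simp
    also have "\<dots> \<le> \<epsilon> * N x0 v" using \<epsilon> m by (intro mult_left_mono) auto
    finally show ?thesis .
  qed (use x x0 N in \<open>auto simp: normlike_zero\<close>)
  obtain d where d: "0 < d" "ball x0 d \<subseteq> X0" using X0 open_contains_ball by blast
  show "\<exists>d>0. \<forall>x\<in>X. dist x x0 < d \<longrightarrow>
      dist (measure lborel (polar_body (N x))) (measure lborel (polar_body (N x0))) < e"
  proof (intro exI conjI ballI impI)
    fix x assume x: "x \<in> X" "dist x x0 < d"
    then have xX: "x \<in> X0 \<inter> X" using d by (auto simp: dist_commute)
    have le: "N x v \<le> (1 + \<epsilon>) * N x0 v" "(1 - \<epsilon>) * N x0 v \<le> N x v" for v
      using close'[OF xX, of v] by (auto simp: abs_le_iff algebra_simps)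
    have u: "measure lborel (polar_body (N x)) \<le> (1 + \<epsilon>)\<^sup>2 * a"
      unfolding a_def using \<epsilon> le
      by (subst polar_area_scale[symmetric]) (auto intro!: polar_area_mono normlike_mult N x0 x)
    have l: "(1 - \<epsilon>)\<^sup>2 * a \<le> measure lborel (polar_body (N x))"
      unfolding a_def using \<epsilon> le
      by (subst polar_area_scale[symmetric]) (auto intro!: polar_area_mono normlike_mult N x0 x)
    have "\<epsilon>\<^sup>2 \<le> \<epsilon>" using \<epsilon> by (simp add: power2_eq_square mult_left_le_one_le)
    then have "\<epsilon>\<^sup>2 * a \<le> \<epsilon> * a" using a by (rule mult_right_mono)
    moreover have "0 \<le> \<epsilon> * a" "0 \<le> \<epsilon>\<^sup>2 * a" using \<epsilon> a by auto
    moreover have "(1 + \<epsilon>)\<^sup>2 * a = a + 2 * (\<epsilon> * a) + \<epsilon>\<^sup>2 * a" "(1 - \<epsilon>)\<^sup>2 * a = a - 2 * (\<epsilon> * a) + \<epsilon>\<^sup>2 * a"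
      by (auto simp: power2_eq_square algebra_simps)
    ultimately have "\<bar>measure lborel (polar_body (N x)) - a\<bar> < e"
      using u l \<epsilon>e by (intro abs_leI[THEN le_less_trans[of _ "4 * \<epsilon> * a"]]) auto
    then show "dist (measure lborel (polar_body (N x))) (measure lborel (polar_body (N x0))) < e"
      by (simp add: dist_real_def a_def)
  qed (rule d)
qed

subsection \<open>Periodic metrics on the strip\<close>

definition strip :: "(real \<times> real) set" where
  "strip = UNIV \<times> {0..1}"

lemma mem_strip: "x \<in> strip \<longleftrightarrow> 0 \<le> snd x \<and> snd x \<le> 1"
  by (cases x) (auto simp: strip_def)

lemma convex_strip: "convex strip"
  unfolding strip_def by (intro convex_Times) auto

lemma strip_shift: "x \<in> strip \<Longrightarrow> x + (a, 0) \<in> strip"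
  by (simp add: mem_strip)

lemma strip_segment: "x \<in> strip \<Longrightarrow> y \<in> strip \<Longrightarrow> 0 \<le> t \<Longrightarrow> t \<le> 1 \<Longrightarrow> x + t *\<^sub>R (y - x) \<in> strip"
  using convex_strip[unfolded convex_alt, rule_format, of x y t] by (simp add: algebra_simps)

text \<open>What the estimate uses about the pulled-back metric, cut off from charts and tangent
  vectors: \<open>G x\<close> is the norm on the tangent plane at \<open>x\<close>, and
  \<open>(1, 0)\<close> generates the deck group.\<close>

locale strip_metric =
  fixes G :: "real \<times> real \<Rightarrow> real \<times> real \<Rightarrow> real"
  assumes G_cont: "continuous_on (strip \<times> UNIV) (\<lambda>(x, v). G x v)"
    and G_norm: "\<And>x. x \<in> strip \<Longrightarrow> normlike (G x)"
    and G_periodic1: "\<And>x v. x \<in> strip \<Longrightarrow> G (x + (1, 0)) v = G x v"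
begin

lemma G_periodic_nat: "x \<in> strip \<Longrightarrow> G (x + (of_nat n, 0)) v = G x v"
proof (induction n)
  case (Suc n)
  have "G (x + (of_nat (Suc n), 0)) v = G ((x + (of_nat n, 0)) + (1, 0)) v"
    by (simp add: add.assoc add.commute[of 1])
  also have "\<dots> = G (x + (of_nat n, 0)) v"
    by (rule G_periodic1) (use Suc.prems in \<open>simp add: mem_strip\<close>)
  finally show ?case using Suc by simp
qed (simp add: zero_prod_def[symmetric])

lemma G_periodic: "x \<in> strip \<Longrightarrow> G (x + (of_int k, 0)) v = G x v"
proof (cases "0 \<le> k")
  case True
  then show "x \<in> strip \<Longrightarrow> ?thesis" using G_periodic_nat[of x "nat k" v] by simp
next
  case False
  assume "x \<in> strip"
  then have "x + (of_int k, 0) \<in> strip" by (rule strip_shift)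
  from G_periodic_nat[OF this, of "nat (-k)" v] False show ?thesis
    by (simp add: add.assoc) (simp add: zero_prod_def[symmetric])
qed

text \<open>The unit square is enlarged by 1 to the left and to the right, so that points of the
  strip at distance below 1 from it still lie in the compact set.\<close>

lemma G_compact_continuous:
  "continuous_on (({-1..2} \<times> {0..1}) \<times> sphere 0 1) (\<lambda>(x, v). G x v)"
  by (rule continuous_on_subset[OF G_cont]) (auto simp: strip_def)

lemma compact_fundamental: "compact ((({-1..2} :: real set) \<times> ({0..1} :: real set)) \<times> sphere (0 :: real \<times> real) 1)"
  by (intro compact_Times) auto

lemma shift_to_fundamental:
  assumes "z \<in> strip"
  obtains k :: int where "fst z + of_int k \<in> {0..1}" "z + (of_int k, 0) \<in> {0..1} \<times> {0..1}"
proof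
  show "fst z + of_int (- \<lfloor>fst z\<rfloor>) \<in> {0..1}"
    by auto linarith+
  then show "z + (of_int (- \<lfloor>fst z\<rfloor>), 0) \<in> {0..1} \<times> {0..1}"
    using assms by (cases z) (auto simp: mem_strip)
qed

lemma G_scale_unit: "x \<in> strip \<Longrightarrow> v \<noteq> 0 \<Longrightarrow> G x v = norm v * G x (v /\<^sub>R norm v)"
  using normlike_scale[OF G_norm, of x "norm v" "v /\<^sub>R norm v"] by simp

lemma G_upper:
  obtains K where "0 < K" "\<And>x v. x \<in> strip \<Longrightarrow> G x v \<le> K * norm v"
proof -
  have "compact ((\<lambda>(x, v). G x v) ` (({-1..2} \<times> {0..1}) \<times> sphere 0 1))"
    by (rule compact_continuous_image[OF G_compact_continuous compact_fundamental])
  then have "bounded ((\<lambda>(x, v). G x v) ` (({-1..2} \<times> {0..1}) \<times> sphere 0 1))"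
    by (rule compact_imp_bounded)
  then obtain K where K: "0 < K" "\<And>y. y \<in> (\<lambda>(x, v). G x v) ` (({-1..2} \<times> {0..1}) \<times> sphere 0 1) \<Longrightarrow> norm y \<le> K"
    using bounded_pos by metis
  have "G x v \<le> K * norm v" if x: "x \<in> strip" for x v
  proof (cases "v = 0")
    case True
    then show ?thesis using normlike_zero[OF G_norm[OF x]] by simp
  next
    case False
    obtain k :: int where "fst x + of_int k \<in> {0..1}" and k: "x + (of_int k, 0) \<in> {0..1} \<times> {0..1}"
      by (rule shift_to_fundamental[OF x])
    have "G x (v /\<^sub>R norm v) = (\<lambda>(x, v). G x v) (x + (of_int k, 0), v /\<^sub>R norm v)"
      using G_periodic[OF x, of k] by simp
    moreover have "(x + (of_int k, 0), v /\<^sub>R norm v) \<in> ({-1..2} \<times> {0..1}) \<times> sphere 0 1"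
      using k False by (cases x) auto
    ultimately have "norm (G x (v /\<^sub>R norm v)) \<le> K"
      using K(2) by (metis image_eqI)
    then show ?thesis
      unfolding G_scale_unit[OF x False] using mult_left_mono[of "G x (v /\<^sub>R norm v)" K "norm v"]
      by (simp add: mult.commute[of _ "norm v"])
  qed
  with K(1) that show ?thesis by blast
qed

text \<open>Uniform continuity on the compact set gives an additive error \<open>\<eta> * m\<close>,
  and \<open>m\<close>, the minimum over unit vectors, turns it into a factor. Shifting
  \<open>z\<close> and \<open>w\<close> by the same integer brings them into the compact set without
  changing \<open>G\<close>.\<close>

lemma G_uniform:
  assumes \<eta>: "0 < \<eta>"
  obtains \<rho> where "0 < \<rho>" "\<And>z w v. z \<in> strip \<Longrightarrow> w \<in> strip \<Longrightarrow> dist z w < \<rho> \<Longrightarrow> G w v \<le> (1 + \<eta>) * G z v"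
proof -
  let ?Q = "(({-1..2} :: real set) \<times> ({0..1} :: real set)) \<times> sphere (0 :: real \<times> real) 1"
  have "sphere (0 :: real \<times> real) 1 \<noteq> {}" by simp
  then have ne: "?Q \<noteq> {}" by auto
  obtain q where q: "q \<in> ?Q" "\<And>p. p \<in> ?Q \<Longrightarrow> (\<lambda>(x, v). G x v) q \<le> (\<lambda>(x, v). G x v) p"
    using continuous_attains_inf[OF compact_fundamental ne G_compact_continuous] by metis
  define m where "m = G (fst q) (snd q)"
  have m: "0 < m"
    unfolding m_def
  proof (rule normlike_pos[OF G_norm])
    show "fst q \<in> strip" using q(1) by (cases q) (auto simp: strip_def)
    show "snd q \<noteq> 0" using q(1) by (cases q) auto
  qed
  have m_le: "m \<le> G x v" if "x \<in> {-1..2} \<times> {0..1}" "norm v = 1" for x v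
    using q(2)[of "(x, v)"] that by (simp add: m_def case_prod_unfold)
  have "uniformly_continuous_on ?Q (\<lambda>(x, v). G x v)"
    by (rule compact_uniformly_continuous[OF G_compact_continuous compact_fundamental])
  then obtain d where d: "0 < d" "\<And>p p'. p \<in> ?Q \<Longrightarrow> p' \<in> ?Q \<Longrightarrow> dist p' p < d \<Longrightarrow>
      dist ((\<lambda>(x, v). G x v) p') ((\<lambda>(x, v). G x v) p) < \<eta> * m"
    using uniformly_continuous_onE[of ?Q "\<lambda>(x, v). G x v" "\<eta> * m"] \<eta> m by (metis mult_pos_pos)
  have "G w v \<le> (1 + \<eta>) * G z v" if z: "z \<in> strip" and w: "w \<in> strip" and zw: "dist z w < min d 1" for z w v
  proof (cases "v = 0")
    case True
    then show ?thesis using normlike_zero[OF G_norm] z w by simp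
  next
    case False
    define u where "u = v /\<^sub>R norm v"
    have u: "norm u = 1" using False by (simp add: u_def)
    obtain k :: int where "fst z + of_int k \<in> {0..1}" and k: "z + (of_int k, 0) \<in> {0..1} \<times> {0..1}"
      by (rule shift_to_fundamental[OF z])
    define z' w' where "z' = z + (of_int k, 0)" and "w' = w + (of_int k, 0)"
    have dd: "dist w' z' < d" "dist (fst w') (fst z') < 1"
      using zw dist_fst_le[of w' z'] by (auto simp: z'_def w'_def dist_commute)
    have z': "z' \<in> {-1..2} \<times> {0..1}" using k by (cases z') (auto simp: z'_def)
    have "fst z' \<in> {0..1}" using k by (cases "z'") (auto simp: z'_def)
    then have w': "w' \<in> {-1..2} \<times> {0..1}"
      using dd(2) w by (cases w'; cases w) (auto simp: w'_def mem_strip dist_real_def abs_less_iff)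
    have "dist (G w' u) (G z' u) < \<eta> * m"
      using d(2)[of "(z', u)" "(w', u)"] z' w' u dd by (simp add: dist_Pair_Pair)
    also have "\<dots> \<le> \<eta> * G z' u" using \<eta> m_le[OF z' u] by simp
    finally have "G w' u \<le> (1 + \<eta>) * G z' u" by (simp add: dist_real_def abs_less_iff algebra_simps)
    then have "G w u \<le> (1 + \<eta>) * G z u"
      using G_periodic[OF z, of k u] G_periodic[OF w, of k u] by (simp add: z'_def w'_def)
    then have "norm v * G w u \<le> norm v * ((1 + \<eta>) * G z u)" by (rule mult_left_mono) simp
    then show ?thesis using G_scale_unit[OF z False] G_scale_unit[OF w False] by (simp add: u_def mult.left_commute)
  qed
  with that[of "min d 1"] d(1) show ?thesis by simp
qed

definition seg :: "real \<times> real \<Rightarrow> real \<times> real \<Rightarrow> real" where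
  "seg x y = integral {0..1} (\<lambda>t. G (x + t *\<^sub>R (y - x)) (y - x))"

lemma G_segment_continuous:
  assumes "x \<in> strip" "y \<in> strip"
  shows "continuous_on {0..1} (\<lambda>t. G (x + t *\<^sub>R (y - x)) v)"
proof -
  have "continuous_on {0..1} (\<lambda>t. (\<lambda>(x, v). G x v) (x + t *\<^sub>R (y - x), v))"
    by (rule continuous_on_compose2[OF G_cont]) (use strip_segment[OF assms] in \<open>auto intro!: continuous_intros\<close>)
  then show ?thesis by simp
qed

lemma seg_has_integral:
  assumes "x \<in> strip" "y \<in> strip"
  shows "((\<lambda>t. G (x + t *\<^sub>R (y - x)) (y - x)) has_integral seg x y) {0..1}"
  unfolding seg_def by (intro integrable_integral integrable_continuous_real G_segment_continuous assms)

lemma seg_le: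
  assumes "x \<in> strip" "y \<in> strip" "\<And>t. 0 \<le> t \<Longrightarrow> t \<le> 1 \<Longrightarrow> G (x + t *\<^sub>R (y - x)) (y - x) \<le> c"
  shows "seg x y \<le> c"
  using has_integral_le[OF seg_has_integral[OF assms(1,2)] has_integral_const_real[of c 0 1]] assms(3) by simp

lemma seg_nonneg: "x \<in> strip \<Longrightarrow> y \<in> strip \<Longrightarrow> 0 \<le> seg x y"
  by (rule has_integral_nonneg[OF seg_has_integral])
     (auto simp only: atLeastAtMost_iff intro!: normlike_nonneg[OF G_norm[OF strip_segment]])

lemma seg_translate:
  assumes "x \<in> strip" "y \<in> strip"
  shows "seg (x + (of_int k, 0)) (y + (of_int k, 0)) = seg x y"
  unfolding seg_def
proof (rule integral_cong)
  fix t :: real assume t: "t \<in> {0..1}"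
  have "G (x + t *\<^sub>R (y - x) + (of_int k, 0)) (y - x) = G (x + t *\<^sub>R (y - x)) (y - x)"
    by (rule G_periodic) (use t strip_segment[OF assms] in auto)
  then show "G (x + (of_int k, 0) + t *\<^sub>R (y + (of_int k, 0) - (x + (of_int k, 0)))) (y + (of_int k, 0) - (x + (of_int k, 0)))
      = G (x + t *\<^sub>R (y - x)) (y - x)"
    by (simp add: algebra_simps)
qed

text \<open>Reversing the segment replaces \<open>t\<close> by \<open>1 - t\<close> and the
  direction by its negative; reversibility of the metric makes the integrands equal.\<close>

lemma seg_commute:
  assumes "x \<in> strip" "y \<in> strip"
  shows "seg y x = seg x y"
proof -
  have "((\<lambda>t. G (x + (-1 *\<^sub>R t + 1) *\<^sub>R (y - x)) (y - x)) has_integral (1 / \<bar>-1\<bar> ^ DIM(real)) *\<^sub>R seg x y)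
     ((\<lambda>t. (1 / -1) *\<^sub>R t + - ((1 / -1) *\<^sub>R 1)) ` cbox 0 1)"
    by (rule has_integral_affinity[of _ _ 0 1 "-1" 1]) (use seg_has_integral[OF assms] in auto)
  moreover have "(\<lambda>t. (1 / -1) *\<^sub>R t + - ((1 / -1) *\<^sub>R 1)) ` cbox 0 (1::real) = {0..1}"
    by (auto simp: image_iff intro: bexI[of _ "1 - _"])
  ultimately have "((\<lambda>t. G (x + (1 - t) *\<^sub>R (y - x)) (y - x)) has_integral seg x y) {0..1}"
    by simp
  moreover have "G (x + (1 - t) *\<^sub>R (y - x)) (y - x) = G (y + t *\<^sub>R (x - y)) (x - y)" if "t \<in> {0..1}" for t
  proof -
    have e: "x + (1 - t) *\<^sub>R (y - x) = y + t *\<^sub>R (x - y)" by (simp add: algebra_simps)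
    have "y + t *\<^sub>R (x - y) \<in> strip" using strip_segment[OF assms(2,1)] that by simp
    from normlike_minus[OF G_norm[OF this], of "y - x"] show ?thesis by (simp add: e)
  qed
  ultimately have "((\<lambda>t. G (y + t *\<^sub>R (x - y)) (x - y)) has_integral seg x y) {0..1}"
    by (rule has_integral_eq[rotated]) auto
  with seg_has_integral[OF assms(2,1)] show ?thesis by (rule has_integral_unique)
qed

text \<open>The affine substitution produces the factor \<open>t - s\<close>, which homogeneity of
  \<open>G\<close> moves into the direction vector.\<close>

lemma seg_subsegment:
  assumes xy: "x \<in> strip" "y \<in> strip" and st: "0 \<le> s" "s \<le> t" "t \<le> 1"
  shows "seg (x + s *\<^sub>R (y - x)) (x + t *\<^sub>R (y - x)) = integral {s..t} (\<lambda>r. G (x + r *\<^sub>R (y - x)) (y - x))"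
proof (cases "s = t")
  case True
  have "x + t *\<^sub>R (y - x) \<in> strip" using strip_segment[OF xy] st by simp
  from normlike_zero[OF G_norm[OF this]] True show ?thesis by (simp add: seg_def)
next
  case False
  with st have st': "s < t" by simp
  define I where "I = integral {s..t} (\<lambda>r. G (x + r *\<^sub>R (y - x)) (y - x))"
  have "(\<lambda>r. G (x + r *\<^sub>R (y - x)) (y - x)) integrable_on {s..t}"
    by (rule integrable_continuous_real[OF continuous_on_subset[OF G_segment_continuous[OF xy]]]) (use st in auto)
  then have "((\<lambda>r. G (x + r *\<^sub>R (y - x)) (y - x)) has_integral I) (cbox s t)"
    unfolding I_def by (simp add: integrable_integral)
  from has_integral_affinity'[OF this, of "t - s" s] st'
  have "((\<lambda>r. G (x + ((t - s) * r + s) *\<^sub>R (y - x)) (y - x)) has_integral I / (t - s)) {0..1}"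
    by (simp add: divide_inverse mult.commute)
  from has_integral_mult_right[OF this, of "t - s"] st'
  have "((\<lambda>r. (t - s) * G (x + ((t - s) * r + s) *\<^sub>R (y - x)) (y - x)) has_integral I) {0..1}"
    by simp
  moreover have "(t - s) * G (x + ((t - s) * r + s) *\<^sub>R (y - x)) (y - x) =
     G (x + s *\<^sub>R (y - x) + r *\<^sub>R (x + t *\<^sub>R (y - x) - (x + s *\<^sub>R (y - x)))) (x + t *\<^sub>R (y - x) - (x + s *\<^sub>R (y - x)))"
    if r: "r \<in> {0..1}" for r
  proof -
    have e: "x + t *\<^sub>R (y - x) - (x + s *\<^sub>R (y - x)) = (t - s) *\<^sub>R (y - x)"
      "x + s *\<^sub>R (y - x) + r *\<^sub>R (t - s) *\<^sub>R (y - x) = x + ((t - s) * r + s) *\<^sub>R (y - x)"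
      by (simp_all add: algebra_simps)
    have "0 \<le> (t - s) * r" "(t - s) * r \<le> t - s" using r st' by (simp_all add: mult_left_le)
    then have "x + ((t - s) * r + s) *\<^sub>R (y - x) \<in> strip"
      using r st' st by (intro strip_segment xy) linarith+
    from normlike_scale[OF G_norm[OF this], of "t - s" "y - x"] st' show ?thesis unfolding e by simp
  qed
  ultimately have "((\<lambda>r. G (x + s *\<^sub>R (y - x) + r *\<^sub>R (x + t *\<^sub>R (y - x) - (x + s *\<^sub>R (y - x)))) (x + t *\<^sub>R (y - x) - (x + s *\<^sub>R (y - x)))) has_integral I) {0..1}"
    by (rule has_integral_eq[rotated]) auto
  then show ?thesis unfolding seg_def I_def by (rule integral_unique)
qed

lemma seg_split:
  assumes xy: "x \<in> strip" "y \<in> strip" and st: "0 \<le> s" "s \<le> t" "t \<le> 1"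
  shows "seg x (x + s *\<^sub>R (y - x)) + seg (x + s *\<^sub>R (y - x)) (x + t *\<^sub>R (y - x)) + seg (x + t *\<^sub>R (y - x)) y = seg x y"
proof -
  let ?f = "\<lambda>r. G (x + r *\<^sub>R (y - x)) (y - x)"
  have i: "?f integrable_on {a..b}" if "0 \<le> a" "b \<le> 1" for a b
    by (rule integrable_continuous_real[OF continuous_on_subset[OF G_segment_continuous[OF xy]]]) (use that in auto)
  have "integral {0..s} ?f + integral {s..t} ?f = integral {0..t} ?f"
    by (rule Henstock_Kurzweil_Integration.integral_combine) (use st i in auto)
  moreover have "integral {0..t} ?f + integral {t..1} ?f = integral {0..1} ?f"
    by (rule Henstock_Kurzweil_Integration.integral_combine) (use st i in auto)
  moreover have "seg x (x + s *\<^sub>R (y - x)) = integral {0..s} ?f"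
    using seg_subsegment[OF xy, of 0 s] st by simp
  moreover have "seg (x + t *\<^sub>R (y - x)) y = integral {t..1} ?f"
    using seg_subsegment[OF xy, of t 1] st by simp
  ultimately show ?thesis using seg_subsegment[OF xy st] by (simp add: seg_def)
qed

section \<open>Lengths of polygons in the strip\<close>

text \<open>A polygon in the strip runs from \<open>x\<close> to \<open>y\<close> with length
  exactly \<open>r\<close>. A relation in place of a distance keeps lengths additive with equality;
  infima are taken only when the height and angle functions are built.\<close>

inductive reach :: "real \<times> real \<Rightarrow> real \<times> real \<Rightarrow> real \<Rightarrow> bool" for x where
  base: "x \<in> strip \<Longrightarrow> reach x x 0"
| step: "reach x y r \<Longrightarrow> z \<in> strip \<Longrightarrow> reach x z (r + seg y z)"

lemma reach_strip: "reach x y r \<Longrightarrow> x \<in> strip \<and> y \<in> strip"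
  by (induction rule: reach.induct) auto

lemma reach_nonneg: "reach x y r \<Longrightarrow> 0 \<le> r"
  by (induction rule: reach.induct) (auto intro!: add_nonneg_nonneg seg_nonneg dest: reach_strip)

lemma reach_seg: "x \<in> strip \<Longrightarrow> y \<in> strip \<Longrightarrow> reach x y (seg x y)"
  using reach.step[OF reach.base, of x y] by simp

lemma reach_trans: "reach y z s \<Longrightarrow> reach x y r \<Longrightarrow> reach x z (r + s)"
  by (induction rule: reach.induct) (auto simp: add.assoc[symmetric] intro: reach.intros)

lemma reach_sym: "reach x y r \<Longrightarrow> reach y x r"
proof (induction rule: reach.induct)
  case (step y r z)
  have "reach z y (seg y z)"
    using reach_seg[of z y] seg_commute[of y z] reach_strip[OF step(1)] step(2) by simp
  from reach_trans[OF step(3) this] show ?case by (simp add: add.commute)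
qed (rule reach.base)

lemma reach_translate: "reach x y r \<Longrightarrow> reach (x + (of_int k, 0)) (y + (of_int k, 0)) r"
proof (induction rule: reach.induct)
  case (step y r z)
  from reach.step[OF step(3) strip_shift[OF step(2), of "of_int k"]] show ?case
    using seg_translate reach_strip[OF step(1)] step(2) by simp
qed (auto intro: reach.base strip_shift)

end

context strip_metric
begin

text \<open>The chord lemma returns parameters on a continuous curve, so the polygon needs a
  parametrisation in which any two parameters cut its length exactly into three. The last edge
  always takes the second half of the interval.\<close>

lemma reach_imp_subdividing_path:
  "reach x y r \<Longrightarrow> \<exists>\<sigma>. continuous_on {0..1} \<sigma> \<and> \<sigma> 0 = x \<and> \<sigma> 1 = y \<and>
     (\<forall>s t. 0 \<le> s \<longrightarrow> s \<le> t \<longrightarrow> t \<le> (1::real) \<longrightarrow>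
       (\<exists>a b c. reach x (\<sigma> s) a \<and> reach (\<sigma> s) (\<sigma> t) b \<and> reach (\<sigma> t) y c \<and> a + b + c = r))"
proof (induction rule: reach.induct)
  case base
  then show ?case
    by (intro exI[of _ "\<lambda>_. x"]) (auto intro!: exI[of _ 0] reach.base)
next
  case (step y r z)
  then obtain \<sigma> where \<sigma>: "continuous_on {0..1} \<sigma>" "\<sigma> 0 = x" "\<sigma> 1 = y"
    and sub: "\<And>s t. 0 \<le> s \<Longrightarrow> s \<le> t \<Longrightarrow> t \<le> (1::real) \<Longrightarrow>
       \<exists>a b c. reach x (\<sigma> s) a \<and> reach (\<sigma> s) (\<sigma> t) b \<and> reach (\<sigma> t) y c \<and> a + b + c = r"
    by blast
  have y: "y \<in> strip" and z: "z \<in> strip" and xy: "reach x y r"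
    using step reach_strip by blast+
  define l where "l = (\<lambda>t::real. y + (2 * t - 1) *\<^sub>R (z - y))"
  have l: "l t \<in> strip" if "1/2 \<le> t" "t \<le> 1" for t
    unfolding l_def using that by (intro strip_segment y z) auto
  define \<tau> where "\<tau> = (\<lambda>t. if t \<le> 1/2 then \<sigma> (2 * t) else l t)"
  have mid: "\<sigma> (2 * t) = y + (2 * t - 1) *\<^sub>R (z - y)" if "t * 2 = 1" for t
  proof -
    have t: "t = 1/2" using that by simp
    show ?thesis unfolding t using \<sigma> by simp
  qed
  have "continuous_on ({0..1/2} \<union> {1/2..1}) \<tau>"
    unfolding \<tau>_def l_def
    by (rule continuous_on_If) (auto intro!: mid continuous_intros continuous_on_compose2[OF \<sigma>(1)])
  then have cont: "continuous_on {0..1} \<tau>" by (rule continuous_on_subset) auto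
  have "\<exists>a b c. reach x (\<tau> s) a \<and> reach (\<tau> s) (\<tau> t) b \<and> reach (\<tau> t) z c \<and> a + b + c = r + seg y z"
    if st: "0 \<le> s" "s \<le> t" "t \<le> 1" for s t
  proof -
    consider "t \<le> 1/2" | "s \<le> 1/2" "1/2 < t" | "1/2 < s" by linarith
    then show ?thesis
    proof cases
      case 1
      then obtain a b c where "reach x (\<sigma> (2 * s)) a" "reach (\<sigma> (2 * s)) (\<sigma> (2*t)) b" "reach (\<sigma> (2*t)) y c" "a + b + c = r"
        using sub[of "2 * s" "2*t"] st by auto
      then show ?thesis
        using 1 st z by (intro exI[of _ a] exI[of _ b] exI[of _ "c + seg y z"]) (auto simp: \<tau>_def intro: reach.step)
    next
      \<comment> \<open>The cuts lie on both sides of the last corner: the old part is cut at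
        \<open>2 * s\<close> and at its end, the new edge at \<open>l t\<close>.\<close>
      case 2
      then obtain a b c where abc: "reach x (\<sigma> (2 * s)) a" "reach (\<sigma> (2 * s)) y b" "reach y y c" "a + b + c = r"
        using sub[of "2 * s" 1] st \<sigma> by auto
      have lt: "l t \<in> strip" using 2 st by (intro l) auto
      have "reach (\<sigma> (2 * s)) (l t) (b + c + seg y (l t))"
        by (intro reach.step reach_trans[OF abc(3,2)] lt)
      \<comment> \<open>\<open>seg_split\<close> with equal parameters leaves a middle segment of
        length zero.\<close>
      moreover have "seg y (l t) + seg (l t) z = seg y z"
        using seg_split[OF y z, of "2*t-1" "2*t-1"] 2 st lt by (simp add: l_def seg_def normlike_zero[OF G_norm])
      ultimately show ?thesis
        using 2 abc(1,4) reach_seg[OF lt z]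
        by (intro exI[of _ a] exI[of _ "b + c + seg y (l t)"] exI[of _ "seg (l t) z"]) (auto simp: \<tau>_def)
    next
      case 3
      have ls: "l s \<in> strip" "l t \<in> strip" using 3 st by (auto intro: l)
      have "seg y (l s) + seg (l s) (l t) + seg (l t) z = seg y z"
        using seg_split[OF y z, of "2 * s-1" "2*t-1"] 3 st by (simp add: l_def)
      then show ?thesis
        using 3 st reach.step[OF xy ls(1)] reach_seg[OF ls] reach_seg[OF ls(2) z]
        by (intro exI[of _ "r + seg y (l s)"] exI[of _ "seg (l s) (l t)"] exI[of _ "seg (l t) z"]) (auto simp: \<tau>_def)
    qed
  qed
  moreover have "\<tau> 0 = x" "\<tau> 1 = z" by (auto simp: \<tau>_def \<sigma> l_def)
  ultimately show ?case using cont by blast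
qed

text \<open>The same construction as for the subdivision, now recording what is needed to project
  the polygon to a piecewise smooth curve: affine pieces between break points, velocities off them,
  and the length as an integral.\<close>

lemma reach_imp_polygonal_path:
  "reach x y r \<Longrightarrow> \<exists>\<sigma> \<sigma>' K. continuous_on {0..1} \<sigma> \<and> \<sigma> ` {0..1} \<subseteq> strip \<and> \<sigma> 0 = x \<and> \<sigma> 1 = y \<and>
     finite K \<and>
     (\<forall>s t. 0 \<le> s \<longrightarrow> s \<le> t \<longrightarrow> t \<le> (1::real) \<longrightarrow> {s<..<t} \<inter> K = {} \<longrightarrow>
        (\<exists>w v. \<forall>u\<in>{s..t}. \<sigma> u = w + u *\<^sub>R v)) \<and>
     (\<forall>t\<in>{0..1} - K. (\<sigma> has_vector_derivative \<sigma>' t) (at t within {0..1})) \<and>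
     ((\<lambda>t. G (\<sigma> t) (\<sigma>' t)) has_integral r) {0..1}"
proof (induction rule: reach.induct)
  case base
  have 1: "\<exists>w v. \<forall>u\<in>{s..t::real}. x = w + u *\<^sub>R v" for s t
    by (intro exI[of _ x] exI[of _ 0]) simp
  have 2: "((\<lambda>_. x) has_vector_derivative 0) (at t within {0..1})" for t by simp
  have 3: "((\<lambda>t::real. G x 0) has_integral 0) {0..1}"
    using normlike_zero[OF G_norm[OF base]] by simp
  show ?case
    by (rule exI[of _ "\<lambda>_. x"], rule exI[of _ "\<lambda>_. 0"], rule exI[of _ "{}"],
        intro conjI allI impI ballI 1 2 3) (use base in auto)
next
  case (step y r z)
  then obtain \<sigma> \<sigma>' K where \<sigma>: "continuous_on {0..1} \<sigma>" "\<sigma> ` {0..1} \<subseteq> strip" "\<sigma> 0 = x" "\<sigma> 1 = y"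
    and K: "finite K"
    and aff: "\<And>s t. 0 \<le> s \<Longrightarrow> s \<le> t \<Longrightarrow> t \<le> (1::real) \<Longrightarrow> {s<..<t} \<inter> K = {} \<Longrightarrow>
        \<exists>w v. \<forall>u\<in>{s..t}. \<sigma> u = w + u *\<^sub>R v"
    and der: "\<And>t. t \<in> {0..1} - K \<Longrightarrow> (\<sigma> has_vector_derivative \<sigma>' t) (at t within {0..1})"
    and int: "((\<lambda>t. G (\<sigma> t) (\<sigma>' t)) has_integral r) {0..1}"
    by blast
  have y: "y \<in> strip" and z: "z \<in> strip" using step reach_strip by blast+
  define l where "l = (\<lambda>t::real. y + (2 * t - 1) *\<^sub>R (z - y))"
  have l: "l t \<in> strip" if "1/2 \<le> t" "t \<le> 1" for t
    unfolding l_def using that by (intro strip_segment y z) auto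
  define \<tau> where "\<tau> = (\<lambda>t. if t \<le> 1/2 then \<sigma> (2 * t) else l t)"
  define \<tau>' where "\<tau>' = (\<lambda>t. if t \<le> 1/2 then 2 *\<^sub>R \<sigma>' (2 * t) else 2 *\<^sub>R (z - y))"
  \<comment> \<open>Halving moves the old break points into the first half; \<open>1/2\<close> is
    the new corner.\<close>
  define K' where "K' = insert (1/2) ((\<lambda>k. k / 2) ` K)"
  have mid: "\<sigma> (2 * t) = y + (2 * t - 1) *\<^sub>R (z - y)" if "t * 2 = 1" for t
  proof -
    have t: "t = 1/2" using that by simp
    show ?thesis unfolding t using \<sigma>(4) by simp
  qed
  have "continuous_on ({0..1/2} \<union> {1/2..1}) \<tau>"
    unfolding \<tau>_def l_def
    by (rule continuous_on_If) (auto intro!: mid continuous_intros continuous_on_compose2[OF \<sigma>(1)])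
  then have cont: "continuous_on {0..1} \<tau>" by (rule continuous_on_subset) auto
  have \<tau>l: "\<tau> t = l t" if "1/2 \<le> t" for t using that by (auto simp: \<tau>_def l_def intro: mid)
  have strip: "\<tau> ` {0..1} \<subseteq> strip" using \<sigma>(2) l by (auto simp: \<tau>_def)
  have aff': "\<exists>w v. \<forall>u\<in>{s..t}. \<tau> u = w + u *\<^sub>R v"
    if st: "0 \<le> s" "s \<le> t" "t \<le> 1" "{s<..<t} \<inter> K' = {}" for s t
  proof -
    have "\<not> (s < 1/2 \<and> 1/2 < t)" using st(4) by (auto simp: K'_def)
    then consider "t \<le> 1/2" | "1/2 \<le> s" by linarith
    then show ?thesis
    proof cases
      case 1
      have "{2 * s<..<2*t} \<inter> K = {}"
      proof (rule ccontr)
        assume "{2 * s<..<2*t} \<inter> K \<noteq> {}"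
        then obtain k where "k \<in> K" "2 * s < k" "k < 2*t" by auto
        then have "k / 2 \<in> {s<..<t} \<inter> K'" by (auto simp: K'_def)
        with st(4) show False by blast
      qed
      then have "\<exists>w v. \<forall>u\<in>{2 * s..2 * t}. \<sigma> u = w + u *\<^sub>R v"
        using st 1 by (intro aff) simp_all
      then obtain w v where "\<forall>u\<in>{2 * s..2 * t}. \<sigma> u = w + u *\<^sub>R v" by blast
      then show ?thesis
        using 1 by (intro exI[of _ w] exI[of _ "2 *\<^sub>R v"]) (auto simp: \<tau>_def mult.commute)
    next
      case 2
      then show ?thesis
        by (intro exI[of _ "y - (z - y)"] exI[of _ "2 *\<^sub>R (z - y)"])
           (auto simp: \<tau>l l_def algebra_simps simp flip: scaleR_2)
    qed
  qed
  have der': "(\<tau> has_vector_derivative \<tau>' t) (at t within {0..1})" if t: "t \<in> {0..1} - K'" for t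
  proof (cases "t \<le> 1/2")
    case True
    have "2 * t \<notin> K"
    proof
      assume "2 * t \<in> K"
      then have "(2 * t) / 2 \<in> K'" unfolding K'_def by blast
      with t show False by simp
    qed
    with True have t': "t < 1/2" "2 * t \<in> {0..1} - K" using t by (auto simp: K'_def less_le)
    have d: "((\<lambda>t. 2 * t) has_vector_derivative 2) (at t within {0..1/2})"
      by (auto intro!: derivative_eq_intros)
    have im: "(\<lambda>t. 2 * t) ` {0..1/2} = {0..1::real}"
      by (auto simp: image_iff intro: bexI[of _ "_ / 2"])
    have "((\<sigma> \<circ> (\<lambda>t. 2 * t)) has_vector_derivative 2 *\<^sub>R \<sigma>' (2 * t)) (at t within {0..1/2})"
      by (rule vector_diff_chain_within[OF d]) (use der[OF t'(2)] im in auto)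
    then have "(\<tau> has_vector_derivative \<tau>' t) (at t within {0..1/2})"
      using True t by (intro has_vector_derivative_transform[of t "{0..1/2}" \<tau>]) (auto simp: \<tau>_def \<tau>'_def)
    moreover have "at t within {0..1/2} = at t within {0..1}"
      by (rule at_within_nhd[of t "{..<1/2}"]) (use t' in auto)
    ultimately show ?thesis by simp
  next
    case False
    have "(l has_vector_derivative 2 *\<^sub>R (z - y)) (at t)"
      unfolding l_def by (auto intro!: derivative_eq_intros simp: has_vector_derivative_def algebra_simps)
    then have "(\<tau> has_vector_derivative 2 *\<^sub>R (z - y)) (at t)"
      by (rule has_vector_derivative_transform_within_open[of _ _ _ "{1/2<..}"]) (use False \<tau>l in auto)
    then show ?thesis using False by (simp add: \<tau>'_def has_vector_derivative_at_within)
  qed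
  have \<sigma>s: "\<sigma> (2 * t) \<in> strip" if "t \<in> {0..1/2}" for t using \<sigma>(2) that by auto
  have i1: "((\<lambda>t. G (\<tau> t) (\<tau>' t)) has_integral r) {0..1/2}"
  proof -
    have "((\<lambda>t. G (\<sigma> (2 *\<^sub>R t + 0)) (\<sigma>' (2 *\<^sub>R t + 0))) has_integral r /\<^sub>R 2 ^ DIM(real)) (cbox ((0 - 0) /\<^sub>R 2) ((1 - 0) /\<^sub>R 2))"
      by (rule has_integral_affinity') (use int in auto)
    from has_integral_mult_right[OF this, of 2]
    have "((\<lambda>t. 2 * G (\<sigma> (2 * t)) (\<sigma>' (2 * t))) has_integral r) {0..1/2}"
      by simp
    moreover have "2 * G (\<sigma> (2 * t)) (\<sigma>' (2 * t)) = G (\<tau> t) (\<tau>' t)" if "t \<in> {0..1/2}" for t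
      using normlike_scale[OF G_norm[OF \<sigma>s[OF that]], of 2] that by (simp add: \<tau>_def \<tau>'_def)
    ultimately show ?thesis by (rule has_integral_eq[rotated]) auto
  qed
  have i2: "((\<lambda>t. G (\<tau> t) (\<tau>' t)) has_integral seg y z) {1/2..1}"
  proof -
    have "((\<lambda>t. G (y + (2 *\<^sub>R t + - 1) *\<^sub>R (z - y)) (z - y)) has_integral seg y z /\<^sub>R 2 ^ DIM(real)) (cbox ((0 - - 1) /\<^sub>R 2) ((1 - - 1) /\<^sub>R 2))"
      by (rule has_integral_affinity'[where f = "\<lambda>t. G (y + t *\<^sub>R (z - y)) (z - y)"])
         (use seg_has_integral[OF y z] in auto)
    from has_integral_mult_right[OF this, of 2]
    have i: "((\<lambda>t. 2 * G (l t) (z - y)) has_integral seg y z) {1/2..1}"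
      by (simp add: l_def)
    show ?thesis
    \<comment> \<open>At \<open>1/2\<close> the definition of \<open>\<tau>'\<close> takes the old
      velocity; a single point does not affect the integral.\<close>
    proof (rule has_integral_spike_finite[OF _ _ i, of "{1/2}"])
      fix t assume "t \<in> {1/2..1} - {1/2::real}"
      then have "1/2 < t" "l t \<in> strip" by (auto intro: l)
      then show "G (\<tau> t) (\<tau>' t) = 2 * G (l t) (z - y)"
        using normlike_scale[OF G_norm[of "l t"], of 2] by (simp add: \<tau>_def \<tau>'_def)
    qed simp
  qed
  have "((\<lambda>t. G (\<tau> t) (\<tau>' t)) has_integral (r + seg y z)) {0..1}"
    by (rule has_integral_combine[OF _ _ i1 i2]) auto
  moreover have "\<tau> 0 = x" "\<tau> 1 = z" by (auto simp: \<tau>_def \<sigma> l_def)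
  moreover have "finite K'" using K by (simp add: K'_def)
  ultimately show ?case using cont strip aff' der' by blast
qed

end

section \<open>Linear growth of lengths, height function and angle function\<close>

text \<open>\<open>sys\<close> has the same bound \<open>L\<close> for every nonzero winding number,
  as the systole does; growth proportional to \<open>k\<close> is derived in
  \<open>sys_int\<close>.\<close>

locale strip_systole = strip_metric +
  fixes L h :: real
  assumes L_nonneg: "0 \<le> L" and h_nonneg: "0 \<le> h"
    and sys: "\<And>x k r. reach x (x + (of_int k, 0)) r \<Longrightarrow> k \<noteq> 0 \<Longrightarrow> L \<le> r"
    and height: "\<And>a b r. reach (a, 0) (b, 1) r \<Longrightarrow> h \<le> r"
begin

text \<open>The chord lemma cuts out a middle piece with displacement \<open>(2 ^ n, 0)\<close>. The
  outer pieces, the last one shifted back by \<open>2 ^ n\<close>, join to a second path with that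
  displacement, so the bound doubles.\<close>

lemma sys_pow2: "reach x (x + (2 ^ n, 0)) r \<Longrightarrow> 2 ^ n * L \<le> r"
proof (induction n arbitrary: x r)
  case 0
  then show ?case using sys[of x 1 r] by simp
next
  case (Suc n)
  obtain \<sigma> where \<sigma>: "continuous_on {0..1} \<sigma>" "\<sigma> 0 = x" "\<sigma> 1 = x + (2 ^ Suc n, 0)"
    and sub: "\<And>s t. 0 \<le> s \<Longrightarrow> s \<le> t \<Longrightarrow> t \<le> (1::real) \<Longrightarrow>
       \<exists>a b c. reach x (\<sigma> s) a \<and> reach (\<sigma> s) (\<sigma> t) b \<and> reach (\<sigma> t) (x + (2 ^ Suc n, 0)) c \<and> a + b + c = r"
    using reach_imp_subdividing_path[OF Suc.prems] by blast
  define u where "u = (\<lambda>t. Complex (fst (\<sigma> t)) (snd (\<sigma> t)))"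
  have u: "continuous_on {0..1} u"
    unfolding u_def by (intro continuous_intros continuous_on_fst continuous_on_snd \<sigma>)
  obtain s t where st: "0 \<le> s" "s \<le> t" "t \<le> 1" "u t = u s + Complex (2 ^ n) 0"
  proof (rule half_chord[OF u])
    show "u 1 = u 0 + 2 * Complex (2 ^ n) 0" by (simp add: u_def \<sigma> complex_eq_iff)
  qed (auto simp: complex_eq_iff)
  then have \<sigma>t: "\<sigma> t = \<sigma> s + (2 ^ n, 0)"
    by (auto simp: u_def complex_eq_iff prod_eq_iff)
  obtain a b c where abc: "reach x (\<sigma> s) a" "reach (\<sigma> s) (\<sigma> t) b" "reach (\<sigma> t) (x + (2 ^ Suc n, 0)) c" "a + b + c = r"
    using sub[OF st(1-3)] by blast
  have 1: "2 ^ n * L \<le> b" using Suc.IH abc(2) by (simp add: \<sigma>t)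
  have e: "\<sigma> t + (of_int (- (2 ^ n)), 0) = \<sigma> s"
    "x + (2 ^ Suc n, 0) + (of_int (- (2 ^ n)), 0) = x + (2 ^ n, 0)"
    by (simp_all add: \<sigma>t prod_eq_iff)
  from reach_translate[OF abc(3), of "- (2 ^ n)"] have "reach (\<sigma> s) (x + (2 ^ n, 0)) c"
    unfolding e .
  from reach_trans[OF this abc(1)] have "2 ^ n * L \<le> a + c" by (rule Suc.IH)
  with 1 abc(4) show ?case by (simp add: algebra_simps)
qed

lemma reach_iterate:
  assumes "reach x (x + (of_nat n, 0)) r"
  shows "reach x (x + (of_nat (m * n), 0)) (of_nat m * r)"
proof (induction m)
  case 0
  then show ?case using reach.base[of x] reach_strip[OF assms] by (simp add: zero_prod_def[symmetric])
next
  case (Suc m)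
  have "reach (x + (of_int (int (m * n)), 0)) (x + (of_nat n, 0) + (of_int (int (m * n)), 0)) r"
    by (rule reach_translate[OF assms])
  then have "reach (x + (of_nat (m * n), 0)) (x + (of_nat (Suc m * n), 0)) r"
    by (simp add: add.assoc)
  from reach_trans[OF this Suc.IH] show ?case by (simp add: algebra_simps)
qed

text \<open>Write \<open>2 ^ k = m * n + j\<close> with \<open>j < n\<close>. Running the path
  \<open>m\<close> times and adding a horizontal edge of Euclidean length \<open>j\<close> gives
  \<open>2 ^ k * L \<le> m * r + K * n\<close>, so \<open>m * (n * L - r)\<close> stays bounded
  while \<open>m\<close> grows.\<close>

lemma sys_nat:
  assumes r: "reach x (x + (of_nat n, 0)) r"
  shows "of_nat n * L \<le> r"
proof (cases "n = 0")
  case True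
  then show ?thesis using reach_nonneg[OF r] by simp
next
  case False
  obtain K where K: "0 < K" "\<And>x v. x \<in> strip \<Longrightarrow> G x v \<le> K * norm v" using G_upper by blast
  have x: "x \<in> strip" using reach_strip[OF r] by simp
  have main: "of_nat m * (of_nat n * L - r) \<le> K * of_nat n" if m: "m = 2 ^ k div n" for m k :: nat
  proof -
    define j where "j = 2 ^ k mod n"
    have kj: "2 ^ k = m * n + j" "j < n" using False by (simp_all add: m j_def)
    define y where "y = x + (of_nat (m * n), 0)"
    have y: "y \<in> strip" using x by (simp add: y_def strip_shift)
    have y2: "y + (of_nat j, 0) = x + (2 ^ k, 0)"
    proof -
      have "(2::real) ^ k = of_nat (m * n + j)" using kj(1) by (metis of_nat_numeral of_nat_power)
      then show ?thesis by (simp add: y_def add.assoc)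
    qed
    have "reach y (y + (of_nat j, 0)) (seg y (y + (of_nat j, 0)))"
      by (intro reach_seg y strip_shift)
    from reach_trans[OF this reach_iterate[OF r, of m, folded y_def]]
    have "reach x (x + (2 ^ k, 0)) (of_nat m * r + seg y (y + (of_nat j, 0)))"
      unfolding y2 .
    then have "2 ^ k * L \<le> of_nat m * r + seg y (y + (of_nat j, 0))" by (rule sys_pow2)
    also have "seg y (y + (of_nat j, 0)) \<le> K * of_nat j"
    proof (rule seg_le[OF y strip_shift[OF y]])
      fix t :: real assume "0 \<le> t" "t \<le> 1"
      then have "y + t *\<^sub>R (y + (of_nat j, 0) - y) \<in> strip" by (intro strip_segment y strip_shift)
      from K(2)[OF this, of "y + (of_nat j, 0) - y"]
      show "G (y + t *\<^sub>R (y + (of_nat j, 0) - y)) (y + (of_nat j, 0) - y) \<le> K * of_nat j"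
        by (simp add: norm_Pair)
    qed
    also have "\<dots> \<le> K * of_nat n" using K kj by simp
    finally have "2 ^ k * L \<le> of_nat m * r + K * of_nat n" by simp
    moreover have "of_nat m * of_nat n * L \<le> 2 ^ k * L"
    proof (rule mult_right_mono[OF _ L_nonneg])
      have "m * n \<le> 2 ^ k" using kj by simp
      then show "real m * real n \<le> 2 ^ k" by (metis of_nat_le_iff of_nat_mult of_nat_numeral of_nat_power)
    qed
    ultimately show ?thesis by (simp add: algebra_simps)
  qed
  show ?thesis
  proof (rule ccontr)
    assume "\<not> ?thesis"
    then have d: "0 < of_nat n * L - r" by simp
    obtain M :: nat where M: "K * of_nat n / (of_nat n * L - r) < of_nat M" using reals_Archimedean2 by blast
    \<comment> \<open>Since \<open>M * n \<le> 2 ^ (M * n)\<close>, the quotient \<open>m\<close> is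
      then at least \<open>M\<close>.\<close>
    define k where "k = M * n"
    have "M \<le> 2 ^ k div n"
    proof -
      have "M * n \<le> 2 ^ k" unfolding k_def using less_exp[of "M * n"] by simp
      then have "M * n div n \<le> 2 ^ k div n" by (rule div_le_mono)
      then show ?thesis using False by simp
    qed
    then have "of_nat M * (of_nat n * L - r) \<le> of_nat (2 ^ k div n) * (of_nat n * L - r)"
      using d by (intro mult_right_mono) (simp_all only: of_nat_le_iff less_imp_le)
    also have "\<dots> \<le> K * of_nat n" by (rule main[OF HOL.refl])
    finally show False using M d by (simp add: field_simps)
  qed
qed

lemma sys_int:
  assumes r: "reach x (x + (of_int k, 0)) r"
  shows "\<bar>of_int k\<bar> * L \<le> r"
proof (cases "0 \<le> k")
  case True
  then show ?thesis using sys_nat[of x "nat k" r] r by simp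
next
  case False
  have "reach (x + (of_int k, 0)) (x + (of_int k, 0) + (of_nat (nat (-k)), 0)) r"
    using reach_sym[OF r] False by (simp add: add.assoc) (simp add: zero_prod_def[symmetric])
  from sys_nat[OF this] False show ?thesis by simp
qed

text \<open>\<open>height\<close> forces the distance to the bottom to be at least \<open>h\<close>
  on the top edge, so the cap makes the edge value exact; it keeps the Lipschitz bound because
  \<open>seg\<close> is nonnegative.\<close>

lemma exists_height_function:
  obtains f where "\<And>a. f (a, 0) = 0" "\<And>a. f (a, 1) = h" "\<And>x. x \<in> strip \<Longrightarrow> 0 \<le> f x \<and> f x \<le> h"
    "\<And>x. x \<in> strip \<Longrightarrow> f (x + (1, 0)) = f x"
    "\<And>x y. x \<in> strip \<Longrightarrow> y \<in> strip \<Longrightarrow> f y \<le> f x + seg x y"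
proof -
  define R where "R = (\<lambda>x. {r. \<exists>a. reach (a, 0) x r})"
  have ne: "R x \<noteq> {}" if "x \<in> strip" for x
    using reach_seg[of "(0,0)" x] that by (auto simp: R_def mem_strip)
  have nn: "0 \<le> r" if "r \<in> R x" for r x using that reach_nonneg unfolding R_def by blast
  have bdd: "bdd_below (R x)" for x using nn by (intro bdd_belowI[of _ 0]) auto
  define D where "D x = Inf (R x)" for x
  have D0: "0 \<le> D x" if "x \<in> strip" for x
    unfolding D_def by (rule cInf_greatest[OF ne[OF that]]) (rule nn)
  have Dle: "D x \<le> r" if "r \<in> R x" for x r
    unfolding D_def by (rule cInf_lower[OF that bdd])
  have Dstep: "D y \<le> D x + seg x y" if x: "x \<in> strip" and y: "y \<in> strip" for x y
  proof -
    have "D y - seg x y \<le> D x"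
      unfolding D_def[of x]
    proof (rule cInf_greatest[OF ne[OF x]])
      fix r assume "r \<in> R x"
      then have "r + seg x y \<in> R y" using reach.step[OF _ y] unfolding R_def by blast
      from Dle[OF this] show "D y - seg x y \<le> r" by simp
    qed
    then show ?thesis by simp
  qed
  have Dper: "D (x + (1, 0)) = D x" for x
  proof -
    have "R (x + (of_int k, 0)) \<subseteq> R x" for x k
    proof
      fix r assume "r \<in> R (x + (of_int k, 0))"
      then obtain a where "reach (a, 0) (x + (of_int k, 0)) r" by (auto simp: R_def)
      from reach_translate[OF this, of "-k"] have "reach (a - of_int k, 0) x r"
        by (simp add: add.assoc) (simp add: zero_prod_def[symmetric])
      then show "r \<in> R x" by (auto simp: R_def)
    qed
    from this[of x 1] this[of "x + (1,0)" "-1"] have "R (x + (1, 0)) = R x"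
      by (auto simp: add.assoc zero_prod_def[symmetric])
    then show ?thesis by (simp add: D_def)
  qed
  have Dbot: "D (a, 0) = 0" for a
    using Dle[of 0 "(a, 0)"] D0[of "(a, 0)"] reach.base[of "(a, 0)"] by (force simp: R_def mem_strip)
  have Dtop: "h \<le> D (a, 1)" for a
    unfolding D_def by (rule cInf_greatest[OF ne]) (auto simp: mem_strip R_def intro: height)
  show thesis
  proof (rule that[of "\<lambda>x. min h (D x)"])
    show "min h (D y) \<le> min h (D x) + seg x y" if "x \<in> strip" "y \<in> strip" for x y
      using Dstep[OF that] seg_nonneg[OF that] by (auto simp: min_def)
  qed (use Dbot Dtop Dper D0 h_nonneg in \<open>auto simp: min_def intro: antisym\<close>)
qed

text \<open>Translating a path by \<open>k\<close> shifts its index by \<open>k\<close> and raises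
  the competing value by \<open>k * L\<close>; the cases \<open>k = 1\<close> and
  \<open>k = -1\<close> together give the equality for one period.\<close>

lemma exists_angle_function:
  obtains g where "\<And>x. x \<in> strip \<Longrightarrow> g (x + (1, 0)) = g x + L"
    "\<And>x y. x \<in> strip \<Longrightarrow> y \<in> strip \<Longrightarrow> g y \<le> g x + seg x y"
proof -
  define R where "R = (\<lambda>x. {r + of_int n * L |n r. reach (of_int n, 0) x r})"
  have ne: "R x \<noteq> {}" if "x \<in> strip" for x
    using reach_seg[of "(of_int 0,0)" x] that unfolding R_def mem_strip by fastforce
  \<comment> \<open>Prolonging the path to \<open>(0,0)\<close> yields displacement
    \<open>-n\<close>, hence length at least \<open>\<bar>n\<bar> * L \<ge> - n * L\<close>; this
    bounds the competing values from below.\<close>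
  have lb: "- seg x (0,0) \<le> q" if q: "q \<in> R x" and x: "x \<in> strip" for q x
  proof -
    obtain n r where nr: "q = r + of_int n * L" "reach (of_int n, 0) x r" using q by (auto simp: R_def)
    have "reach (of_int n, 0) (0, 0) (r + seg x (0, 0))"
      by (rule reach.step[OF nr(2)]) (simp add: mem_strip)
    then have "reach (of_int n, 0) ((of_int n, 0) + (of_int (-n), 0)) (r + seg x (0, 0))" by simp
    from sys_int[OF this] have "\<bar>of_int n\<bar> * L \<le> r + seg x (0, 0)" by simp
    moreover have "- of_int n * L \<le> \<bar>of_int n\<bar> * L" by (rule mult_right_mono[OF _ L_nonneg]) linarith
    ultimately show ?thesis by (simp add: nr)
  qed
  have bdd: "bdd_below (R x)" if "x \<in> strip" for x using lb[OF _ that] by (rule bdd_belowI)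
  define D where "D x = Inf (R x)" for x
  have Dle: "D x \<le> r" if "r \<in> R x" "x \<in> strip" for x r
    unfolding D_def by (rule cInf_lower[OF that(1) bdd[OF that(2)]])
  have Dstep: "D y \<le> D x + seg x y" if x: "x \<in> strip" and y: "y \<in> strip" for x y
  proof -
    have "D y - seg x y \<le> D x"
      unfolding D_def[of x]
    proof (rule cInf_greatest[OF ne[OF x]])
      fix q assume "q \<in> R x"
      then obtain n r where nr: "q = r + of_int n * L" "reach (of_int n, 0) x r" by (auto simp: R_def)
      have "(r + seg x y) + of_int n * L \<in> R y" using reach.step[OF nr(2) y] by (auto simp: R_def)
      from Dle[OF this y] show "D y - seg x y \<le> q" by (simp add: nr)
    qed
    then show ?thesis by simp
  qed
  have shift: "D (x + (of_int k, 0)) \<le> D x + of_int k * L" if x: "x \<in> strip" for x k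
  proof -
    have "D (x + (of_int k, 0)) - of_int k * L \<le> D x"
      unfolding D_def[of x]
    proof (rule cInf_greatest[OF ne[OF x]])
      fix q assume "q \<in> R x"
      then obtain n r where nr: "q = r + of_int n * L" "reach (of_int n, 0) x r" by (auto simp: R_def)
      have "reach (of_int (n + k), 0) (x + (of_int k, 0)) r" using reach_translate[OF nr(2), of k] by simp
      then have "r + of_int (n + k) * L \<in> R (x + (of_int k, 0))" unfolding R_def by blast
      from Dle[OF this strip_shift[OF x]] show "D (x + (of_int k, 0)) - of_int k * L \<le> q"
        by (simp add: nr algebra_simps)
    qed
    then show ?thesis by simp
  qed
  show thesis
  proof (rule that[of D])
    fix x assume x: "x \<in> strip"
    have e: "x + (1, 0) + (of_int (-1), 0) = x" by (simp add: prod_eq_iff)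
    show "D (x + (1, 0)) = D x + L"
      using shift[OF x, of 1] shift[OF strip_shift[OF x, of 1], of "-1", unfolded e] by simp
  qed (rule Dstep)
qed

end

section \<open>Averages of Lipschitz functions on the strip\<close>

text \<open>One comparison principle serves for periodicity, for values near the edges and for the
  gradient bound. The base points may differ because both averages run over the same shifts
  \<open>(a, b)\<close>.\<close>

lemma mollify_mono:
  assumes "continuous_on UNIV \<phi>" "continuous_on UNIV \<psi>" "0 < \<delta>"
    and le: "\<And>a b. 0 \<le> a \<Longrightarrow> a \<le> \<delta> \<Longrightarrow> 0 \<le> b \<Longrightarrow> b \<le> \<delta> \<Longrightarrow>
        \<phi> (fst z + a, snd z + b) \<le> \<psi> (fst w + a, snd w + b) + c"
  shows "mollify \<delta> \<phi> z \<le> mollify \<delta> \<psi> w + c"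
proof -
  have i1: "(\<lambda>a. k (x + a, y)) integrable_on {0..\<delta>}" if "continuous_on UNIV k" for k :: "real \<times> real \<Rightarrow> real" and x y
    by (intro integrable_continuous_real continuous_on_compose2[OF that] continuous_intros) auto
  have i2: "(\<lambda>b. k (x, y + b)) integrable_on {0..\<delta>}" if "continuous_on UNIV k" for k :: "real \<times> real \<Rightarrow> real" and x y
    by (intro integrable_continuous_real continuous_on_compose2[OF that] continuous_intros) auto
  have s1: "slide1 \<delta> \<phi> (fst z, snd z + b) \<le> slide1 \<delta> \<psi> (fst w, snd w + b) + c * \<delta>" if b: "0 \<le> b" "b \<le> \<delta>" for b
  proof -
    have "integral {0..\<delta>} (\<lambda>a. \<phi> (fst z + a, snd z + b)) \<le> integral {0..\<delta>} (\<lambda>a. \<psi> (fst w + a, snd w + b) + c)"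
      by (intro integral_le integrable_add i1 assms integrable_const_ivl) (use le b in auto)
    also have "\<dots> = integral {0..\<delta>} (\<lambda>a. \<psi> (fst w + a, snd w + b)) + integral {0..\<delta>} (\<lambda>a. c)"
      by (intro integral_add i1 assms integrable_const_ivl)
    finally show ?thesis using \<open>0 < \<delta>\<close> by (simp add: slide1_def mult.commute)
  qed
  have "integral {0..\<delta>} (\<lambda>b. slide1 \<delta> \<phi> (fst z, snd z + b)) \<le> integral {0..\<delta>} (\<lambda>b. slide1 \<delta> \<psi> (fst w, snd w + b) + c * \<delta>)"
    by (intro integral_le integrable_add i2 continuous_slide1 assms integrable_const_ivl) (use s1 in auto)
  also have "\<dots> = integral {0..\<delta>} (\<lambda>b. slide1 \<delta> \<psi> (fst w, snd w + b)) + integral {0..\<delta>} (\<lambda>b. c * \<delta>)"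
    by (intro integral_add i2 continuous_slide1 assms integrable_const_ivl)
  finally have "slide2 \<delta> (slide1 \<delta> \<phi>) z \<le> slide2 \<delta> (slide1 \<delta> \<psi>) w + c * \<delta>\<^sup>2"
    using \<open>0 < \<delta>\<close> by (simp add: slide2_def power2_eq_square mult_ac)
  then show ?thesis using \<open>0 < \<delta>\<close> by (simp add: mollify_def field_simps)
qed

lemma mollify_const: "0 < \<delta> \<Longrightarrow> mollify \<delta> (\<lambda>_. c) z = c"
  by (simp add: mollify_def slide1_def slide2_def power2_eq_square)

lemma mollify_shift:
  assumes "continuous_on UNIV \<phi>" "0 < \<delta>" "\<And>z. \<phi> (z + (1, 0)) = \<phi> z + c"
  shows "mollify \<delta> \<phi> (z + (1, 0)) = mollify \<delta> \<phi> z + c"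
proof (rule antisym)
  have e: "\<phi> (fst z + 1 + a, b) = \<phi> (fst z + a, b) + c" for a b
    using assms(3)[of "(fst z + a, b)"] by (simp add: algebra_simps)
  show "mollify \<delta> \<phi> (z + (1, 0)) \<le> mollify \<delta> \<phi> z + c"
    by (rule mollify_mono) (use assms e in auto)
  have "mollify \<delta> \<phi> z \<le> mollify \<delta> \<phi> (z + (1, 0)) + - c"
    by (rule mollify_mono) (use assms e in auto)
  then show "mollify \<delta> \<phi> z + c \<le> mollify \<delta> \<phi> (z + (1, 0))" by simp
qed

lemma moll2_shift:
  assumes "continuous_on UNIV \<phi>" "0 < \<delta>" "\<And>z. \<phi> (z + (1, 0)) = \<phi> z + c"
  shows "moll2 \<delta> \<phi> (x + 1, y) = moll2 \<delta> \<phi> (x, y)"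
proof -
  have "((\<lambda>y. mollify \<delta> \<phi> (x + 1, y)) has_real_derivative moll2 \<delta> \<phi> (x + 1, y)) (at y)"
    by (rule mollify_deriv2[OF assms(1,2)])
  moreover have "(\<lambda>y. mollify \<delta> \<phi> (x + 1, y)) = (\<lambda>y. mollify \<delta> \<phi> (x, y) + c)"
    using mollify_shift[OF assms, of "(x, _)"] by simp
  moreover have "((\<lambda>y. mollify \<delta> \<phi> (x, y) + c) has_real_derivative moll2 \<delta> \<phi> (x, y) + 0) (at y)"
    by (intro DERIV_add mollify_deriv2[OF assms(1,2)] DERIV_const)
  ultimately show ?thesis by (auto dest: DERIV_unique)
qed

text \<open>The functions are controlled in the strip only. Freezing their edge values beyond it
  extends them continuously to the plane, where averages can be formed at every point.\<close>

definition clamp_snd :: "real \<times> real \<Rightarrow> real \<times> real" where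
  "clamp_snd z = (fst z, max 0 (min 1 (snd z)))"

lemma clamp_snd_mem: "clamp_snd z \<in> strip"
  by (simp add: clamp_snd_def mem_strip)

lemma clamp_snd_id: "z \<in> strip \<Longrightarrow> clamp_snd z = z"
  by (cases z) (auto simp: clamp_snd_def mem_strip)

lemma clamp_snd_shift: "clamp_snd (z + (1, 0)) = clamp_snd z + (1, 0)"
  by (simp add: clamp_snd_def)

context strip_metric
begin

text \<open>The bound on \<open>G\<close> by \<open>K\<close> makes \<open>seg\<close> at most
  \<open>K\<close> times the Euclidean distance, so the function is Lipschitz in the ordinary
  sense.\<close>

lemma continuous_on_lipschitz_clamp:
  assumes lip: "\<And>x y. x \<in> strip \<Longrightarrow> y \<in> strip \<Longrightarrow> \<phi> y \<le> \<phi> x + seg x y"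
  shows "continuous_on UNIV (\<phi> \<circ> clamp_snd)"
proof -
  obtain K where K: "0 < K" "\<And>x v. x \<in> strip \<Longrightarrow> G x v \<le> K * norm v" using G_upper by blast
  have sb: "seg x y \<le> K * dist x y" if "x \<in> strip" "y \<in> strip" for x y
    by (rule seg_le[OF that], rule order_trans[OF K(2)])
       (use strip_segment[OF that] in \<open>auto simp: dist_norm norm_minus_commute\<close>)
  have ab: "\<bar>\<phi> x - \<phi> y\<bar> \<le> K * dist x y" if "x \<in> strip" "y \<in> strip" for x y
    using lip[OF that] lip[OF that(2,1)] sb[OF that] sb[OF that(2,1)] by (simp add: dist_commute abs_le_iff)
  have "continuous_on strip \<phi>"
    unfolding continuous_on_iff
  proof (intro ballI allI impI)
    fix x and e :: real assume x: "x \<in> strip" and e: "0 < e"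
    show "\<exists>d>0. \<forall>x'\<in>strip. dist x' x < d \<longrightarrow> dist (\<phi> x') (\<phi> x) < e"
    proof (intro exI[of _ "e / K"] conjI ballI impI)
      fix x' assume "x' \<in> strip" "dist x' x < e / K"
      then have "K * dist x' x < e" using K by (simp add: field_simps)
      then show "dist (\<phi> x') (\<phi> x) < e" using ab[OF \<open>x' \<in> strip\<close> x] by (simp add: dist_real_def)
    qed (use e K in auto)
  qed
  then have "continuous_on (range clamp_snd) \<phi>"
    by (rule continuous_on_subset) (use clamp_snd_mem in blast)
  moreover have "continuous_on UNIV clamp_snd"
    unfolding clamp_snd_def[abs_def] by (intro continuous_intros)
  ultimately show ?thesis by (intro continuous_on_compose)
qed

text \<open>The averages at \<open>z + t v\<close> and at \<open>z\<close> are compared shift by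
  shift along translated segments. All of these stay within \<open>\<rho>\<close> of
  \<open>z\<close>, so each has length at most \<open>t * (c * G z v)\<close>; dividing by
  \<open>t\<close> and letting \<open>t\<close> tend to 0 bounds the derivative in direction
  \<open>v\<close>.\<close>

lemma mollify_gradient_in_polar:
  assumes lip: "\<And>x y. x \<in> strip \<Longrightarrow> y \<in> strip \<Longrightarrow> \<phi> y \<le> \<phi> x + seg x y"
    and \<delta>: "0 < \<delta>" "3 * \<delta> < \<rho>"
    and \<rho>: "\<And>w v. w \<in> strip \<Longrightarrow> dist z w < \<rho> \<Longrightarrow> G w v \<le> c * G z v"
    and z: "0 < snd z" "snd z < 1 - \<delta>"
  shows "(moll1 \<delta> (\<phi> \<circ> clamp_snd) z, moll2 \<delta> (\<phi> \<circ> clamp_snd) z) \<in> polar_body (\<lambda>v. c * G z v)"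
proof (rule polar_bodyI)
  fix v :: "real \<times> real"
  let ?\<phi> = "\<phi> \<circ> clamp_snd"
  define M where "M = mollify \<delta> ?\<phi>"
  note cont = continuous_on_lipschitz_clamp[OF lip]
  define D where "D = (\<lambda>v. fst v * moll1 \<delta> ?\<phi> z + snd v * moll2 \<delta> ?\<phi> z)"
  have MD: "(M has_derivative D) (at z)"
    unfolding M_def D_def by (rule mollify_has_derivative[OF cont \<delta>(1)])
  have "((\<lambda>t. z + t *\<^sub>R v) has_derivative (\<lambda>t. t *\<^sub>R v)) (at 0)"
    by (auto intro!: derivative_eq_intros)
  from diff_chain_at[OF this, of M D] MD
  have "((\<lambda>t. M (z + t *\<^sub>R v)) has_derivative (\<lambda>t. D (t *\<^sub>R v))) (at 0)"
    by (simp add: o_def)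
  moreover have "(\<lambda>t. D (t *\<^sub>R v)) = (*) (D v)" by (auto simp: D_def algebra_simps)
  ultimately have "((\<lambda>t. M (z + t *\<^sub>R v)) has_real_derivative D v) (at 0)"
    by (simp add: has_field_derivative_def)
  then have "((\<lambda>t. (M (z + t *\<^sub>R v) - M z) / t) \<longlongrightarrow> D v) (at 0)"
    by (simp add: has_field_derivative_iff)
  \<comment> \<open>The limit from the right is enough, and division by a positive \<open>t\<close>
    preserves the inequality.\<close>
  then have lim: "((\<lambda>t. (M (z + t *\<^sub>R v) - M z) / t) \<longlongrightarrow> D v) (at_right 0)"
    by (rule filterlim_mono) (auto simp: at_le)
  have c1: "((\<lambda>t. snd (z + t *\<^sub>R v)) \<longlongrightarrow> snd (z + 0 *\<^sub>R v)) (at_right 0)"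
    by (intro tendsto_intros)
  have c2: "((\<lambda>t. norm (t *\<^sub>R v)) \<longlongrightarrow> norm (0 *\<^sub>R v)) (at_right 0)"
    by (intro tendsto_intros)
  have "\<forall>\<^sub>F t in at_right 0. 0 < snd (z + t *\<^sub>R v)"
    by (rule order_tendstoD(1)[OF c1]) (use z in simp)
  moreover have "\<forall>\<^sub>F t in at_right 0. snd (z + t *\<^sub>R v) < 1 - \<delta>"
    by (rule order_tendstoD(2)[OF c1]) (use z in simp)
  moreover have "\<forall>\<^sub>F t in at_right 0. norm (t *\<^sub>R v) < \<delta>"
    by (rule order_tendstoD(2)[OF c2]) (use \<delta> in simp)
  moreover have "\<forall>\<^sub>F t in at_right (0::real). 0 < t" by (simp add: eventually_at_right_less)
  ultimately have "\<forall>\<^sub>F t in at_right 0. (M (z + t *\<^sub>R v) - M z) / t \<le> c * G z v"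
  proof eventually_elim
    case (elim t)
    have "M (z + t *\<^sub>R v) \<le> M z + t * (c * G z v)"
      unfolding M_def
    proof (rule mollify_mono[OF cont cont \<delta>(1)])
      fix a b :: real assume ab: "0 \<le> a" "a \<le> \<delta>" "0 \<le> b" "b \<le> \<delta>"
      define w where "w = z + (a, b)"
      define w' where "w' = z + t *\<^sub>R v + (a, b)"
      have w: "w \<in> strip" and w': "w' \<in> strip"
        using ab z elim by (auto simp: w_def w'_def mem_strip)
      have d: "w' - w = t *\<^sub>R v" by (simp add: w_def w'_def)
      have "seg w w' \<le> t * (c * G z v)"
      proof (rule seg_le[OF w w'])
        fix s :: real assume s: "0 \<le> s" "s \<le> 1"
        define q where "q = w + s *\<^sub>R (w' - w)"
        have q: "q \<in> strip" unfolding q_def by (rule strip_segment[OF w w' s])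
        have e: "q = z + ((a, b) + s *\<^sub>R (t *\<^sub>R v))"
          unfolding q_def d unfolding w_def by (simp only: add.assoc)
        have "dist z q = norm ((a, b) + s *\<^sub>R (t *\<^sub>R v))"
          by (subst dist_commute) (simp add: dist_norm e)
        also have "\<dots> \<le> norm (a, b) + norm (s *\<^sub>R (t *\<^sub>R v))" by (rule norm_triangle_ineq)
        also have "norm (s *\<^sub>R (t *\<^sub>R v)) \<le> 1 * norm (t *\<^sub>R v)"
          unfolding norm_scaleR[of s] using s by (intro mult_right_mono) auto
        also have "norm (a, b) \<le> \<bar>a\<bar> + \<bar>b\<bar>" using norm_Pair_le[of a b] by simp
        \<comment> \<open>The shifts \<open>a\<close> and \<open>b\<close> and the step
          \<open>t v\<close> contribute at most \<open>\<delta>\<close> each, whence the assumption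
          on \<open>3 * \<delta>\<close>.\<close>
        finally have "dist z q < \<rho>" using elim ab \<delta> by simp
        from \<rho>[OF q this, of v] have "t * G q v \<le> t * (c * G z v)" using elim by (intro mult_left_mono) auto
        moreover have "G q (t *\<^sub>R v) = t * G q v"
          using normlike_scale[OF G_norm[OF q], of t v] elim by simp
        ultimately show "G (w + s *\<^sub>R (w' - w)) (w' - w) \<le> t * (c * G z v)"
          by (simp add: q_def d)
      qed
      with lip[OF w w'] have "\<phi> w' \<le> \<phi> w + t * (c * G z v)" by simp
      moreover have "w' = (fst (z + t *\<^sub>R v) + a, snd (z + t *\<^sub>R v) + b)" "w = (fst z + a, snd z + b)"
        by (simp_all add: w_def w'_def prod_eq_iff)
      ultimately show "?\<phi> (fst (z + t *\<^sub>R v) + a, snd (z + t *\<^sub>R v) + b) \<le> ?\<phi> (fst z + a, snd z + b) + t * (c * G z v)"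
        using clamp_snd_id[OF w] clamp_snd_id[OF w'] by simp
    qed
    then show ?case using elim by (simp add: field_simps)
  qed
  from tendsto_upperbound[OF lim this] have "D v \<le> c * G z v" by simp
  then show "(moll1 \<delta> ?\<phi> z, moll2 \<delta> ?\<phi> z) \<bullet> v \<le> c * G z v"
    by (simp add: D_def inner_prod_def mult.commute)
qed

definition area :: "real \<times> real \<Rightarrow> real" where
  "area z = measure lborel (polar_body (G z))"

lemma continuous_area: "continuous_on strip area"
  unfolding area_def[abs_def] by (rule continuous_on_polar_area[OF G_cont G_norm])

end

section \<open>The area estimate\<close>

context strip_systole
begin

text \<open>The smoothed height and angle functions take the places of \<open>P\<close> and
  \<open>Q\<close> in Green's formula. The limit in \<open>\<delta>\<close> comes before the one in
  \<open>\<eta>\<close>, since the admissible \<open>\<delta>\<close> depend on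
  \<open>\<eta>\<close> through \<open>\<rho>\<close>.\<close>

lemma area_integral_ge:
  "2 * (L * h) \<le> integral (cbox (0,0) (1,1)) area"
proof -
  obtain f where f0: "\<And>a. f (a, 0) = 0" and f1: "\<And>a. f (a, 1) = h"
    and f_bd: "\<And>x. x \<in> strip \<Longrightarrow> 0 \<le> f x \<and> f x \<le> h"
    and f_per: "\<And>x. x \<in> strip \<Longrightarrow> f (x + (1, 0)) = f x"
    and f_lip: "\<And>x y. x \<in> strip \<Longrightarrow> y \<in> strip \<Longrightarrow> f y \<le> f x + seg x y"
    using exists_height_function by blast
  obtain g where g_per: "\<And>x. x \<in> strip \<Longrightarrow> g (x + (1, 0)) = g x + L"
    and g_lip: "\<And>x y. x \<in> strip \<Longrightarrow> y \<in> strip \<Longrightarrow> g y \<le> g x + seg x y"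
    using exists_angle_function by blast
  obtain K where K: "0 < K" "\<And>x v. x \<in> strip \<Longrightarrow> G x v \<le> K * norm v" using G_upper by blast
  let ?f = "f \<circ> clamp_snd" and ?g = "g \<circ> clamp_snd"
  note cf = continuous_on_lipschitz_clamp[of f, OF f_lip]
  note cg = continuous_on_lipschitz_clamp[of g, OF g_lip]
  have f_per': "?f (z + (1, 0)) = ?f z + 0" for z
    using f_per[OF clamp_snd_mem] by (simp add: clamp_snd_shift)
  have g_per': "?g (z + (1, 0)) = ?g z + L" for z
    using g_per[OF clamp_snd_mem] by (simp add: clamp_snd_shift)
  \<comment> \<open>At distance \<open>b\<close> from an edge \<open>f\<close> deviates from its
    edge value by at most \<open>K * b\<close>; this controls the smoothed function on the
    horizontal sides of the smaller rectangle.\<close>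
  have f_low: "f (a, b) \<le> K * b" and f_high: "h - K * (1 - b) \<le> f (a, b)" if b: "0 \<le> b" "b \<le> 1" for a b
  proof -
    have s: "(a, b) \<in> strip" "(a, 0) \<in> strip" "(a, 1) \<in> strip" using b by (auto simp: mem_strip)
    have "seg (a, 0) (a, b) \<le> K * b"
      by (rule seg_le[OF s(2,1)], rule order_trans[OF K(2)[OF strip_segment[OF s(2,1)]]]) (use b in auto)
    then show "f (a, b) \<le> K * b" using f_lip[OF s(2,1)] f0 by simp
    have "seg (a, b) (a, 1) \<le> K * (1 - b)"
      by (rule seg_le[OF s(1,3)], rule order_trans[OF K(2)[OF strip_segment[OF s(1,3)]]]) (use b in auto)
    then show "h - K * (1 - b) \<le> f (a, b)" using f_lip[OF s(1,3)] f1 by simp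
  qed
  define I where "I = integral (cbox (0,0) (1,1)) area"
  have area_nn: "0 \<le> area z" for z by (simp add: area_def)
  have int_area: "area integrable_on cbox (a,b) (c,d)" if "0 \<le> b" "d \<le> 1" for a b c d
    by (rule integrable_continuous[OF continuous_on_subset[OF continuous_area]]) (use that in \<open>auto simp: mem_strip\<close>)
  \<comment> \<open>The loss \<open>8 * K * K * \<delta>\<close> collects
    \<open>4 * K * K * \<delta>\<close> from each horizontal side: a deviation
    \<open>2 * K * \<delta>\<close> of the smoothed \<open>f\<close> from its edge value times a
    bound \<open>2 * K\<close> on the \<open>x\<close>-derivative of the smoothed
    \<open>g\<close>.\<close>
  have step: "2 * (h * L - 8 * K * K * \<delta>) \<le> (1 + \<eta>)\<^sup>2 * I"
    if \<eta>: "0 < \<eta>" "\<eta> \<le> 1"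
      and \<rho>: "\<And>z w v. z \<in> strip \<Longrightarrow> w \<in> strip \<Longrightarrow> dist z w < \<rho> \<Longrightarrow> G w v \<le> (1 + \<eta>) * G z v"
      and \<delta>: "0 < \<delta>" "3 * \<delta> < \<rho>" "3 * \<delta> < 1"
    for \<eta> \<rho> \<delta>
  proof -
    define P where "P = mollify \<delta> ?f"
    define P1 where "P1 = moll1 \<delta> ?f"
    define P2 where "P2 = moll2 \<delta> ?f"
    define Q1 where "Q1 = moll1 \<delta> ?g"
    define Q2 where "Q2 = moll2 \<delta> ?g"
    note defs = P_def P1_def P2_def Q1_def Q2_def
    \<comment> \<open>The averaging squares reach upwards by \<open>\<delta>\<close>; lowering the
      top by \<open>2 * \<delta>\<close> leaves the strict inequality
      \<open>snd z < 1 - \<delta>\<close> that the gradient bound wants.\<close>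
    let ?R = "cbox (0, \<delta>) (1, 1 - 2 * \<delta>)"
    have inR: "z \<in> strip" "0 < snd z" "snd z < 1 - \<delta>" if "\<delta> \<le> snd z" "snd z \<le> 1 - 2 * \<delta>" for z
      using that \<delta> by (auto simp: mem_strip)
    have pol: "(P1 z, P2 z) \<in> polar_body (\<lambda>v. (1 + \<eta>) * G z v)" "(Q1 z, Q2 z) \<in> polar_body (\<lambda>v. (1 + \<eta>) * G z v)"
      if z: "\<delta> \<le> snd z" "snd z \<le> 1 - 2 * \<delta>" for z
      unfolding defs
       apply (rule mollify_gradient_in_polar[OF f_lip \<delta>(1,2) \<rho>[OF inR(1)[OF z]] inR(2,3)[OF z]]; assumption)
      apply (rule mollify_gradient_in_polar[OF g_lip \<delta>(1,2) \<rho>[OF inR(1)[OF z]] inR(2,3)[OF z]]; assumption)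
      done
    have contP: "continuous_on UNIV P" unfolding P_def by (rule continuous_mollify[OF cf \<delta>(1)])
    have contP1: "continuous_on UNIV P1" unfolding P1_def by (rule continuous_moll1[OF cf \<delta>(1)])
    have contP2: "continuous_on UNIV P2" unfolding P2_def by (rule continuous_moll2[OF cf \<delta>(1)])
    have contQ1: "continuous_on UNIV Q1" unfolding Q1_def by (rule continuous_moll1[OF cg \<delta>(1)])
    have contQ2: "continuous_on UNIV Q2" unfolding Q2_def by (rule continuous_moll2[OF cg \<delta>(1)])
    have neg_le_abs: "- X * 2 \<le> 2 * \<bar>X\<bar>" for X :: real by simp
    \<comment> \<open>The minus sign anticipates the orientation: the top side enters Green's
      formula negatively, and it is the side that yields \<open>h * L\<close>.\<close>
    have J: "- (P1 z * Q2 z - P2 z * Q1 z) * 2 \<le> (1 + \<eta>)\<^sup>2 * area z" if z: "z \<in> ?R" for z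
    proof -
      have zz: "\<delta> \<le> snd z" "snd z \<le> 1 - 2 * \<delta>" using z by (cases z; auto)+
      have "2 * \<bar>P1 z * Q2 z - Q1 z * P2 z\<bar> \<le> measure lborel (polar_body (\<lambda>v. (1 + \<eta>) * G z v))"
        using polar_area_ge_det[OF normlike_mult[OF G_norm[OF inR(1)[OF zz]], of "1 + \<eta>"] pol[OF zz]] \<eta> by simp
      also have "\<dots> = (1 + \<eta>)\<^sup>2 * area z"
        unfolding area_def using \<eta> by (intro polar_area_scale G_norm inR(1)[OF zz]) auto
      finally have "2 * \<bar>P1 z * Q2 z - Q1 z * P2 z\<bar> \<le> (1 + \<eta>)\<^sup>2 * area z" .
      moreover have "- (P1 z * Q2 z - P2 z * Q1 z) * 2 \<le> 2 * \<bar>P1 z * Q2 z - Q1 z * P2 z\<bar>"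
        unfolding mult.commute[of "P2 z"] by (rule neg_le_abs)
      ultimately show ?thesis by (rule order_trans[rotated])
    qed
    have Q1b: "\<bar>Q1 z\<bar> \<le> 2 * K" if z: "\<delta> \<le> snd z" "snd z \<le> 1 - 2 * \<delta>" for z
    proof -
      have le: "(Q1 z, Q2 z) \<bullet> v \<le> 2 * (K * norm v)" for v
      proof -
        have zs: "z \<in> strip" by (rule inR(1)[OF z])
        have "(Q1 z, Q2 z) \<bullet> v \<le> (1 + \<eta>) * G z v" by (rule polar_bodyD[OF pol(2)[OF z]])
        also have "\<dots> \<le> 2 * G z v"
          \<comment> \<open>\<open>\<eta> \<le> 1\<close> is what replaces \<open>1 + \<eta>\<close>
            by the constant 2.\<close>
          using \<eta> by (intro mult_right_mono normlike_nonneg[OF G_norm[OF zs]]) simp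
        also have "\<dots> \<le> 2 * (K * norm v)" using K(2)[OF zs, of v] by simp
        finally show ?thesis .
      qed
      from le[of "(1,0)"] le[of "(-1,0)"] show ?thesis by (simp add: abs_le_iff norm_Pair)
    qed
    have P_low: "\<bar>P (x, \<delta>)\<bar> \<le> 2 * K * \<delta>" for x
    proof -
      have "P (x, \<delta>) \<le> mollify \<delta> (\<lambda>_. 0) (x, \<delta>) + 2 * K * \<delta>"
        unfolding P_def
      proof (rule mollify_mono[OF cf _ \<delta>(1)])
        fix a b :: real assume ab: "0 \<le> a" "a \<le> \<delta>" "0 \<le> b" "b \<le> \<delta>"
        have s: "(x + a, \<delta> + b) \<in> strip" using ab \<delta> by (simp add: mem_strip)
        have "f (x + a, \<delta> + b) \<le> K * (\<delta> + b)" using ab \<delta> by (intro f_low) auto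
        \<comment> \<open>The square based at height \<open>\<delta>\<close> reaches at most height
          \<open>2 * \<delta>\<close>.\<close>
        also have "\<dots> \<le> K * (2 * \<delta>)" using ab K by (intro mult_left_mono) auto
        finally show "?f (fst (x, \<delta>) + a, snd (x, \<delta>) + b) \<le> 0 + 2 * K * \<delta>" by (simp add: clamp_snd_id[OF s])
      qed auto
      moreover have "mollify \<delta> (\<lambda>_. 0) (x, \<delta>) \<le> P (x, \<delta>) + 0"
        unfolding P_def
        by (rule mollify_mono[OF _ cf \<delta>(1)]) (use f_bd[OF clamp_snd_mem] in auto)
      ultimately show ?thesis using \<delta> by (simp add: mollify_const)
    qed
    have P_high: "\<bar>P (x, 1 - 2 * \<delta>) - h\<bar> \<le> 2 * K * \<delta>" for x
    proof -
      have "mollify \<delta> (\<lambda>_. h) (x, 1 - 2 * \<delta>) \<le> P (x, 1 - 2 * \<delta>) + 2 * K * \<delta>"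
        unfolding P_def
      proof (rule mollify_mono[OF _ cf \<delta>(1)])
        fix a b :: real assume ab: "0 \<le> a" "a \<le> \<delta>" "0 \<le> b" "b \<le> \<delta>"
        have s: "(x + a, 1 - 2 * \<delta> + b) \<in> strip" using ab \<delta> by (simp add: mem_strip)
        have "h - K * (1 - (1 - 2 * \<delta> + b)) \<le> f (x + a, 1 - 2 * \<delta> + b)" using ab \<delta> by (intro f_high) auto
        moreover have "K * (1 - (1 - 2 * \<delta> + b)) \<le> K * (2 * \<delta>)" using ab K by (intro mult_left_mono) auto
        ultimately show "h \<le> ?f (fst (x, 1 - 2 * \<delta>) + a, snd (x, 1 - 2 * \<delta>) + b) + 2 * K * \<delta>"
          by (simp add: clamp_snd_id[OF s])
      qed auto
      moreover have "P (x, 1 - 2 * \<delta>) \<le> mollify \<delta> (\<lambda>_. h) (x, 1 - 2 * \<delta>) + 0"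
        unfolding P_def
        by (rule mollify_mono[OF cf _ \<delta>(1)]) (use f_bd[OF clamp_snd_mem] in auto)
      moreover have "0 \<le> 2 * K * \<delta>" using K \<delta> by simp
      ultimately show ?thesis using \<delta> by (simp add: mollify_const abs_le_iff)
    qed
    have Green: "integral ?R (\<lambda>z. P1 z * Q2 z - P2 z * Q1 z) =
      integral {\<delta>..1 - 2 * \<delta>} (\<lambda>y. P (1, y) * Q2 (1, y) - P (0, y) * Q2 (0, y)) -
      integral {0..1} (\<lambda>x. P (x, 1 - 2 * \<delta>) * Q1 (x, 1 - 2 * \<delta>) - P (x, \<delta>) * Q1 (x, \<delta>))"
    proof (rule integral_jacobian_rectangle[where Qxy = "moll12 \<delta> ?g"])
      show "((\<lambda>x. P (x, y)) has_real_derivative P1 (x, y)) (at x)" for x y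
        unfolding defs by (rule mollify_deriv1[OF cf \<delta>(1)])
      show "((\<lambda>y. P (x, y)) has_real_derivative P2 (x, y)) (at y)" for x y
        unfolding defs by (rule mollify_deriv2[OF cf \<delta>(1)])
      show "((\<lambda>y. Q1 (x, y)) has_real_derivative moll12 \<delta> ?g (x, y)) (at y)" for x y
        unfolding defs by (rule moll1_deriv2[OF cg \<delta>(1)])
      show "((\<lambda>x. Q2 (x, y)) has_real_derivative moll12 \<delta> ?g (x, y)) (at x)" for x y
        unfolding defs by (rule moll2_deriv1[OF cg \<delta>(1)])
      show "continuous_on UNIV (moll12 \<delta> ?g)" by (rule continuous_moll12[OF cg \<delta>(1)])
    qed (use \<delta> contP contP1 contP2 contQ1 contQ2 in simp_all)
    have shP: "P (1, y) = P (0, y)" for y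
    proof -
      have "mollify \<delta> ?f ((0, y) + (1, 0)) = mollify \<delta> ?f (0, y) + 0"
        by (rule mollify_shift[OF cf \<delta>(1) f_per'])
      then show ?thesis unfolding P_def by (simp only: add_Pair add_0_left add_0_right)
    qed
    have shQ: "mollify \<delta> ?g (1, y) = mollify \<delta> ?g (0, y) + L" for y
    proof -
      have "mollify \<delta> ?g ((0, y) + (1, 0)) = mollify \<delta> ?g (0, y) + L"
        by (rule mollify_shift[OF cg \<delta>(1) g_per'])
      then show ?thesis by (simp only: add_Pair add_0_left add_0_right)
    qed
    have shQ2: "Q2 (1, y) = Q2 (0, y)" for y
    proof -
      have "moll2 \<delta> ?g (0 + 1, y) = moll2 \<delta> ?g (0, y)"
        by (rule moll2_shift[OF cg \<delta>(1) g_per'])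
      then show ?thesis unfolding Q2_def by (simp only: add_0_left)
    qed
    \<comment> \<open>The vertical sides cancel: \<open>P\<close> is periodic, and so is
      \<open>Q2\<close>, because the smoothed \<open>g\<close> grows by a constant over one
      period.\<close>
    have per: "P (1, y) * Q2 (1, y) - P (0, y) * Q2 (0, y) = 0" for y
      unfolding shP shQ2 by simp
    \<comment> \<open>Along a horizontal line the integral of the \<open>x\<close>-derivative is the
      increment of the smoothed \<open>g\<close> over one period.\<close>
    have Q1int: "((\<lambda>x. Q1 (x, 1 - 2 * \<delta>)) has_integral L) {0..1}"
    proof -
      have "((\<lambda>x. Q1 (x, 1 - 2 * \<delta>)) has_integral mollify \<delta> ?g (1, 1 - 2 * \<delta>) - mollify \<delta> ?g (0, 1 - 2 * \<delta>)) {0..1}"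
      proof (rule fundamental_theorem_of_calculus)
        fix x
        have "((\<lambda>x. mollify \<delta> ?g (x, 1 - 2 * \<delta>)) has_real_derivative Q1 (x, 1 - 2 * \<delta>)) (at x within {0..1})"
          unfolding Q1_def by (rule has_field_derivative_at_within[OF mollify_deriv1[OF cg \<delta>(1)]])
        then show "((\<lambda>x. mollify \<delta> ?g (x, 1 - 2 * \<delta>)) has_vector_derivative Q1 (x, 1 - 2 * \<delta>)) (at x within {0..1})"
          by (rule has_real_derivative_iff_has_vector_derivative[THEN iffD1])
      qed simp
      then show ?thesis unfolding shQ by (simp only: add_diff_cancel_left')
    qed
    let ?T = "\<lambda>x. P (x, 1 - 2 * \<delta>) * Q1 (x, 1 - 2 * \<delta>) - P (x, \<delta>) * Q1 (x, \<delta>)"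
    have Tint: "?T integrable_on {0..1}"
      by (intro integrable_continuous_real continuous_intros continuous_on_compose2[OF contP]
            continuous_on_compose2[OF contQ1]) auto
    have "((\<lambda>x. h * Q1 (x, 1 - 2 * \<delta>) - 8 * K * K * \<delta>) has_integral (h * L - 8 * K * K * \<delta> * (1 - 0))) {0..1}"
      by (intro has_integral_diff has_integral_mult_right Q1int)
         (use has_integral_const_real[of "8 * K * K * \<delta>" 0 1] in auto)
    moreover have "h * Q1 (x, 1 - 2 * \<delta>) - 8 * K * K * \<delta> \<le> ?T x" for x
    proof -
      have "\<bar>(P (x, 1 - 2 * \<delta>) - h) * Q1 (x, 1 - 2 * \<delta>)\<bar> \<le> (2 * K * \<delta>) * (2 * K)"
        unfolding abs_mult using \<delta> K by (intro mult_mono P_high Q1b) auto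
      moreover have "\<bar>P (x, \<delta>) * Q1 (x, \<delta>)\<bar> \<le> (2 * K * \<delta>) * (2 * K)"
        unfolding abs_mult using \<delta> K by (intro mult_mono P_low Q1b) auto
      ultimately show ?thesis by (simp add: abs_le_iff algebra_simps)
    qed
    ultimately have "h * L - 8 * K * K * \<delta> \<le> integral {0..1} ?T"
      using has_integral_le[OF _ integrable_integral[OF Tint]] by force
    then have "h * L - 8 * K * K * \<delta> \<le> - integral ?R (\<lambda>z. P1 z * Q2 z - P2 z * Q1 z)"
      by (simp add: Green per)
    then have "2 * (h * L - 8 * K * K * \<delta>) \<le> (- integral ?R (\<lambda>z. P1 z * Q2 z - P2 z * Q1 z)) * 2"
      by simp
    also have "\<dots> = integral ?R (\<lambda>z. - (P1 z * Q2 z - P2 z * Q1 z) * 2)"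
      unfolding integral_mult_left integral_neg by (rule refl)
    also have "\<dots> \<le> integral ?R (\<lambda>z. (1 + \<eta>)\<^sup>2 * area z)"
    proof (rule integral_le)
      have "continuous_on UNIV (\<lambda>z. - (P1 z * Q2 z - P2 z * Q1 z) * 2)"
        by (intro continuous_intros contP1 contP2 contQ1 contQ2)
      then show "(\<lambda>z. - (P1 z * Q2 z - P2 z * Q1 z) * 2) integrable_on ?R"
        by (rule integrable_continuous[OF continuous_on_subset[OF _ subset_UNIV]])
      have "area integrable_on ?R" by (rule int_area) (use \<delta> in simp_all)
      then show "(\<lambda>z. (1 + \<eta>)\<^sup>2 * area z) integrable_on ?R"
        by (rule integrable_on_mult_right)
    qed (rule J)
    also have "\<dots> = (1 + \<eta>)\<^sup>2 * integral ?R area" by (rule integral_mult_right)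
    also have "\<dots> \<le> (1 + \<eta>)\<^sup>2 * I"
    proof (rule mult_left_mono)
      show "integral ?R area \<le> I"
        unfolding I_def
      proof (rule integral_subset_le)
        show "?R \<subseteq> cbox (0, 0) (1, 1)" using \<delta> by auto
        show "area integrable_on ?R" by (rule int_area) (use \<delta> in simp_all)
        show "area integrable_on cbox (0, 0) (1, 1)" by (rule int_area) simp_all
      qed (intro ballI area_nn)
    qed simp
    finally show ?thesis .
  qed
  have step2: "2 * (h * L) \<le> (1 + \<eta>)\<^sup>2 * I" if \<eta>: "0 < \<eta>" "\<eta> \<le> 1" for \<eta>
  proof -
    obtain \<rho> where \<rho>: "0 < \<rho>" "\<And>z w v. z \<in> strip \<Longrightarrow> w \<in> strip \<Longrightarrow> dist z w < \<rho> \<Longrightarrow> G w v \<le> (1 + \<eta>) * G z v"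
      using G_uniform[OF \<eta>(1)] by blast
    have lim: "((\<lambda>\<delta>. 2 * (h * L - 8 * K * K * \<delta>)) \<longlongrightarrow> 2 * (h * L - 8 * K * K * 0)) (at_right 0)"
      by (intro tendsto_intros)
    have ev: "\<forall>\<^sub>F \<delta> in at_right 0. 2 * (h * L - 8 * K * K * \<delta>) \<le> (1 + \<eta>)\<^sup>2 * I"
      unfolding eventually_at_right_field
    proof (intro exI[of _ "min (\<rho> / 3) (1 / 3)"] conjI allI impI)
      fix \<delta> :: real assume \<delta>: "0 < \<delta>" "\<delta> < min (\<rho> / 3) (1 / 3)"
      then have b: "3 * \<delta> < \<rho>" "3 * \<delta> < 1" by (simp_all add: field_simps)
      show "2 * (h * L - 8 * K * K * \<delta>) \<le> (1 + \<eta>)\<^sup>2 * I"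
        by (rule step[OF \<eta> _ \<delta>(1) b]) (rule \<rho>(2))
    qed (use \<rho>(1) in simp)
    have "2 * (h * L - 8 * K * K * 0) \<le> (1 + \<eta>)\<^sup>2 * I"
      by (rule tendsto_upperbound[OF lim ev]) simp
    then show ?thesis by simp
  qed
  have lim: "((\<lambda>\<eta>. (1 + \<eta>)\<^sup>2 * I) \<longlongrightarrow> (1 + 0)\<^sup>2 * I) (at_right 0)"
    by (intro tendsto_intros)
  have ev: "\<forall>\<^sub>F \<eta> in at_right 0. 2 * (h * L) \<le> (1 + \<eta>)\<^sup>2 * I"
    unfolding eventually_at_right_field
  proof (intro exI[of _ 1] conjI allI impI)
    fix \<eta> :: real assume "0 < \<eta>" "\<eta> < 1"
    then show "2 * (h * L) \<le> (1 + \<eta>)\<^sup>2 * I" by (intro step2) simp_all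
  qed simp
  have "2 * (h * L) \<le> (1 + 0)\<^sup>2 * I"
    by (rule tendsto_lowerbound[OF lim ev]) simp
  then show ?thesis by (simp add: I_def mult.commute)
qed

end

subsection \<open>Pulling the metric back to the strip\<close>

lemma frechet_derivative_eqI: "(f has_derivative f') (at x) \<Longrightarrow> frechet_derivative f (at x) = f'"
  by (simp add: frechet_derivative_at[symmetric])

lemma Ck_on_SucD:
  assumes "Ck_on (Suc k) S f" "x \<in> S"
  shows "(f has_derivative frechet_derivative f (at x)) (at x)"
proof -
  have "f differentiable (at x)" using assms by simp
  then show ?thesis by (rule frechet_derivative_works[THEN iffD1])
qed

lemma Ck_on_cong:
  "open S \<Longrightarrow> (\<And>x. x \<in> S \<Longrightarrow> f x = g x) \<Longrightarrow> Ck_on k S f \<Longrightarrow> Ck_on k S g"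
proof (induction k arbitrary: f g)
  case 0
  then show ?case using continuous_on_cong[of S S f g] by simp
next
  case (Suc k)
  have d: "(g has_derivative frechet_derivative f (at x)) (at x)" if "x \<in> S" for x
    by (rule has_derivative_transform_within_open[OF Ck_on_SucD[OF Suc.prems(3) that] Suc.prems(1) that Suc.prems(2)])
  have "frechet_derivative g (at x) = frechet_derivative f (at x)" if "x \<in> S" for x
    using frechet_derivative_eqI[OF d[OF that]] .
  then have "Ck_on k S (\<lambda>x. frechet_derivative g (at x) v)" for v
    using Suc.IH[of "\<lambda>x. frechet_derivative f (at x) v" "\<lambda>x. frechet_derivative g (at x) v"] Suc.prems by simp
  then show ?case using d by (auto simp: differentiable_def)
qed

lemma Ck_on_Suc_imp: "Ck_on (Suc k) S f \<Longrightarrow> Ck_on k S f"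
proof (induction k arbitrary: f)
  case 0
  then show ?case
    by (auto intro!: differentiable_imp_continuous_on simp: differentiable_on_def differentiable_at_withinI)
qed auto

text \<open>Trades the chosen \<open>frechet_derivative\<close> for an explicit derivative; on an
  open set the two agree at every point, and \<open>Ck_on_cong\<close> transfers the class.\<close>

lemma Ck_on_SucI:
  assumes "open S" "\<And>x. x \<in> S \<Longrightarrow> (f has_derivative f' x) (at x)" "\<And>v. Ck_on k S (\<lambda>x. f' x v)"
  shows "Ck_on (Suc k) S f"
proof -
  have "frechet_derivative f (at x) = f' x" if "x \<in> S" for x
    using frechet_derivative_eqI[OF assms(2)[OF that]] .
  then have "Ck_on k S (\<lambda>x. frechet_derivative f (at x) v)" for v
    by (intro Ck_on_cong[OF assms(1) _ assms(3)[of v]]) simp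
  then show ?thesis using assms(2) by (auto simp: differentiable_def)
qed

lemma Ck_on_const: "open S \<Longrightarrow> Ck_on k S (\<lambda>x. c)"
proof (induction k arbitrary: c)
  case (Suc k)
  then show ?case by (intro Ck_on_SucI[where f' = "\<lambda>x v. 0"]) auto
qed simp

lemma Ck_on_add: "open S \<Longrightarrow> Ck_on k S f \<Longrightarrow> Ck_on k S g \<Longrightarrow> Ck_on k S (\<lambda>x. f x + g x)"
proof (induction k arbitrary: f g)
  case (Suc k)
  show ?case
    by (rule Ck_on_SucI[where f' = "\<lambda>x v. frechet_derivative f (at x) v + frechet_derivative g (at x) v"])
       (use Suc in \<open>auto intro!: has_derivative_add Ck_on_SucD\<close>)
qed (auto intro: continuous_intros)

lemma Ck_on_sum:
  assumes "open S" "finite I" "\<And>i. i \<in> I \<Longrightarrow> Ck_on k S (f i)"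
  shows "Ck_on k S (\<lambda>x. \<Sum>i\<in>I. f i x)"
  using assms(2,3) by (induction) (auto intro!: Ck_on_add Ck_on_const assms(1))

lemma Ck_on_scaleR:
  "open S \<Longrightarrow> Ck_on k S f \<Longrightarrow> Ck_on k S g \<Longrightarrow> Ck_on k S (\<lambda>x. f x *\<^sub>R g x)"
proof (induction k arbitrary: f g)
  case (Suc k)
  show ?case
  proof (rule Ck_on_SucI[where f' = "\<lambda>x v. f x *\<^sub>R frechet_derivative g (at x) v + frechet_derivative f (at x) v *\<^sub>R g x"])
    show "((\<lambda>x. f x *\<^sub>R g x) has_derivative
        (\<lambda>v. f x *\<^sub>R frechet_derivative g (at x) v + frechet_derivative f (at x) v *\<^sub>R g x)) (at x)" if "x \<in> S" for x
      by (intro has_derivative_scaleR Ck_on_SucD[OF Suc.prems(2) that] Ck_on_SucD[OF Suc.prems(3) that])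
    show "Ck_on k S (\<lambda>x. f x *\<^sub>R frechet_derivative g (at x) v + frechet_derivative f (at x) v *\<^sub>R g x)" for v
    proof (intro Ck_on_add Suc.IH Suc.prems(1))
      show "Ck_on k S f" "Ck_on k S g" using Suc.prems Ck_on_Suc_imp by blast+
    qed (use Suc.prems in simp_all)
  qed (rule Suc.prems)
qed (auto intro: continuous_intros)

lemma Ck_on_inner_const:
  fixes f :: "'a::real_normed_vector \<Rightarrow> 'b::real_inner"
  shows "open S \<Longrightarrow> Ck_on k S f \<Longrightarrow> Ck_on k S (\<lambda>x. f x \<bullet> b)"
proof (induction k arbitrary: f)
  case (Suc k)
  show ?case
    by (rule Ck_on_SucI[where f' = "\<lambda>x v. frechet_derivative f (at x) v \<bullet> b"])
       (use Suc in \<open>auto intro!: has_derivative_inner_left Ck_on_SucD\<close>)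
qed (auto intro: continuous_intros)

text \<open>Expanding in a basis separates direction from base point: when \<open>T\<close> varies,
  continuity or smoothness of its values on basis vectors is enough, even for a moving direction
  \<open>u\<close>.\<close>

lemma linear_euclidean_expand:
  fixes T :: "'a::euclidean_space \<Rightarrow> 'b::real_vector"
  assumes "linear T"
  shows "T u = (\<Sum>b\<in>Basis. (u \<bullet> b) *\<^sub>R T b)"
proof -
  have "T u = T (\<Sum>b\<in>Basis. (u \<bullet> b) *\<^sub>R b)" by (simp add: euclidean_representation)
  then show ?thesis by (simp add: linear_sum[OF assms] linear_scale[OF assms])
qed

text \<open>The chain rule, expanded in a basis, writes the derivative as a finite sum of products;
  one factor is a derivative of \<open>f\<close>, the other a derivative of \<open>g\<close>
  composed with \<open>f\<close>, to which the induction hypothesis applies.\<close>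

lemma Ck_on_compose:
  fixes f :: "'a::real_normed_vector \<Rightarrow> 'b::euclidean_space"
  shows "open S \<Longrightarrow> open V \<Longrightarrow> f ` S \<subseteq> V \<Longrightarrow> Ck_on k S f \<Longrightarrow> Ck_on k V g \<Longrightarrow> Ck_on k S (\<lambda>x. g (f x))"
proof (induction k arbitrary: g)
  case 0
  then show ?case by (auto intro: continuous_on_compose2)
next
  case (Suc k)
  let ?D = "\<lambda>x v. \<Sum>b\<in>Basis. (frechet_derivative f (at x) v \<bullet> b) *\<^sub>R frechet_derivative g (at (f x)) b"
  show ?case
  proof (rule Ck_on_SucI[where f' = ?D])
    fix x assume x: "x \<in> S"
    have df: "(f has_derivative frechet_derivative f (at x)) (at x)"
      by (rule Ck_on_SucD[OF Suc.prems(4) x])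
    have dg: "(g has_derivative frechet_derivative g (at (f x))) (at (f x))"
      by (rule Ck_on_SucD[OF Suc.prems(5)]) (use Suc.prems(3) x in auto)
    have "?D x = (\<lambda>v. frechet_derivative g (at (f x)) (frechet_derivative f (at x) v))"
      by (rule ext) (rule linear_euclidean_expand[OF has_derivative_linear[OF dg], symmetric])
    then show "((\<lambda>x. g (f x)) has_derivative ?D x) (at x)"
      using diff_chain_at[OF df dg] by (simp add: o_def)
  next
    fix v
    have f: "Ck_on k S f" by (rule Ck_on_Suc_imp[OF Suc.prems(4)])
    have fv: "Ck_on k S (\<lambda>x. frechet_derivative f (at x) v)" using Suc.prems(4) by simp
    show "Ck_on k S (\<lambda>x. ?D x v)"
    proof (intro Ck_on_sum Ck_on_scaleR Ck_on_inner_const fv Suc.prems(1) finite_Basis)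
      fix b :: 'b
      have "Ck_on k V (\<lambda>y. frechet_derivative g (at y) b)" using Suc.prems(5) by simp
      from Suc.IH[OF Suc.prems(1-3) f this] show "Ck_on k S (\<lambda>x. frechet_derivative g (at (f x)) b)" .
    qed
  qed (rule Suc.prems)
qed

lemma Ck_on_subset:
  "Ck_on k S f \<Longrightarrow> T \<subseteq> S \<Longrightarrow> Ck_on k T f"
  by (induction k arbitrary: f) (auto intro: continuous_on_subset)

lemma smooth_onE:
  assumes "smooth_on S f" "x \<in> S"
  obtains U g g' where "open U" "x \<in> U" "\<And>k. Ck_on k U g" "\<And>y. y \<in> U \<inter> S \<Longrightarrow> g y = f y"
    "\<And>y. y \<in> U \<Longrightarrow> (g has_derivative g' y) (at y)" "\<And>v. continuous_on U (\<lambda>y. g' y v)"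
proof -
  have "\<exists>U g. open U \<and> x \<in> U \<and> (\<forall>k. Ck_on k U g) \<and> (\<forall>y\<in>U \<inter> S. g y = f y)"
    using assms unfolding smooth_on_def by (rule bspec)
  then obtain U g where U: "open U" "x \<in> U" "\<forall>k. Ck_on k U g" "\<forall>y\<in>U \<inter> S. g y = f y"
    by (elim exE conjE)
  note U = U(1,2) U(3)[rule_format] U(4)[rule_format]
  have 1: "(g has_derivative frechet_derivative g (at y)) (at y)" if "y \<in> U" for y
    by (rule Ck_on_SucD[OF U(3)[of "Suc 0"] that])
  have 2: "continuous_on U (\<lambda>y. frechet_derivative g (at y) v)" for v
    using U(3)[of "Suc 0"] by simp
  show thesis by (rule that[OF U 1 2])
qed

text \<open>If \<open>N \<xi> = 0\<close> then \<open>N\<^sup>2\<close> vanishes along the ray through \<open>\<xi>\<close>, so that its second derivative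
  at \<open>\<xi>\<close> in the direction \<open>\<xi>\<close> is zero.\<close>

lemma homogeneous_zero_imp_second_derivative_zero:
  fixes N :: "real \<times> real \<Rightarrow> real"
  assumes hom: "\<And>t v. N (t *\<^sub>R v) = \<bar>t\<bar> * N v"
    and U: "open U" "(p, \<xi>) \<in> U" "\<And>k. Ck_on k U g"
    and g: "\<And>\<eta>. (p, \<eta>) \<in> U \<Longrightarrow> g (p, \<eta>) = N \<eta>"
    and zero: "N \<xi> = 0"
  shows "second_derivative (\<lambda>\<eta>. (N \<eta>)\<^sup>2) \<xi> \<xi> \<xi> = 0"
proof -
  define W where "W = {\<eta>. (p, \<eta>) \<in> U}"
  have "W = Pair p -` U" by (auto simp: W_def)
  then have W: "open W" using U(1) by (auto intro!: open_vimage continuous_intros)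
  have \<xi>W: "\<xi> \<in> W" using U by (simp add: W_def)
  define f where "f = (\<lambda>\<eta>. (N \<eta>)\<^sup>2)"
  define D where "D = (\<lambda>y. 2 * g (p, y) * frechet_derivative g (at (p, y)) (0, \<xi>))"
  have pair: "((\<lambda>y. (p, y)) has_derivative (\<lambda>v. (0, v))) (at y)" for y :: "real \<times> real"
    by (auto intro!: derivative_eq_intros)
  have df: "(f has_derivative (\<lambda>v. 2 * g (p, y) * frechet_derivative g (at (p, y)) (0, v))) (at y)" if y: "y \<in> W" for y
  proof -
    have dg: "(g has_derivative frechet_derivative g (at (p, y))) (at (p, y))"
      by (rule Ck_on_SucD[OF U(3)[of "Suc 0"]]) (use y in \<open>simp add: W_def\<close>)
    have "((\<lambda>y. g (p, y)) has_derivative (\<lambda>v. frechet_derivative g (at (p, y)) (0, v))) (at y)"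
      using diff_chain_at[OF pair dg] by (simp add: o_def)
    from has_derivative_power[OF this, of 2]
    have "((\<lambda>y. (g (p, y))\<^sup>2) has_derivative (\<lambda>v. 2 * g (p, y) * frechet_derivative g (at (p, y)) (0, v))) (at y)"
      by (simp add: algebra_simps)
    then show ?thesis
      by (rule has_derivative_transform_within_open[OF _ W y]) (auto simp: f_def W_def g)
  qed
  have fD: "frechet_derivative f (at y) \<xi> = D y" if "y \<in> W" for y
    using frechet_derivative_eqI[OF df[OF that]] by (simp add: D_def)
  have "D differentiable (at \<xi>)"
  proof -
    have gd: "g differentiable (at (p, \<xi>))" using U(2) U(3)[of "Suc 0"] by simp
    have "Ck_on (Suc 0) U (\<lambda>z. frechet_derivative g (at z) (0, \<xi>))"
      using U(3)[of "Suc (Suc 0)"] unfolding Ck_on.simps(2)[of "Suc 0"] by blast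
    then have gd2: "(\<lambda>z. frechet_derivative g (at z) (0, \<xi>)) differentiable (at (p, \<xi>))"
      using U(2) by simp
    have pd: "Pair p differentiable (at \<xi>)" using pair[of \<xi>] unfolding differentiable_def by blast
    show ?thesis
      unfolding D_def
      using differentiable_chain_at[OF pd gd] differentiable_chain_at[OF pd gd2]
      by (intro differentiable_mult differentiable_const) (simp_all only: o_def)
  qed
  then obtain D' where D': "(D has_derivative D') (at \<xi>)" by (auto simp: differentiable_def)
  have line0: "D (\<xi> + s *\<^sub>R \<xi>) = 0" if "\<xi> + s *\<^sub>R \<xi> \<in> W" for s
  proof -
    let ?y = "\<xi> + s *\<^sub>R \<xi>"
    have l: "((\<lambda>r. ?y + r *\<^sub>R \<xi>) has_derivative (\<lambda>r. r *\<^sub>R \<xi>)) (at 0)"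
      by (auto intro!: derivative_eq_intros)
    have "(f has_derivative frechet_derivative f (at ?y)) (at (?y + 0 *\<^sub>R \<xi>))"
      using df[OF that] frechet_derivative_eqI[OF df[OF that]] by simp
    from diff_chain_at[OF l this]
    have "((\<lambda>r. f (?y + r *\<^sub>R \<xi>)) has_derivative (\<lambda>r. frechet_derivative f (at ?y) (r *\<^sub>R \<xi>))) (at 0)"
      by (simp add: o_def)
    moreover have "(\<lambda>r. f (?y + r *\<^sub>R \<xi>)) = (\<lambda>r. 0)"
    proof
      fix r
      have "?y + r *\<^sub>R \<xi> = (1 + s + r) *\<^sub>R \<xi>" by (simp add: algebra_simps)
      then show "f (?y + r *\<^sub>R \<xi>) = 0" by (simp only: f_def hom zero) simp
    qed
    ultimately have "(\<lambda>r. frechet_derivative f (at ?y) (r *\<^sub>R \<xi>)) = (\<lambda>r::real. 0)"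
      using has_derivative_unique[OF _ has_derivative_const] by metis
    from fun_cong[OF this, of 1] show ?thesis using fD[OF that] by simp
  qed
  have l: "((\<lambda>s. \<xi> + s *\<^sub>R \<xi>) has_derivative (\<lambda>s. s *\<^sub>R \<xi>)) (at 0)"
    by (auto intro!: derivative_eq_intros)
  have "((\<lambda>s. D (\<xi> + s *\<^sub>R \<xi>)) has_derivative (\<lambda>s. D' (s *\<^sub>R \<xi>))) (at 0)"
    using diff_chain_at[OF l, of D D'] D' by (simp add: o_def)
  moreover have "open ((\<lambda>s::real. \<xi> + s *\<^sub>R \<xi>) -` W)"
    by (intro open_vimage W continuous_intros)
  ultimately have "((\<lambda>s::real. 0) has_derivative (\<lambda>s. D' (s *\<^sub>R \<xi>))) (at 0)"
    by (rule has_derivative_transform_within_open) (use \<xi>W line0 in auto)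
  then have "(\<lambda>s::real. D' (s *\<^sub>R \<xi>)) = (\<lambda>s. 0)"
    using has_derivative_unique[OF _ has_derivative_const] by metis
  from fun_cong[OF this, of 1] have "D' \<xi> = 0" by simp
  moreover have "((\<lambda>y. frechet_derivative f (at y) \<xi>) has_derivative D') (at \<xi>)"
    by (rule has_derivative_transform_within_open[OF D' W \<xi>W]) (simp add: fD)
  ultimately show ?thesis
    unfolding second_derivative_def f_def[symmetric] by (simp add: frechet_derivative_eqI)
qed

section \<open>The universal covering of the standard cylinder\<close>

definition wrap :: "real \<times> real \<Rightarrow> complex \<times> real" where
  "wrap x = (cis (2 * pi * fst x), snd x)"

definition wrap' :: "real \<times> real \<Rightarrow> real \<times> real \<Rightarrow> complex \<times> real" where
  "wrap' x v = ((2 * pi * fst v) *\<^sub>R (\<i> * cis (2 * pi * fst x)), snd v)"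

lemma wrap_has_derivative: "(wrap has_derivative wrap' x) (at x within X)"
  unfolding wrap_def[abs_def] wrap'_def[abs_def]
  by (auto intro!: derivative_eq_intros simp: algebra_simps)

lemma continuous_wrap: "continuous_on X wrap"
  unfolding wrap_def[abs_def] by (intro continuous_intros)

lemma continuous_wrap': "continuous_on X (\<lambda>x. wrap' x v)"
  unfolding wrap'_def by (intro continuous_intros)

lemma wrap'_inj: "wrap' x v = 0 \<Longrightarrow> v = 0"
  by (auto simp: wrap'_def prod_eq_iff)

lemma wrap_strip: "x \<in> strip \<Longrightarrow> wrap x \<in> standard_cylinder"
  by (auto simp: wrap_def standard_cylinder_def mem_strip)

lemma wrap_surj: "z \<in> standard_cylinder \<Longrightarrow> \<exists>x. x \<in> strip \<and> 0 \<le> fst x \<and> fst x < 1 \<and> wrap x = z"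
proof -
  assume z: "z \<in> standard_cylinder"
  obtain w t where wt: "z = (w, t)" "norm w = 1" "0 \<le> t" "t \<le> 1"
    using z by (auto simp: standard_cylinder_def)
  define \<theta> where "\<theta> = Arg2pi w / (2 * pi)"
  have "cis (2 * pi * \<theta>) = w"
    using Arg2pi_eq[of w] wt(2) by (simp add: \<theta>_def cis_conv_exp)
  moreover have "0 \<le> \<theta>" "\<theta> < 1"
    using Arg2pi_ge_0[of w] Arg2pi_lt_2pi[of w] by (auto simp: \<theta>_def)
  ultimately show ?thesis
    using wt by (intro exI[of _ "(\<theta>, t)"]) (auto simp: wrap_def mem_strip)
qed

lemma wrap_eqD: "wrap x = wrap y \<Longrightarrow> \<exists>k::int. y = x + (of_int k, 0)"
proof -
  assume e: "wrap x = wrap y"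
  then have "exp (\<i> * complex_of_real (2 * pi * fst y)) = exp (\<i> * complex_of_real (2 * pi * fst x))" and s: "snd x = snd y"
    by (auto simp: wrap_def cis_conv_exp)
  then obtain n :: int where "\<i> * complex_of_real (2 * pi * fst y) = \<i> * complex_of_real (2 * pi * fst x) + (of_int (2 * n) * pi) * \<i>"
    unfolding exp_eq by blast
  then have "Im (\<i> * complex_of_real (2 * pi * fst y)) = Im (\<i> * complex_of_real (2 * pi * fst x) + (of_int (2 * n) * pi) * \<i>)"
    by simp
  then have "2 * pi * fst y = 2 * pi * (fst x + of_int n)" by (simp add: algebra_simps)
  then have "fst y = fst x + of_int n" by simp
  with s show ?thesis by (intro exI[of _ n]) (simp add: prod_eq_iff)
qed

lemma wrap_shift: "wrap (x + (of_int k, 0)) = wrap x"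
proof -
  have "cis (2 * pi * (fst x + of_int k)) = cis (2 * pi * fst x) * cis (2 * pi * of_int k)"
    by (simp add: cis_mult algebra_simps)
  then show ?thesis by (simp add: wrap_def)
qed

text \<open>The family is closed under differentiation: the amplitude picks up a constant factor and
  the affine component becomes constant. Hence general \<open>B\<close>, \<open>e\<close> and
  \<open>d\<close> in the induction.\<close>

lemma Ck_on_wrap_line:
  "Ck_on k UNIV (\<lambda>u::real. (B * cis (a + b * u), e + d * u) :: complex \<times> real)"
proof (induction k arbitrary: B e d)
  case 0
  then show ?case by (auto intro!: continuous_intros)
next
  case (Suc k)
  show ?case
  proof (rule Ck_on_SucI[where f' = "\<lambda>u v. v *\<^sub>R (B * \<i> * of_real b * cis (a + b * u), d)"])
    show "((\<lambda>u. (B * cis (a + b * u), e + d * u)) has_derivative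
        (\<lambda>v. v *\<^sub>R (B * \<i> * of_real b * cis (a + b * u), d))) (at u)" for u
      by (auto intro!: derivative_eq_intros simp: algebra_simps scaleR_conv_of_real)
    show "Ck_on k UNIV (\<lambda>u. v *\<^sub>R (B * \<i> * of_real b * cis (a + b * u), d))" for v
      using Suc.IH[of "of_real v * B * \<i> * of_real b" "v * d" 0]
      by (simp add: scaleR_conv_of_real mult.assoc)
  qed simp
qed

lemma has_derivative_local:
  assumes "(f has_derivative f') (at x within S)" "open U" "x \<in> U" "x \<in> S"
    "\<And>y. y \<in> U \<Longrightarrow> y \<in> S \<Longrightarrow> f y = g y"
  shows "(g has_derivative f') (at x within S)"
proof -
  obtain d where d: "0 < d" "ball x d \<subseteq> U" using assms(2,3) open_contains_ball by blast
  have "f y = g y" if "y \<in> S" "dist y x < d" for y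
    by (rule assms(5)) (use d(2) that in \<open>auto simp: dist_commute\<close>)
  with assms(1,4) d(1) show ?thesis by (blast intro: has_derivative_transform_within)
qed

text \<open>At every point, also on the edges, the strip contains short steps in both coordinate
  directions, and these determine a linear map.\<close>

lemma strip_derivative_unique:
  assumes "(f has_derivative d1) (at x within strip)" "(f has_derivative d2) (at x within strip)" "x \<in> strip"
  shows "d1 = d2"
proof (rule frechet_derivative_unique_within[OF assms(1,2)])
  fix i :: "real \<times> real" and e :: real
  assume i: "i \<in> Basis" and e: "0 < e"
  \<comment> \<open>The sign points away from the nearer edge, and the cap \<open>1/2\<close> keeps
    a vertical step inside the strip.\<close>
  define d where "d = (if snd x \<le> 1/2 then min (e/2) (1/2) else - min (e/2) (1/2))"
  have "0 < \<bar>d\<bar>" "\<bar>d\<bar> < e" using e by (auto simp: d_def)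
  moreover have "x + d *\<^sub>R i \<in> strip"
    using i assms(3) e by (auto simp: Basis_prod_def mem_strip d_def min_def)
  ultimately show "\<exists>d. 0 < \<bar>d\<bar> \<and> \<bar>d\<bar> < e \<and> x + d *\<^sub>R i \<in> strip" by blast
qed

lemma continuous_on_local:
  fixes f :: "'a::t2_space \<Rightarrow> 'b::topological_space"
  assumes "\<And>x. x \<in> S \<Longrightarrow> \<exists>U. open U \<and> x \<in> U \<and> continuous_on (U \<inter> S) f"
  shows "continuous_on S f"
  unfolding continuous_on_eq_continuous_within[of S]
proof (rule ballI)
  fix x assume x: "x \<in> S"
  then obtain U where U: "open U" "x \<in> U" "continuous_on (U \<inter> S) f" using assms by blast
  then have "continuous (at x within (U \<inter> S)) f" using x by (simp add: continuous_on_eq_continuous_within)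
  moreover have "at x within (U \<inter> S) = at x within S"
    by (rule at_within_nhd[OF U(2,1)]) auto
  ultimately show "continuous (at x within S) f" by simp
qed

text \<open>A function that is not integrable has integral 0 by convention, so the claim covers
  every curve to which \<open>curve_length\<close> is applied.\<close>

lemma integral_nonneg_except_finite:
  fixes f :: "real \<Rightarrow> real"
  assumes "finite K" "\<And>t. t \<in> {0..1} - K \<Longrightarrow> 0 \<le> f t"
  shows "0 \<le> integral {0..1} f"
proof (cases "f integrable_on {0..1}")
  case True
  then have "(f has_integral integral {0..1} f) {0..1}" by (rule integrable_integral)
  then have "((\<lambda>t. if t \<in> K then 0 else f t) has_integral integral {0..1} f) {0..1}"
    by (rule has_integral_spike_finite[OF assms(1), rotated]) auto
  then show ?thesis by (rule has_integral_nonneg) (use assms(2) in auto)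
qed (simp add: not_integrable_integral)

section \<open>The covering map in charts and the pulled-back metric\<close>

locale finsler_cylinder_chart =
  fixes C :: "'a::topological_space set" and A :: "'a chart set" and F :: "'a \<Rightarrow> 'a tvec \<Rightarrow> real"
    and \<Phi> :: "'a \<Rightarrow> complex \<times> real" and \<Psi> :: "complex \<times> real \<Rightarrow> 'a"
  assumes surface: "smooth_surface C A" and compact_C: "compact C"
    and homeo: "homeomorphism C standard_cylinder \<Phi> \<Psi>"
    and smooth_to: "\<And>c. c \<in> A \<Longrightarrow> smooth_on (chart_img c) (\<Phi> \<circ> chart_inv c)"
    and smooth_from: "\<And>c. c \<in> A \<Longrightarrow> smooth_on (\<Phi> ` chart_dom c) (chart_map c \<circ> \<Psi>)"
    and finsler: "finsler_metric C A F"
begin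

lemma chart_open: "c \<in> A \<Longrightarrow> openin (top_of_set C) (chart_dom c)"
  using surface unfolding smooth_surface_def by blast

lemma chart_img_open: "c \<in> A \<Longrightarrow> openin (top_of_set half_plane) (chart_img c)"
  using surface unfolding smooth_surface_def by blast

lemma chart_homeo: "c \<in> A \<Longrightarrow> homeomorphism (chart_dom c) (chart_img c) (chart_map c) (chart_inv c)"
  using surface unfolding smooth_surface_def by blast

lemma chart_cover: "p \<in> C \<Longrightarrow> \<exists>c\<in>A. p \<in> chart_dom c"
  using surface unfolding smooth_surface_def by blast

lemma transition_smooth:
  "c \<in> A \<Longrightarrow> d \<in> A \<Longrightarrow> smooth_on (chart_map c ` (chart_dom c \<inter> chart_dom d)) (chart_map d \<circ> chart_inv c)"
  using surface unfolding smooth_surface_def by blast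

lemma chart_dom_subset: "c \<in> A \<Longrightarrow> chart_dom c \<subseteq> C"
  using chart_open openin_imp_subset by blast

lemma chart_inv_map: "c \<in> A \<Longrightarrow> p \<in> chart_dom c \<Longrightarrow> chart_inv c (chart_map c p) = p"
  using homeomorphism_apply1[OF chart_homeo] .

lemma chart_inv_dom: "c \<in> A \<Longrightarrow> y \<in> chart_img c \<Longrightarrow> chart_inv c y \<in> chart_dom c"
  using homeomorphism_image2[OF chart_homeo] by blast

lemma chart_map_cont: "c \<in> A \<Longrightarrow> continuous_on (chart_dom c) (chart_map c)"
  using homeomorphism_cont1[OF chart_homeo] .

lemma chart_map_inj: "c \<in> A \<Longrightarrow> inj_on (chart_map c) (chart_dom c)"
  using chart_inv_map by (intro inj_on_inverseI[where g = "chart_inv c"]) auto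

text \<open>The universal covering of the surface. Below, \<open>cdom c\<close> is the part of the
  strip over a chart domain and \<open>kap c\<close> is the chart read in strip coordinates.\<close>

definition q :: "real \<times> real \<Rightarrow> 'a" where "q x = \<Psi> (wrap x)"

definition cdom :: "'a chart \<Rightarrow> (real \<times> real) set" where
  "cdom c = {x \<in> strip. q x \<in> chart_dom c}"

definition kap :: "'a chart \<Rightarrow> real \<times> real \<Rightarrow> real \<times> real" where
  "kap c x = chart_map c (q x)"

text \<open>Taken within the strip so that it makes sense on the edges, where
  \<open>strip_derivative_unique\<close> still determines it.\<close>

definition J :: "'a chart \<Rightarrow> real \<times> real \<Rightarrow> real \<times> real \<Rightarrow> real \<times> real" where
  "J c x = frechet_derivative (kap c) (at x within strip)"

lemma Phi_q: "x \<in> strip \<Longrightarrow> \<Phi> (q x) = wrap x"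
  unfolding q_def using homeomorphism_apply2[OF homeo] wrap_strip by blast

lemma q_C: "x \<in> strip \<Longrightarrow> q x \<in> C"
  unfolding q_def using homeomorphism_image2[OF homeo] wrap_strip by blast

lemma q_cont: "continuous_on strip q"
  unfolding q_def[abs_def]
  by (rule continuous_on_compose2[OF homeomorphism_cont2[OF homeo] continuous_wrap]) (use wrap_strip in blast)

lemma q_surj: "p \<in> C \<Longrightarrow> \<exists>x. x \<in> strip \<and> 0 \<le> fst x \<and> fst x < 1 \<and> q x = p"
proof -
  assume p: "p \<in> C"
  then have "\<Phi> p \<in> standard_cylinder" using homeomorphism_image1[OF homeo] by blast
  from wrap_surj[OF this] obtain x where "x \<in> strip" "0 \<le> fst x" "fst x < 1" "wrap x = \<Phi> p" by blast
  moreover have "\<Psi> (\<Phi> p) = p" by (rule homeomorphism_apply1[OF homeo p])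
  ultimately show ?thesis unfolding q_def by metis
qed

lemma q_eqD: "x \<in> strip \<Longrightarrow> y \<in> strip \<Longrightarrow> q x = q y \<Longrightarrow> \<exists>k::int. y = x + (of_int k, 0)"
  using Phi_q[of x] Phi_q[of y] by (intro wrap_eqD) simp

lemma q_shift: "q (x + (of_int k, 0)) = q x"
  by (simp add: q_def wrap_shift)

lemma cdom_openin: "c \<in> A \<Longrightarrow> openin (top_of_set strip) (cdom c)"
proof -
  assume c: "c \<in> A"
  have "openin (top_of_set strip) (strip \<inter> q -` chart_dom c)"
    by (rule continuous_openin_preimage[OF q_cont _ chart_open[OF c]]) (use q_C in blast)
  moreover have "strip \<inter> q -` chart_dom c = cdom c" by (auto simp: cdom_def)
  ultimately show ?thesis by simp
qed

lemma cdom_nhd: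
  assumes "c \<in> A" "x \<in> cdom c"
  obtains W where "open W" "x \<in> W" "W \<inter> strip \<subseteq> cdom c"
  using cdom_openin[OF assms(1)] assms(2) unfolding openin_open by blast

lemma kap_img: "c \<in> A \<Longrightarrow> x \<in> cdom c \<Longrightarrow> kap c x \<in> chart_img c"
  by (simp add: kap_def cdom_def)

lemma kap_inv: "c \<in> A \<Longrightarrow> x \<in> cdom c \<Longrightarrow> chart_inv c (kap c x) = q x"
  by (simp add: kap_def cdom_def chart_inv_map)

lemma kap_cont: "c \<in> A \<Longrightarrow> continuous_on (cdom c) (kap c)"
  unfolding kap_def[abs_def]
  by (rule continuous_on_compose2[OF chart_map_cont continuous_on_subset[OF q_cont]]) (auto simp: cdom_def)

text \<open>\<open>wrap\<close> is defined on the whole plane, so composing it with the local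
  extension of \<open>chart_map c \<circ> \<Psi>\<close> extends \<open>kap c\<close> across the
  edges of the strip with continuous derivative.\<close>

lemma kap_extension:
  assumes c: "c \<in> A" and x: "x \<in> cdom c"
  obtains U w w' where "open U" "x \<in> U" "\<forall>y\<in>U. y \<in> strip \<longrightarrow> y \<in> cdom c \<and> w y = kap c y"
    "\<forall>y\<in>U. (w has_derivative w' y) (at y)" "\<forall>v. continuous_on U (\<lambda>y. w' y v)"
proof -
  have "wrap x \<in> \<Phi> ` chart_dom c"
    using x Phi_q[of x] unfolding cdom_def by (metis (mono_tags, lifting) image_eqI mem_Collect_eq)
  then obtain V g g' where V: "open V" "wrap x \<in> V"
    "\<And>y. y \<in> V \<inter> \<Phi> ` chart_dom c \<Longrightarrow> g y = (chart_map c \<circ> \<Psi>) y"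
    "\<And>y. y \<in> V \<Longrightarrow> (g has_derivative g' y) (at y)" "\<And>v. continuous_on V (\<lambda>y. g' y v)"
    using smooth_onE[OF smooth_from[OF c]] by metis
  obtain W where W: "open W" "x \<in> W" "W \<inter> strip \<subseteq> cdom c"
    by (rule cdom_nhd[OF c x])
  define U where "U = W \<inter> wrap -` V"
  have U: "open U" unfolding U_def by (intro open_Int W open_vimage V continuous_wrap)
  have xU: "x \<in> U" using W V by (simp add: U_def)
  have eq: "y \<in> cdom c \<and> (g \<circ> wrap) y = kap c y" if "y \<in> U" "y \<in> strip" for y
  proof
    show yc: "y \<in> cdom c" using W(3) that by (auto simp: U_def)
    have "wrap y \<in> \<Phi> ` chart_dom c"
      using yc Phi_q[of y] unfolding cdom_def by (metis (mono_tags, lifting) image_eqI mem_Collect_eq)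
    then have "g (wrap y) = (chart_map c \<circ> \<Psi>) (wrap y)" using that by (intro V(3)) (simp add: U_def)
    then show "(g \<circ> wrap) y = kap c y" by (simp add: kap_def q_def)
  qed
  have der: "((g \<circ> wrap) has_derivative (g' (wrap y) \<circ> wrap' y)) (at y)" if "y \<in> U" for y
    by (rule diff_chain_at[OF wrap_has_derivative V(4)]) (use that in \<open>simp add: U_def\<close>)
  have cont: "continuous_on U (\<lambda>y. (g' (wrap y) \<circ> wrap' y) v)" for v
  proof -
    have "(g' (wrap y) \<circ> wrap' y) v = (\<Sum>b\<in>Basis. (wrap' y v \<bullet> b) *\<^sub>R g' (wrap y) b)" if "y \<in> U" for y
      unfolding o_def
      by (rule linear_euclidean_expand[OF has_derivative_linear[OF V(4)]]) (use that in \<open>simp add: U_def\<close>)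
    moreover have "continuous_on U (\<lambda>y. \<Sum>b\<in>Basis. (wrap' y v \<bullet> b) *\<^sub>R g' (wrap y) b)"
    proof (intro continuous_on_sum continuous_on_scaleR continuous_on_inner continuous_wrap' continuous_on_const)
      fix b
      show "continuous_on U (\<lambda>y. g' (wrap y) b)"
        by (rule continuous_on_compose2[OF V(5) continuous_wrap]) (auto simp: U_def)
    qed
    ultimately show ?thesis by (metis (mono_tags, lifting) continuous_on_cong)
  qed
  have "\<forall>y\<in>U. y \<in> strip \<longrightarrow> y \<in> cdom c \<and> (g \<circ> wrap) y = kap c y"
    by (intro ballI impI) (rule eq)
  moreover have "\<forall>y\<in>U. ((g \<circ> wrap) has_derivative (g' (wrap y) \<circ> wrap' y)) (at y)"
    by (intro ballI) (rule der)
  moreover have "\<forall>v. continuous_on U (\<lambda>y. (g' (wrap y) \<circ> wrap' y) v)"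
    by (intro allI) (rule cont)
  ultimately show thesis by (rule that[OF U xU])
qed

lemma J_has_derivative:
  assumes c: "c \<in> A" and x: "x \<in> cdom c"
  shows "(kap c has_derivative J c x) (at x within strip)"
proof -
  obtain U w w' where U: "open U" "x \<in> U" "\<forall>y\<in>U. y \<in> strip \<longrightarrow> y \<in> cdom c \<and> w y = kap c y"
    "\<forall>y\<in>U. (w has_derivative w' y) (at y)" "\<forall>v. continuous_on U (\<lambda>y. w' y v)"
    by (rule kap_extension[OF c x])
  note U = U(1,2) U(3)[rule_format] U(4)[rule_format] U(5)[rule_format]
  have "(kap c has_derivative w' x) (at x within strip)"
    by (rule has_derivative_local[OF has_derivative_at_withinI[OF U(4)[OF U(2)]] U(1,2)])
       (use x U(3) in \<open>auto simp: cdom_def\<close>)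
  then show ?thesis unfolding J_def using frechet_derivative_works differentiableI by blast
qed

lemma J_linear: "c \<in> A \<Longrightarrow> x \<in> cdom c \<Longrightarrow> linear (J c x)"
  by (rule has_derivative_linear[OF J_has_derivative])

text \<open>Near each point \<open>J c\<close> equals the derivative of the extension, by uniqueness
  of derivatives within the strip.\<close>

lemma J_cont:
  assumes c: "c \<in> A"
  shows "continuous_on (cdom c) (\<lambda>y. J c y v)"
proof (rule continuous_on_local)
  fix x assume x: "x \<in> cdom c"
  obtain U w w' where U: "open U" "x \<in> U" "\<forall>y\<in>U. y \<in> strip \<longrightarrow> y \<in> cdom c \<and> w y = kap c y"
    "\<forall>y\<in>U. (w has_derivative w' y) (at y)" "\<forall>v. continuous_on U (\<lambda>y. w' y v)"
    by (rule kap_extension[OF c x])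
  note U = U(1,2) U(3)[rule_format] U(4)[rule_format] U(5)[rule_format]
  have "J c y = w' y" if y: "y \<in> U \<inter> cdom c" for y
  proof (rule strip_derivative_unique)
    show "(kap c has_derivative J c y) (at y within strip)" using J_has_derivative[OF c] y by blast
    show "(kap c has_derivative w' y) (at y within strip)"
      by (rule has_derivative_local[OF has_derivative_at_withinI[OF U(4)] U(1)])
         (use y U(3) in \<open>auto simp: cdom_def\<close>)
    show "y \<in> strip" using y by (simp add: cdom_def)
  qed
  moreover have "continuous_on (U \<inter> cdom c) (\<lambda>y. w' y v)"
    by (rule continuous_on_subset[OF U(5)]) auto
  ultimately have "continuous_on (U \<inter> cdom c) (\<lambda>y. J c y v)"
    by (metis (mono_tags, lifting) continuous_on_cong)
  with U show "\<exists>U. open U \<and> x \<in> U \<and> continuous_on (U \<inter> cdom c) (\<lambda>y. J c y v)" by blast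
qed

text \<open>Differentiating \<open>g \<circ> kap c = wrap\<close> shows that \<open>g'\<close> after
  \<open>J c x\<close> is the injective map \<open>wrap' x\<close>. This yields injectivity of
  \<open>J\<close> and later locates the boundary.\<close>

lemma inverse_extension:
  assumes c: "c \<in> A" and x: "x \<in> cdom c"
  obtains V g g' where "open V" "kap c x \<in> V"
    "\<forall>y\<in>V \<inter> chart_img c. g y = \<Phi> (chart_inv c y)"
    "(g has_derivative g') (at (kap c x))" "\<forall>v. g' (J c x v) = wrap' x v"
proof -
  obtain V g g' where V: "open V" "kap c x \<in> V"
    "\<And>y. y \<in> V \<inter> chart_img c \<Longrightarrow> g y = (\<Phi> \<circ> chart_inv c) y"
    "\<And>y. y \<in> V \<Longrightarrow> (g has_derivative g' y) (at y)"
    using smooth_onE[OF smooth_to[OF c] kap_img[OF c x]] by metis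
  have xs: "x \<in> strip" using x by (simp add: cdom_def)
  have "openin (top_of_set (cdom c)) (cdom c \<inter> kap c -` V)"
    by (rule continuous_openin_preimage_gen[OF kap_cont[OF c] V(1)])
  then have "openin (top_of_set strip) (cdom c \<inter> kap c -` V)"
    using cdom_openin[OF c] openin_trans by blast
  then obtain T where T: "open T" "cdom c \<inter> kap c -` V = strip \<inter> T" unfolding openin_open by blast
  have "(g has_derivative g' (kap c x)) (at (kap c x) within kap c ` strip)"
    by (rule has_derivative_at_withinI[OF V(4)[OF V(2)]])
  from diff_chain_within[OF J_has_derivative[OF c x] this]
  have "((g \<circ> kap c) has_derivative (g' (kap c x) \<circ> J c x)) (at x within strip)" .
  then have "(wrap has_derivative (g' (kap c x) \<circ> J c x)) (at x within strip)"
  proof (rule has_derivative_local[OF _ T(1)])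
    show "x \<in> T" using T x V(2) by blast
    fix y assume "y \<in> T" "y \<in> strip"
    then have y: "y \<in> cdom c" "kap c y \<in> V" using T by blast+
    have "g (kap c y) = \<Phi> (chart_inv c (kap c y))" using V(3)[of "kap c y"] y kap_img[OF c y(1)] by simp
    also have "\<dots> = wrap y" using kap_inv[OF c y(1)] Phi_q y by (simp add: cdom_def)
    finally show "(g \<circ> kap c) y = wrap y" by simp
  qed (rule xs)
  from strip_derivative_unique[OF this wrap_has_derivative xs]
  have "g' (kap c x) (J c x v) = wrap' x v" for v
    unfolding o_def by (rule fun_cong)
  then have e: "\<forall>v. g' (kap c x) (J c x v) = wrap' x v" by blast
  show thesis
    by (rule that[OF V(1,2) _ V(4)[OF V(2)] e]) (use V(3) in simp)
qed

lemma J_inj: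
  assumes c: "c \<in> A" and x: "x \<in> cdom c"
  shows "inj (J c x)"
  unfolding linear_injective_0[OF J_linear[OF c x]]
proof (intro allI impI)
  fix v assume v: "J c x v = 0"
  obtain V g g' where g: "open V" "kap c x \<in> V" "\<forall>y\<in>V \<inter> chart_img c. g y = \<Phi> (chart_inv c y)"
    "(g has_derivative g') (at (kap c x))" "\<forall>v. g' (J c x v) = wrap' x v"
    by (rule inverse_extension[OF c x])
  have "wrap' x v = 0" using g(5)[rule_format, of v] v linear_0[OF has_derivative_linear[OF g(4)]] by simp
  then show "v = 0" by (rule wrap'_inj)
qed

lemma J_shift:
  assumes c: "c \<in> A" and x: "x \<in> cdom c"
  shows "J c (x + (1, 0)) = J c x"
proof (rule strip_derivative_unique[OF _ J_has_derivative[OF c x]])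
  have q1: "q (y + (1, 0)) = q y" for y using q_shift[of y 1] by simp
  have xs: "x \<in> strip" using x by (simp add: cdom_def)
  then show "x \<in> strip" .
  have "x + (1, 0) \<in> cdom c" using x strip_shift by (simp add: cdom_def q1)
  from J_has_derivative[OF c this]
  have d: "(kap c has_derivative J c (x + (1, 0))) (at (x + (1, 0)) within (\<lambda>y. y + (1, 0)) ` strip)"
    by (rule has_derivative_subset) (use strip_shift in blast)
  have "((\<lambda>y. y + (1, 0)) has_derivative (\<lambda>v. v)) (at x within strip)"
    by (auto intro!: derivative_eq_intros)
  from diff_chain_within[OF this d]
  have "((kap c \<circ> (\<lambda>y. y + (1, 0))) has_derivative (J c (x + (1, 0)) \<circ> (\<lambda>v. v))) (at x within strip)" .
  moreover have "kap c \<circ> (\<lambda>y. y + (1, 0)) = kap c" by (rule ext) (simp only: kap_def q1 o_def)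
  ultimately show "(kap c has_derivative J c (x + (1, 0))) (at x within strip)" by (simp add: o_def)
qed

lemma transition_has_derivative:
  assumes c: "c \<in> A" and d: "d \<in> A" and p: "p \<in> chart_dom c" "p \<in> chart_dom d"
  shows "((chart_map d \<circ> chart_inv c) has_derivative
     frechet_derivative (chart_map d \<circ> chart_inv c) (at (chart_map c p) within chart_map c ` (chart_dom c \<inter> chart_dom d)))
     (at (chart_map c p) within chart_map c ` (chart_dom c \<inter> chart_dom d))"
proof -
  let ?T = "chart_map c ` (chart_dom c \<inter> chart_dom d)"
  have pT: "chart_map c p \<in> ?T" using p by blast
  obtain U g g' where U: "open U" "chart_map c p \<in> U" "\<And>y. y \<in> U \<inter> ?T \<Longrightarrow> g y = (chart_map d \<circ> chart_inv c) y"
    "\<And>y. y \<in> U \<Longrightarrow> (g has_derivative g' y) (at y)"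
    using smooth_onE[OF transition_smooth[OF c d] pT] by metis
  have "((chart_map d \<circ> chart_inv c) has_derivative g' (chart_map c p)) (at (chart_map c p) within ?T)"
    by (rule has_derivative_local[OF has_derivative_at_withinI[OF U(4)[OF U(2)]] U(1,2) pT]) (rule U(3), simp)
  then show ?thesis using frechet_derivative_works differentiableI by blast
qed

text \<open>The differential of \<open>q\<close>, given by its components in all charts as the type
  \<open>tvec\<close> requires; \<open>tangent_vector_kap\<close> shows that it is a tangent
  vector.\<close>

definition dq :: "real \<times> real \<Rightarrow> real \<times> real \<Rightarrow> 'a tvec" where
  "dq x v = (\<lambda>d. if d \<in> A \<and> q x \<in> chart_dom d then J d x v else 0)"

text \<open>\<open>kap d\<close> is \<open>kap c\<close> followed by the coordinate change; the
  chain rule and uniqueness of derivatives within the strip compare the components.\<close>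

lemma tangent_vector_kap:
  assumes c: "c \<in> A" and x: "x \<in> cdom c"
  shows "tangent_vector A c (q x) (J c x v) = dq x v"
proof
  fix d
  have xs: "x \<in> strip" and qc: "q x \<in> chart_dom c" using x by (auto simp: cdom_def)
  show "tangent_vector A c (q x) (J c x v) d = dq x v d"
  proof (cases "d \<in> A \<and> q x \<in> chart_dom d")
    case True
    then have d: "d \<in> A" and qd: "q x \<in> chart_dom d" by auto
    have xd: "x \<in> cdom d" using xs qd by (simp add: cdom_def)
    let ?T = "chart_map c ` (chart_dom c \<inter> chart_dom d)"
    let ?\<tau>' = "frechet_derivative (chart_map d \<circ> chart_inv c) (at (chart_map c (q x)) within ?T)"
    obtain W where W: "open W" "x \<in> W" "W \<inter> strip \<subseteq> cdom c"
      by (rule cdom_nhd[OF c x])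
    obtain W' where W': "open W'" "x \<in> W'" "W' \<inter> strip \<subseteq> cdom d"
      by (rule cdom_nhd[OF d xd])
    \<comment> \<open>Over both chart domains \<open>kap c\<close> takes values in the overlap, the
      set within which \<open>tangent_vector\<close> differentiates the coordinate change.\<close>
    let ?N = "strip \<inter> (W \<inter> W')"
    have inT: "kap c ` ?N \<subseteq> ?T"
    proof
      fix z assume "z \<in> kap c ` ?N"
      then obtain y where y: "y \<in> strip" "y \<in> W" "y \<in> W'" "z = kap c y" by blast
      then have "q y \<in> chart_dom c" "q y \<in> chart_dom d" using W(3) W'(3) by (auto simp: cdom_def)
      then show "z \<in> ?T" using y(4) by (simp add: kap_def)
    qed
    have "((chart_map d \<circ> chart_inv c) has_derivative ?\<tau>') (at (kap c x) within kap c ` ?N)"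
      using has_derivative_subset[OF transition_has_derivative[OF c d qc qd] inT] by (simp add: kap_def)
    from diff_chain_within[OF has_derivative_subset[OF J_has_derivative[OF c x] Int_lower1] this]
    have "(((chart_map d \<circ> chart_inv c) \<circ> kap c) has_derivative (?\<tau>' \<circ> J c x)) (at x within ?N)" .
    moreover have "at x within ?N = at x within strip"
      by (rule at_within_nhd[of x "W \<inter> W'"]) (use W W' in auto)
    ultimately have "(((chart_map d \<circ> chart_inv c) \<circ> kap c) has_derivative (?\<tau>' \<circ> J c x)) (at x within strip)" by simp
    then have "(kap d has_derivative (?\<tau>' \<circ> J c x)) (at x within strip)"
    proof (rule has_derivative_local[OF _ W(1,2) xs])
      fix y assume "y \<in> W" "y \<in> strip"
      then have "y \<in> cdom c" using W(3) by blast
      from kap_inv[OF c this] show "((chart_map d \<circ> chart_inv c) \<circ> kap c) y = kap d y" by (simp add: kap_def)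
    qed
    from strip_derivative_unique[OF this J_has_derivative[OF d xd] xs]
    have "?\<tau>' (J c x v) = J d x v" unfolding o_def by (rule fun_cong)
    then show ?thesis using True by (simp add: tangent_vector_def dq_def)
  qed (auto simp: tangent_vector_def dq_def)
qed

definition G :: "real \<times> real \<Rightarrow> real \<times> real \<Rightarrow> real" where
  "G x v = F (q x) (dq x v)"

lemma G_in_chart:
  assumes c: "c \<in> A" and x: "x \<in> cdom c"
  shows "G x v = in_chart A F c (kap c x) (J c x v)"
  using tangent_vector_kap[OF c x] kap_inv[OF c x] by (simp add: G_def in_chart_def)

lemma in_chart_cont: "c \<in> A \<Longrightarrow> continuous_on (chart_img c \<times> UNIV) (\<lambda>(y, v). in_chart A F c y v)"
  using finsler unfolding finsler_metric_def by blast

text \<open>\<open>finsler_metric\<close> states only that \<open>F\<close> is nonnegative. Strict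
  positivity off the zero vector comes from the positive second derivatives: a zero of the norm
  would annihilate the one in its own direction.\<close>

lemma in_chart_normlike:
  assumes c: "c \<in> A" and y: "y \<in> chart_img c"
  shows "normlike (in_chart A F c y)"
proof -
  let ?p = "chart_inv c y"
  have p: "?p \<in> chart_dom c" by (rule chart_inv_dom[OF c y])
  have pC: "?p \<in> C" using chart_dom_subset[OF c] p by blast
  have tan: "tangent_vector A c ?p v \<in> tangent_space A ?p" for v
    unfolding tangent_space_def using c p by blast
  have "continuous_on UNIV (\<lambda>v. (\<lambda>(y, v). in_chart A F c y v) (y, v))"
    by (rule continuous_on_compose2[OF in_chart_cont[OF c]]) (use y in \<open>auto intro!: continuous_intros\<close>)
  then have cont: "continuous_on UNIV (in_chart A F c y)" by simp
  have tscale: "tangent_vector A c ?p (t *\<^sub>R v) = (\<lambda>d. t *\<^sub>R tangent_vector A c ?p v d)" for t v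
  proof
    fix d
    show "tangent_vector A c ?p (t *\<^sub>R v) d = t *\<^sub>R tangent_vector A c ?p v d"
    proof (cases "d \<in> A \<and> ?p \<in> chart_dom d")
      case True
      from transition_has_derivative[OF c _ p, of d] True
      have "linear (frechet_derivative (chart_map d \<circ> chart_inv c) (at (chart_map c ?p) within chart_map c ` (chart_dom c \<inter> chart_dom d)))"
        by (intro has_derivative_linear) simp
      then show ?thesis using True by (simp add: tangent_vector_def linear_scale)
    next
      case False
      then show ?thesis unfolding tangent_vector_def by auto
    qed
  qed
  have scale: "in_chart A F c y (t *\<^sub>R v) = \<bar>t\<bar> * in_chart A F c y v" for t v
    unfolding in_chart_def tscale
    using finsler pC tan unfolding finsler_metric_def by blast
  have nonneg: "0 \<le> in_chart A F c y v" for v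
    unfolding in_chart_def using finsler pC tan unfolding finsler_metric_def by blast
  have pos: "0 < in_chart A F c y v" if v: "v \<noteq> 0" for v
  proof (rule ccontr)
    assume "\<not> 0 < in_chart A F c y v"
    then have zero: "in_chart A F c y v = 0" using nonneg[of v] by simp
    have "smooth_on (chart_img c \<times> (- {0})) (\<lambda>(x, \<xi>). in_chart A F c x \<xi>)"
      using finsler c unfolding finsler_metric_def by blast
    moreover have "(y, v) \<in> chart_img c \<times> (- {0})" using y v by simp
    ultimately obtain U g where U: "open U" "(y, v) \<in> U" "\<And>k. Ck_on k U g"
      "\<And>z. z \<in> U \<inter> (chart_img c \<times> (- {0})) \<Longrightarrow> g z = (\<lambda>(x, \<xi>). in_chart A F c x \<xi>) z"
      by (rule smooth_onE) (rule that)
    \<comment> \<open>The extension \<open>g\<close> agrees with the metric away from the zero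
      section, which is therefore removed from its domain.\<close>
    let ?U = "U \<inter> (UNIV \<times> (- {0}))"
    have oU: "open ?U" by (intro open_Int U open_Times) auto
    have "second_derivative (\<lambda>\<eta>. (in_chart A F c y \<eta>)\<^sup>2) v v v = 0"
    proof (rule homogeneous_zero_imp_second_derivative_zero[OF scale oU])
      show "(y, v) \<in> ?U" using U(2) v by simp
      show "Ck_on k ?U g" for k by (rule Ck_on_subset[OF U(3)]) simp
      show "g (y, \<eta>) = in_chart A F c y \<eta>" if "(y, \<eta>) \<in> ?U" for \<eta>
        using U(4)[of "(y, \<eta>)"] that y by simp
    qed (rule zero)
    moreover have "0 < second_derivative (\<lambda>\<eta>. (in_chart A F c y \<eta>)\<^sup>2) v v v"
      using finsler c y v unfolding finsler_metric_def by blast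
    ultimately show False by simp
  qed
  show ?thesis unfolding normlike_def using cont scale pos by blast
qed

lemma G_normlike:
  assumes x: "x \<in> strip"
  shows "normlike (G x)"
proof -
  obtain c where c: "c \<in> A" "x \<in> cdom c" using chart_cover[OF q_C[OF x]] x by (auto simp: cdom_def)
  note N = in_chart_normlike[OF c(1) kap_img[OF c]]
  have G: "G x = (\<lambda>v. in_chart A F c (kap c x) (J c x v))" using G_in_chart[OF c] by blast
  note lin = J_linear[OF c]
  have cJ: "continuous_on UNIV (J c x)" using lin by (simp add: linear_continuous_on linear_conv_bounded_linear)
  have cN: "continuous_on UNIV (in_chart A F c (kap c x))" using N unfolding normlike_def by (rule conjunct1)
  have "continuous_on UNIV (\<lambda>v. in_chart A F c (kap c x) (J c x v))"
    by (rule continuous_on_compose2[OF cN cJ subset_UNIV])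
  moreover have "0 < in_chart A F c (kap c x) (J c x v)" if "v \<noteq> 0" for v
  proof (rule normlike_pos[OF N])
    show "J c x v \<noteq> 0" using J_inj[OF c] that unfolding linear_injective_0[OF lin] by blast
  qed
  moreover have "in_chart A F c (kap c x) (J c x (t *\<^sub>R v)) = \<bar>t\<bar> * in_chart A F c (kap c x) (J c x v)" for t v
    unfolding linear_scale[OF lin] by (rule normlike_scale[OF N])
  ultimately show ?thesis
    unfolding G normlike_def by (intro conjI allI impI)
qed

text \<open>Checked in one chart at a time. Joint continuity of \<open>J c x v\<close> follows from
  continuity in \<open>x\<close> on basis vectors and linearity in \<open>v\<close>.\<close>

lemma G_continuous: "continuous_on (strip \<times> UNIV) (\<lambda>(x, v). G x v)"
proof (rule continuous_on_local)
  fix z assume "z \<in> strip \<times> (UNIV :: (real \<times> real) set)"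
  then obtain x v where z: "z = (x, v)" and x: "x \<in> strip" by blast
  obtain c where c: "c \<in> A" "x \<in> cdom c" using chart_cover[OF q_C[OF x]] x by (auto simp: cdom_def)
  obtain W where W: "open W" "x \<in> W" "W \<inter> strip \<subseteq> cdom c"
    by (rule cdom_nhd[OF c])
  let ?X = "(W \<times> UNIV) \<inter> (strip \<times> (UNIV :: (real \<times> real) set))"
  have sub: "fst ` ?X \<subseteq> cdom c" using W(3) by auto
  have Jx: "continuous_on ?X (\<lambda>z. J c (fst z) b)" for b
    by (rule continuous_on_compose2[OF J_cont[OF c(1)] continuous_on_fst[OF continuous_on_id] sub])
  have "continuous_on ?X (\<lambda>z. \<Sum>b\<in>Basis. (snd z \<bullet> b) *\<^sub>R J c (fst z) b)"
    by (intro continuous_intros Jx)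
  moreover have "(\<Sum>b\<in>Basis. (snd z \<bullet> b) *\<^sub>R J c (fst z) b) = J c (fst z) (snd z)" if "z \<in> ?X" for z
    by (rule linear_euclidean_expand[symmetric, OF J_linear[OF c(1)]]) (use that sub in blast)
  ultimately have J2: "continuous_on ?X (\<lambda>z. J c (fst z) (snd z))" by (rule continuous_on_eq)
  have K2: "continuous_on ?X (\<lambda>z. kap c (fst z))"
    by (rule continuous_on_compose2[OF kap_cont[OF c(1)] continuous_on_fst[OF continuous_on_id] sub])
  have "continuous_on ?X (\<lambda>z. (\<lambda>(y, v). in_chart A F c y v) (kap c (fst z), J c (fst z) (snd z)))"
    by (rule continuous_on_compose2[OF in_chart_cont[OF c(1)] continuous_on_Pair[OF K2 J2]])
       (use sub kap_img[OF c(1)] in blast)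
  moreover have "(\<lambda>(y, v). in_chart A F c y v) (kap c (fst z), J c (fst z) (snd z)) = (\<lambda>(x, v). G x v) z" if "z \<in> ?X" for z
  proof -
    have "fst z \<in> cdom c" using that sub by blast
    from G_in_chart[OF c(1) this, of "snd z"] show ?thesis by (simp add: case_prod_unfold)
  qed
  ultimately have "continuous_on ?X (\<lambda>(x, v). G x v)" by (rule continuous_on_eq)
  moreover have "open (W \<times> (UNIV :: (real \<times> real) set))" by (intro open_Times W) simp
  moreover have "z \<in> W \<times> UNIV" using W z by simp
  ultimately show "\<exists>U. open U \<and> z \<in> U \<and> continuous_on (U \<inter> (strip \<times> UNIV)) (\<lambda>(x, v). G x v)" by blast
qed

sublocale strip_metric G
proof
  fix x v :: "real \<times> real" assume x: "x \<in> strip"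
  have q1: "q (x + (1, 0)) = q x" using q_shift[of x 1] by simp
  have "dq (x + (1, 0)) v = dq x v"
  proof
    fix d
    show "dq (x + (1, 0)) v d = dq x v d"
      unfolding dq_def q1 using J_shift[of d x] x by (simp add: cdom_def)
  qed
  then show "G (x + (1, 0)) v = G x v" by (simp add: G_def q1)
qed (rule G_continuous G_normlike; assumption)+

end

section \<open>The boundary circles and nontrivial curves\<close>

lemma two_valued_endpoints_eq:
  fixes f :: "real \<Rightarrow> real"
  assumes "continuous_on {0..1} f" "\<And>t. t \<in> {0..1} \<Longrightarrow> f t = 0 \<or> f t = 1"
  shows "f 0 = f 1"
proof -
  have "f ` {0..1} \<subseteq> {0, 1}" using assms(2) by blast
  then have "finite (f ` {0..1})" using finite_subset by blast
  then have "f constant_on {0..1}"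
    using continuous_finite_range_constant[OF connected_Icc assms(1)] by blast
  then show ?thesis by (auto simp: constant_on_def)
qed

context finsler_cylinder_chart
begin

text \<open>Otherwise the second chart coordinate, which is nonnegative, would have an interior
  minimum; its differential would vanish there, against surjectivity of \<open>J\<close>.\<close>

lemma interior_not_boundary:
  assumes x: "0 < snd x" "snd x < 1" and c: "c \<in> A" and xc: "x \<in> cdom c"
  shows "snd (kap c x) \<noteq> 0"
proof
  assume z: "snd (kap c x) = 0"
  obtain W where W: "open W" "x \<in> W" "W \<inter> strip \<subseteq> cdom c"
    by (rule cdom_nhd[OF c xc])
  define W' where "W' = W \<inter> (UNIV \<times> {0<..<1})"
  have W': "open W'" unfolding W'_def by (intro open_Int W open_Times) auto
  have xW': "x \<in> W'" using W x by (cases x) (auto simp: W'_def)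
  have sub: "W' \<subseteq> strip" by (auto simp: W'_def strip_def)
  then have dom: "y \<in> cdom c" if "y \<in> W'" for y using that W(3) by (auto simp: W'_def)
  have "(kap c has_derivative J c x) (at x within W')"
    by (rule has_derivative_subset[OF J_has_derivative[OF c xc] sub])
  then have "(kap c has_derivative J c x) (at x)"
    using at_within_open[OF xW' W'] by simp
  then have "((\<lambda>y. snd (kap c y)) has_derivative (\<lambda>v. snd (J c x v))) (at x)"
    by (rule has_derivative_snd)
  moreover have "\<forall>y\<in>W'. snd (kap c x) \<le> snd (kap c y)"
  proof
    fix y assume "y \<in> W'"
    then have "kap c y \<in> chart_img c" by (intro kap_img c dom)
    then have "kap c y \<in> half_plane" using openin_imp_subset[OF chart_img_open[OF c]] by blast
    then show "snd (kap c x) \<le> snd (kap c y)" using z by (simp add: half_plane_def)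
  qed
  ultimately have "(\<lambda>v. snd (J c x v)) = (\<lambda>v. 0)"
    using differential_zero_maxmin[OF xW' W'] by blast
  moreover have "surj (J c x)"
    by (rule linear_injective_imp_surjective[OF J_linear[OF c xc] J_inj[OF c xc]]) simp
  then obtain v where "J c x v = (0, 1)" by (metis surjD)
  ultimately show False by (metis snd_conv zero_neq_one)
qed

text \<open>The converse argument with the inverse chart: at a chart value inside the half-plane the
  level \<open>snd (g y)\<close> would be extremal on an open set, so its differential would vanish,
  yet it is 1 on \<open>J c x (0, 1)\<close>.\<close>

lemma end_is_boundary:
  assumes x: "snd x = 0 \<or> snd x = 1" and c: "c \<in> A" and xc: "x \<in> cdom c"
  shows "snd (kap c x) = 0"
proof (rule ccontr)
  assume nz: "snd (kap c x) \<noteq> 0"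
  obtain T where T: "open T" "chart_img c = half_plane \<inter> T"
    using chart_img_open[OF c] unfolding openin_open by blast
  have kc: "kap c x \<in> chart_img c" by (rule kap_img[OF c xc])
  then have "0 < snd (kap c x)" using nz T by (auto simp: half_plane_def)
  obtain V g g' where V: "open V" "kap c x \<in> V" "\<forall>y\<in>V \<inter> chart_img c. g y = \<Phi> (chart_inv c y)"
    "(g has_derivative g') (at (kap c x))" "\<forall>v. g' (J c x v) = wrap' x v"
    by (rule inverse_extension[OF c xc])
  define N where "N = V \<inter> T \<inter> (UNIV \<times> {0<..})"
  have N: "open N" unfolding N_def by (intro open_Int V T open_Times) auto
  have xN: "kap c x \<in> N" using V kc T \<open>0 < snd (kap c x)\<close> by (cases "kap c x") (auto simp: N_def)
  have Nsub: "N \<subseteq> V \<inter> chart_img c" using T by (auto simp: N_def half_plane_def)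
  have gcyl: "0 \<le> snd (g y) \<and> snd (g y) \<le> 1" if "y \<in> N" for y
  proof -
    have "y \<in> chart_img c" "g y = \<Phi> (chart_inv c y)" using that Nsub V(3) by blast+
    moreover have "\<Phi> (chart_inv c y) \<in> standard_cylinder"
      using homeomorphism_image1[OF homeo] chart_dom_subset[OF c] chart_inv_dom[OF c] calculation by blast
    ultimately show ?thesis by (auto simp: standard_cylinder_def mem_Times_iff)
  qed
  have "x \<in> strip" using xc by (simp add: cdom_def)
  then have "g (kap c x) = wrap x" using V(2,3) kc kap_inv[OF c xc] Phi_q by simp
  then have gx: "snd (g (kap c x)) = snd x" by (simp add: wrap_def)
  have "((\<lambda>y. snd (g y)) has_derivative (\<lambda>v. snd (g' v))) (at (kap c x))"
    by (rule has_derivative_snd[OF V(4)])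
  moreover have "(\<forall>y\<in>N. snd (g y) \<le> snd (g (kap c x))) \<or> (\<forall>y\<in>N. snd (g (kap c x)) \<le> snd (g y))"
    using x gcyl by (auto simp: gx)
  ultimately have "(\<lambda>v. snd (g' v)) = (\<lambda>v. 0)"
    using differential_zero_maxmin[OF xN N] by blast
  then have "snd (g' (J c x (0, 1))) = 0" by metis
  then show False using V(5) by (simp add: wrap'_def)
qed

lemma boundary_iff:
  assumes x: "x \<in> strip"
  shows "q x \<in> surface_boundary A \<longleftrightarrow> snd x = 0 \<or> snd x = 1"
proof
  assume "q x \<in> surface_boundary A"
  then obtain c where c: "c \<in> A" "q x \<in> chart_dom c" "snd (chart_map c (q x)) = 0"
    unfolding surface_boundary_def by blast
  have "x \<in> cdom c" using c x by (simp add: cdom_def)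
  then have "\<not> (0 < snd x \<and> snd x < 1)" using interior_not_boundary[of x c] c by (auto simp: kap_def)
  then show "snd x = 0 \<or> snd x = 1" using x by (auto simp: mem_strip)
next
  assume e: "snd x = 0 \<or> snd x = 1"
  obtain c where c: "c \<in> A" "q x \<in> chart_dom c" using chart_cover[OF q_C[OF x]] by blast
  then have "x \<in> cdom c" using x by (simp add: cdom_def)
  from end_is_boundary[OF e c(1) this] c show "q x \<in> surface_boundary A"
    unfolding surface_boundary_def kap_def by blast
qed

lemma boundary_level:
  assumes p: "p \<in> surface_boundary A"
  shows "p \<in> C" "snd (\<Phi> p) = 0 \<or> snd (\<Phi> p) = 1"
proof -
  show pC: "p \<in> C" using p chart_dom_subset unfolding surface_boundary_def by blast
  obtain x where x: "x \<in> strip" "q x = p" using q_surj[OF pC] by blast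
  then show "snd (\<Phi> p) = 0 \<or> snd (\<Phi> p) = 1"
    using p boundary_iff[OF x(1)] Phi_q[OF x(1)] by (simp add: wrap_def)
qed

text \<open>On the boundary the level is 0 or 1. It is therefore constant along the tracks of both
  endpoints during the homotopy and along the final arc, which would equate the levels of the
  original endpoints.\<close>

lemma crossing_arc_nontrivial:
  assumes "snd (\<Phi> (\<gamma> 0)) \<noteq> snd (\<Phi> (\<gamma> 1))"
  shows "\<not> trivial_rel_boundary C (surface_boundary A) \<gamma>"
proof
  let ?B = "surface_boundary A"
  let ?l = "\<lambda>p. snd (\<Phi> p)"
  assume "trivial_rel_boundary C ?B \<gamma>"
  then obtain \<eta> where \<eta>: "path \<eta>" "path_image \<eta> \<subseteq> ?B"
    and hom: "homotopic_with_canon (\<lambda>\<beta>. \<beta> 0 \<in> ?B \<and> \<beta> 1 \<in> ?B) {0..1} C \<gamma> \<eta>"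
    unfolding trivial_rel_boundary_def by blast
  have lcont: "continuous_on C ?l" by (intro continuous_on_snd homeomorphism_cont1[OF homeo])
  from hom obtain h where h: "continuous_map (prod_topology (top_of_set {0..1::real}) (top_of_set {0..1::real})) (top_of_set C) h"
    and h0: "\<And>x. h (0, x) = \<gamma> x" and h1: "\<And>x. h (1, x) = \<eta> x"
    and hB: "\<And>t. t \<in> {0..1} \<Longrightarrow> h (t, 0) \<in> ?B \<and> h (t, 1) \<in> ?B"
    unfolding homotopic_with_def by blast
  have "continuous_map (top_of_set ({0..1::real} \<times> {0..1::real})) (top_of_set C) h"
    using h by (simp add: subtopology_Times)
  then have hc: "continuous_on ({0..1} \<times> {0..1}) h" "h ` ({0..1} \<times> {0..1}) \<subseteq> C"
    by (auto simp: continuous_map_subtopology_eu image_subset_iff_funcset)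
  have side: "?l (\<gamma> u) = ?l (\<eta> u)" if u: "u = 0 \<or> u = 1" for u :: real
  proof -
    have "?l (h (0, u)) = ?l (h (1, u))"
    proof (rule two_valued_endpoints_eq[where f = "\<lambda>s. ?l (h (s, u))"])
      have "continuous_on {0..1} (\<lambda>s. h (s, u))"
        by (rule continuous_on_compose2[OF hc(1)]) (use u in \<open>auto intro!: continuous_intros\<close>)
      then show "continuous_on {0..1} (\<lambda>s. ?l (h (s, u)))"
        by (rule continuous_on_compose2[OF lcont]) (use hc(2) u in auto)
      fix s :: real assume "s \<in> {0..1}"
      then have "h (s, u) \<in> ?B" using hB u by blast
      then show "?l (h (s, u)) = 0 \<or> ?l (h (s, u)) = 1" by (rule boundary_level(2))
    qed
    then show ?thesis by (simp add: h0 h1)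
  qed
  have \<eta>B: "\<eta> t \<in> ?B" if "t \<in> {0..1}" for t using \<eta>(2) that by (auto simp: path_image_def)
  have "?l (\<eta> 0) = ?l (\<eta> 1)"
  proof (rule two_valued_endpoints_eq[where f = "\<lambda>t. ?l (\<eta> t)"])
    show "continuous_on {0..1} (\<lambda>t. ?l (\<eta> t))"
      by (rule continuous_on_compose2[OF lcont]) (use \<eta>(1) \<eta>B boundary_level(1) in \<open>auto simp: path_def\<close>)
    show "?l (\<eta> t) = 0 \<or> ?l (\<eta> t) = 1" if "t \<in> {0..1}" for t
      by (rule boundary_level(2)[OF \<eta>B[OF that]])
  qed
  with side[of 0] side[of 1] assms show False by simp
qed

text \<open>The projection to the circle factor would carry a contraction of the loop to a
  contraction of a circle loop whose angle increases by \<open>k\<close>.\<close>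

lemma winding_loop_noncontractible:
  assumes \<sigma>: "continuous_on {0..1} \<sigma>" "\<sigma> ` {0..1} \<subseteq> strip" "\<sigma> 1 = \<sigma> 0 + (of_int k, 0)" and k: "k \<noteq> 0"
  shows "\<not> contractible_loop C (q \<circ> \<sigma>)"
proof
  assume "contractible_loop C (q \<circ> \<sigma>)"
  then obtain p where "homotopic_loops C (q \<circ> \<sigma>) (\<lambda>_. p)" unfolding contractible_loop_def by blast
  moreover have "continuous_on C (fst \<circ> \<Phi>)"
    by (intro continuous_on_compose homeomorphism_cont1[OF homeo] continuous_intros)
  moreover have "(fst \<circ> \<Phi>) \<in> C \<rightarrow> sphere 0 1"
  proof
    fix p assume "p \<in> C"
    then have "\<Phi> p \<in> standard_cylinder" using homeomorphism_image1[OF homeo] by blast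
    then show "(fst \<circ> \<Phi>) p \<in> sphere 0 1" by (simp add: standard_cylinder_def mem_Times_iff)
  qed
  ultimately have 1: "homotopic_loops (sphere 0 1) ((fst \<circ> \<Phi>) \<circ> (q \<circ> \<sigma>)) ((fst \<circ> \<Phi>) \<circ> (\<lambda>_. p))"
    by (rule homotopic_loops_continuous_image)
  define \<theta> where "\<theta> = (\<lambda>t. fst (\<sigma> t))"
  have \<theta>: "continuous_on {0..1} \<theta>" unfolding \<theta>_def by (intro continuous_on_fst \<sigma>)
  have \<theta>1: "\<theta> 1 = \<theta> 0 + of_int k" by (simp add: \<theta>_def \<sigma>)
  have eq: "cis (2 * pi * \<theta> t) = ((fst \<circ> \<Phi>) \<circ> (q \<circ> \<sigma>)) t" if "t \<in> {0..1}" for t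
  proof -
    have "\<sigma> t \<in> strip" using \<sigma>(2) that by blast
    from Phi_q[OF this] show ?thesis by (simp add: wrap_def \<theta>_def)
  qed
  have "homotopic_loops (sphere 0 1) (\<lambda>t. cis (2 * pi * \<theta> t)) ((fst \<circ> \<Phi>) \<circ> (q \<circ> \<sigma>))"
  proof (rule homotopic_loops_eq[OF _ _ _ eq])
    show "path (\<lambda>t. cis (2 * pi * \<theta> t))" unfolding path_def by (intro continuous_intros \<theta>)
    show "path_image (\<lambda>t. cis (2 * pi * \<theta> t)) \<subseteq> sphere 0 1" by (auto simp: path_image_def)
    have "wrap (\<sigma> 0 + (of_int k, 0)) = wrap (\<sigma> 0)" by (rule wrap_shift)
    then have "wrap (\<sigma> 1) = wrap (\<sigma> 0)" by (simp only: \<sigma>(3))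
    then show "pathfinish (\<lambda>t. cis (2 * pi * \<theta> t)) = pathstart (\<lambda>t. cis (2 * pi * \<theta> t))"
      by (simp add: pathfinish_def pathstart_def \<theta>_def wrap_def)
  qed
  from homotopic_loops_trans[OF this 1]
  have "homotopic_loops (sphere 0 1) (\<lambda>t. cis (2 * pi * \<theta> t)) (\<lambda>_. fst (\<Phi> p))" by (simp add: o_def)
  with cis_loop_noncontractible[OF \<theta> \<theta>1 k] show False by blast
qed

section \<open>Projected polygons and the bounds for systole and height\<close>

text \<open>The affine formula makes sense for all real \<open>u\<close>, so \<open>wrap\<close>
  along the line, followed by the local extension of the chart, is a smooth extension also at the
  ends of \<open>X\<close>.\<close>

lemma smooth_on_chart_line:
  assumes c: "c \<in> A" and aff: "\<And>u. u \<in> X \<Longrightarrow> \<sigma> u = w + u *\<^sub>R v" "\<And>u. u \<in> X \<Longrightarrow> \<sigma> u \<in> strip"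
  shows "smooth_on (X \<inter> (q \<circ> \<sigma>) -` chart_dom c) (chart_map c \<circ> (q \<circ> \<sigma>))"
  unfolding smooth_on_def
proof
  let ?Y = "X \<inter> (q \<circ> \<sigma>) -` chart_dom c"
  define l where "l = (\<lambda>u. wrap (w + u *\<^sub>R v))"
  have l: "Ck_on k UNIV l" for k
  proof -
    have "l = (\<lambda>u. (1 * cis (2 * pi * fst w + (2 * pi * fst v) * u), snd w + snd v * u))"
      by (auto simp: l_def wrap_def algebra_simps)
    then show ?thesis using Ck_on_wrap_line by metis
  qed
  have lc: "continuous_on UNIV l" using l[of 0] by simp
  have lY: "l u \<in> \<Phi> ` chart_dom c" "(chart_map c \<circ> \<Psi>) (l u) = (chart_map c \<circ> (q \<circ> \<sigma>)) u" if u: "u \<in> ?Y" for u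
  proof -
    have e: "l u = wrap (\<sigma> u)" "\<sigma> u \<in> strip" using aff u by (auto simp: l_def)
    then have "l u = \<Phi> (q (\<sigma> u))" using Phi_q by simp
    then show "l u \<in> \<Phi> ` chart_dom c" using u by auto
    show "(chart_map c \<circ> \<Psi>) (l u) = (chart_map c \<circ> (q \<circ> \<sigma>)) u" by (simp add: e q_def)
  qed
  fix u assume u: "u \<in> ?Y"
  obtain V g g' where V: "open V" "l u \<in> V" "\<And>k. Ck_on k V g"
    "\<And>y. y \<in> V \<inter> \<Phi> ` chart_dom c \<Longrightarrow> g y = (chart_map c \<circ> \<Psi>) y"
    using smooth_onE[OF smooth_from[OF c] lY(1)[OF u]] by metis
  show "\<exists>U h. open U \<and> u \<in> U \<and> (\<forall>k. Ck_on k U h) \<and> (\<forall>y\<in>U \<inter> ?Y. h y = (chart_map c \<circ> (q \<circ> \<sigma>)) y)"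
  proof (intro exI conjI allI ballI)
    show oU: "open (l -` V)" by (rule open_vimage[OF V(1) lc])
    show "u \<in> l -` V" using V by simp
    show "Ck_on k (l -` V) (\<lambda>u. g (l u))" for k
      by (rule Ck_on_compose[OF oU V(1) _ Ck_on_subset[OF l] V(3)]) auto
    fix y assume "y \<in> l -` V \<inter> ?Y"
    then have y: "y \<in> ?Y" "l y \<in> V" by auto
    show "g (l y) = (chart_map c \<circ> (q \<circ> \<sigma>)) y"
      using V(4)[of "l y"] lY[OF y(1)] y(2) by simp
  qed
qed

text \<open>Lengths in the strip and on the surface agree because off the break points the velocity
  of \<open>q \<circ> \<sigma>\<close> is \<open>dq (\<sigma> t) (\<sigma>' t)\<close>, by the chain
  rule in each chart.\<close>

lemma reach_curve:
  assumes "reach x y r"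
  obtains \<sigma> where "continuous_on {0..1} \<sigma>" "\<sigma> ` {0..1} \<subseteq> strip" "\<sigma> 0 = x" "\<sigma> 1 = y"
    "piecewise_smooth C A 0 1 (q \<circ> \<sigma>)" "curve_length A F 0 1 (q \<circ> \<sigma>) = r"
proof -
  obtain \<sigma> \<sigma>' K where \<sigma>: "continuous_on {0..1} \<sigma>" "\<sigma> ` {0..1} \<subseteq> strip" "\<sigma> 0 = x" "\<sigma> 1 = y"
    and K: "finite K"
    and aff: "\<And>s t. 0 \<le> s \<Longrightarrow> s \<le> t \<Longrightarrow> t \<le> (1::real) \<Longrightarrow> {s<..<t} \<inter> K = {} \<Longrightarrow>
        \<exists>w v. \<forall>u\<in>{s..t}. \<sigma> u = w + u *\<^sub>R v"
    and der: "\<And>t. t \<in> {0..1} - K \<Longrightarrow> (\<sigma> has_vector_derivative \<sigma>' t) (at t within {0..1})"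
    and int: "((\<lambda>t. G (\<sigma> t) (\<sigma>' t)) has_integral r) {0..1}"
    using reach_imp_polygonal_path[OF assms] by blast
  have "piecewise_smooth C A 0 1 (q \<circ> \<sigma>)"
    unfolding piecewise_smooth_def
  proof (intro conjI)
    show "continuous_on {0..1} (q \<circ> \<sigma>)"
      by (rule continuous_on_compose[OF \<sigma>(1) continuous_on_subset[OF q_cont \<sigma>(2)]])
    show "(q \<circ> \<sigma>) ` {0..1} \<subseteq> C"
    proof (rule image_subsetI)
      fix u :: real assume "u \<in> {0..1}"
      then have "\<sigma> u \<in> strip" using \<sigma>(2) by blast
      then show "(q \<circ> \<sigma>) u \<in> C" by (simp add: q_C)
    qed
    show "\<exists>S. finite S \<and> (\<forall>s t. 0 \<le> s \<and> s \<le> t \<and> t \<le> 1 \<and> {s<..<t} \<inter> S = {} \<longrightarrow>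
        (\<forall>c\<in>A. smooth_on ({s..t} \<inter> (q \<circ> \<sigma>) -` chart_dom c) (chart_map c \<circ> (q \<circ> \<sigma>))))"
    proof (intro exI[of _ K] conjI allI impI ballI K)
      fix s t :: real and c
      assume st: "0 \<le> s \<and> s \<le> t \<and> t \<le> 1 \<and> {s<..<t} \<inter> K = {}" and c: "c \<in> A"
      then have "\<exists>w v. \<forall>u\<in>{s..t}. \<sigma> u = w + u *\<^sub>R v" by (intro aff) auto
      then obtain w v where wv: "\<forall>u\<in>{s..t}. \<sigma> u = w + u *\<^sub>R v" by blast
      show "smooth_on ({s..t} \<inter> (q \<circ> \<sigma>) -` chart_dom c) (chart_map c \<circ> (q \<circ> \<sigma>))"
      proof (rule smooth_on_chart_line[OF c])
        show "\<sigma> u = w + u *\<^sub>R v" if "u \<in> {s..t}" for u using wv that by blast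
        show "\<sigma> u \<in> strip" if "u \<in> {s..t}" for u using \<sigma>(2) that st by (auto simp: image_subset_iff)
      qed
    qed
  qed
  moreover have "curve_length A F 0 1 (q \<circ> \<sigma>) = r"
  proof -
    have vel: "velocity A 0 1 (q \<circ> \<sigma>) t = dq (\<sigma> t) (\<sigma>' t)" if t: "t \<in> {0..1} - K" for t
    proof
      fix d
      show "velocity A 0 1 (q \<circ> \<sigma>) t d = dq (\<sigma> t) (\<sigma>' t) d"
      proof (cases "d \<in> A \<and> q (\<sigma> t) \<in> chart_dom d")
        case True
        have "\<sigma> t \<in> strip" using \<sigma>(2) t by blast
        then have "\<sigma> t \<in> cdom d" using True by (simp add: cdom_def)
        then have "(kap d has_derivative J d (\<sigma> t)) (at (\<sigma> t) within strip)" using J_has_derivative True by blast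
        from vector_derivative_diff_chain_within[OF der[OF t] has_derivative_subset[OF this \<sigma>(2)]]
        have "((kap d \<circ> \<sigma>) has_vector_derivative J d (\<sigma> t) (\<sigma>' t)) (at t within {0..1})" .
        moreover have "kap d \<circ> \<sigma> = chart_map d \<circ> (q \<circ> \<sigma>)" by (rule ext) (simp add: kap_def)
        ultimately have "vector_derivative (chart_map d \<circ> (q \<circ> \<sigma>)) (at t within {0..1}) = J d (\<sigma> t) (\<sigma>' t)"
          using vector_derivative_within_closed_interval[of 0 1 t] t by simp
        then show ?thesis using True by (simp add: velocity_def dq_def)
      next
        case False
        then show ?thesis unfolding velocity_def dq_def by auto
      qed
    qed
    have "((\<lambda>t. F ((q \<circ> \<sigma>) t) (velocity A 0 1 (q \<circ> \<sigma>) t)) has_integral r) {0..1}"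
      by (rule has_integral_spike_finite[OF K _ int]) (simp add: vel G_def)
    then show ?thesis unfolding curve_length_def by (rule integral_unique)
  qed
  ultimately show thesis using that[OF \<sigma>] by blast
qed

text \<open>\<open>F\<close> is known to be nonnegative on tangent spaces only, so the velocity must
  be recognised as a tangent vector: the curve is differentiable in one chart, and coordinate
  changes carry its derivative to the others.\<close>

lemma velocity_in_tangent_space:
  assumes \<gamma>: "continuous_on {0..1} \<gamma>" "\<gamma> ` {0..1} \<subseteq> C"
    and K: "finite K" and t: "0 < t" "t < 1" "t \<notin> K"
    and smooth: "\<And>s t c. 0 \<le> s \<Longrightarrow> s \<le> t \<Longrightarrow> t \<le> 1 \<Longrightarrow> {s<..<t} \<inter> K = {} \<Longrightarrow> c \<in> A \<Longrightarrow>
       smooth_on ({s..t} \<inter> \<gamma> -` chart_dom c) (chart_map c \<circ> \<gamma>)"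
  shows "velocity A 0 1 \<gamma> t \<in> tangent_space A (\<gamma> t)"
proof -
  have t01: "t \<in> {0..1}" using t by simp
  have nhd: "\<exists>N. open N \<and> t \<in> N \<and> N \<subseteq> {0<..<1} \<and> (\<forall>u\<in>N. \<gamma> u \<in> chart_dom d)" if d: "d \<in> A" "\<gamma> t \<in> chart_dom d" for d
  proof -
    have "openin (top_of_set {0..1}) ({0..1} \<inter> \<gamma> -` chart_dom d)"
      by (rule continuous_openin_preimage[OF \<gamma>(1) _ chart_open[OF d(1)]]) (use \<gamma>(2) in auto)
    then obtain T where T: "open T" "{0..1} \<inter> \<gamma> -` chart_dom d = {0..1} \<inter> T" unfolding openin_open by blast
    have "t \<in> {0..1} \<inter> \<gamma> -` chart_dom d" using t01 d by simp
    then have "t \<in> T" using T(2) by blast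
    then have "t \<in> T \<inter> {0<..<1}" using t by simp
    moreover have "\<forall>u\<in>T \<inter> {0<..<1}. \<gamma> u \<in> chart_dom d"
    proof
      fix u assume "u \<in> T \<inter> {0<..<1}"
      then have "u \<in> {0..1} \<inter> T" by auto
      then have "u \<in> {0..1} \<inter> \<gamma> -` chart_dom d" using T(2) by blast
      then show "\<gamma> u \<in> chart_dom d" by simp
    qed
    moreover have "open (T \<inter> {0<..<1})" using T(1) by auto
    ultimately show ?thesis by blast
  qed
  obtain c where c: "c \<in> A" "\<gamma> t \<in> chart_dom c" using chart_cover \<gamma>(2) t01 by blast
  obtain N where N: "open N" "t \<in> N" "N \<subseteq> {0<..<1}" "\<forall>u\<in>N. \<gamma> u \<in> chart_dom c" using nhd[OF c] by blast
  have "open (N - K)" "t \<in> N - K" using N t K by (auto intro: open_Diff finite_imp_closed)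
  \<comment> \<open>A closed interval around \<open>t\<close> that avoids all break points is one on
    which piecewise smoothness gives an honest smooth extension.\<close>
  then obtain e where e: "0 < e" "cball t e \<subseteq> N - K" using open_contains_cball by blast
  have I: "{t - e..t + e} \<subseteq> N - K" using e(2) by (simp add: cball_eq_atLeastAtMost)
  have I01: "{t - e..t + e} \<subseteq> {0<..<1}" using I N(3) by blast
  have "t - e \<in> {t - e..t + e}" "t + e \<in> {t - e..t + e}" using e(1) by auto
  then have "t - e \<in> {0<..<1}" "t + e \<in> {0<..<1}" using I01 by blast+
  then have b: "0 \<le> t - e" "t + e \<le> 1" by simp_all
  have Ie: "{t - e<..<t + e} \<subseteq> {t - e..t + e}" by auto
  then have disj: "{t - e<..<t + e} \<inter> K = {}" using I by blast
  have "smooth_on ({t - e..t + e} \<inter> \<gamma> -` chart_dom c) (chart_map c \<circ> \<gamma>)"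
    by (rule smooth[OF b(1) _ b(2) disj c(1)]) (use e in simp)
  moreover have "t \<in> {t - e..t + e} \<inter> \<gamma> -` chart_dom c" using e c by simp
  ultimately obtain U g g' where U: "open U" "t \<in> U"
    "\<And>y. y \<in> U \<inter> ({t - e..t + e} \<inter> \<gamma> -` chart_dom c) \<Longrightarrow> g y = (chart_map c \<circ> \<gamma>) y"
    "\<And>y. y \<in> U \<Longrightarrow> (g has_derivative g' y) (at y)"
    using smooth_onE by metis
  have der: "((chart_map c \<circ> \<gamma>) has_derivative g' t) (at t)"
  proof (rule has_derivative_transform_within_open[OF U(4)[OF U(2)]])
    show "open (U \<inter> {t - e<..<t + e})" using U by auto
    show "t \<in> U \<inter> {t - e<..<t + e}" using U e by auto
    fix u assume u: "u \<in> U \<inter> {t - e<..<t + e}"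
    then have "u \<in> N" using I Ie by blast
    then show "g u = (chart_map c \<circ> \<gamma>) u" using N(4) u Ie by (intro U(3)) auto
  qed
  define \<xi> where "\<xi> = g' t 1"
  have "velocity A 0 1 \<gamma> t = tangent_vector A c (\<gamma> t) \<xi>"
  proof
    fix d
    show "velocity A 0 1 \<gamma> t d = tangent_vector A c (\<gamma> t) \<xi> d"
    proof (cases "d \<in> A \<and> \<gamma> t \<in> chart_dom d")
      case True
      then have d: "d \<in> A" "\<gamma> t \<in> chart_dom d" by auto
      obtain N' where N': "open N'" "t \<in> N'" "N' \<subseteq> {0<..<1}" "\<forall>u\<in>N'. \<gamma> u \<in> chart_dom d" using nhd[OF d] by blast
      let ?T = "chart_map c ` (chart_dom c \<inter> chart_dom d)"
      let ?\<tau> = "chart_map d \<circ> chart_inv c"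
      let ?\<tau>' = "frechet_derivative ?\<tau> (at (chart_map c (\<gamma> t)) within ?T)"
      have "(chart_map c \<circ> \<gamma>) ` (N \<inter> N') \<subseteq> ?T" using N(4) N'(4) by auto
      from has_derivative_subset[OF transition_has_derivative[OF c(1) d(1) c(2) d(2)] this]
      have "(?\<tau> has_derivative ?\<tau>') (at ((chart_map c \<circ> \<gamma>) t) within (chart_map c \<circ> \<gamma>) ` (N \<inter> N'))" by simp
      from diff_chain_within[OF has_derivative_at_withinI[OF der] this]
      have "((?\<tau> \<circ> (chart_map c \<circ> \<gamma>)) has_derivative (?\<tau>' \<circ> g' t)) (at t within N \<inter> N')" .
      moreover have "at t within N \<inter> N' = at t"
        using N N' by (intro at_within_open) auto
      ultimately have "((?\<tau> \<circ> (chart_map c \<circ> \<gamma>)) has_derivative (?\<tau>' \<circ> g' t)) (at t)" by simp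
      then have D: "((chart_map d \<circ> \<gamma>) has_derivative (?\<tau>' \<circ> g' t)) (at t)"
      proof (rule has_derivative_transform_within_open[OF _ N(1,2)])
        fix u assume "u \<in> N"
        then show "(?\<tau> \<circ> (chart_map c \<circ> \<gamma>)) u = (chart_map d \<circ> \<gamma>) u" using N(4) chart_inv_map[OF c(1)] by simp
      qed
      have lin: "linear (?\<tau>' \<circ> g' t)" by (rule has_derivative_linear[OF D])
      have "(?\<tau>' \<circ> g' t) = (\<lambda>r. r *\<^sub>R ?\<tau>' \<xi>)"
      proof
        fix r :: real
        have "(?\<tau>' \<circ> g' t) (r *\<^sub>R 1) = r *\<^sub>R (?\<tau>' \<circ> g' t) 1" by (rule linear_scale[OF lin])
        then show "(?\<tau>' \<circ> g' t) r = r *\<^sub>R ?\<tau>' \<xi>" by (simp add: \<xi>_def)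
      qed
      with D have D2: "((chart_map d \<circ> \<gamma>) has_vector_derivative ?\<tau>' \<xi>) (at t)"
        unfolding has_vector_derivative_def by (simp only:)
      have "vector_derivative (chart_map d \<circ> \<gamma>) (at t within {0..1}) = ?\<tau>' \<xi>"
        by (rule vector_derivative_within_closed_interval[OF zero_less_one t01 has_vector_derivative_at_within[OF D2]])
      then show ?thesis using True by (simp add: velocity_def tangent_vector_def)
    next
      case False
      then show ?thesis unfolding velocity_def tangent_vector_def by auto
    qed
  qed
  then show ?thesis unfolding tangent_space_def using c by blast
qed

text \<open>Supplies the lower bound without which the real infima defining systole and height would
  carry no information.\<close>

lemma curve_length_nonneg:
  assumes ps: "piecewise_smooth C A 0 1 \<gamma>"
  shows "0 \<le> curve_length A F 0 1 \<gamma>"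
proof -
  obtain K where \<gamma>: "continuous_on {0..1} \<gamma>" "\<gamma> ` {0..1} \<subseteq> C" and K: "finite K"
    and sm: "\<forall>s t. 0 \<le> s \<and> s \<le> t \<and> t \<le> 1 \<and> {s<..<t} \<inter> K = {} \<longrightarrow>
        (\<forall>c\<in>A. smooth_on ({s..t} \<inter> \<gamma> -` chart_dom c) (chart_map c \<circ> \<gamma>))"
    using ps unfolding piecewise_smooth_def by blast
  show ?thesis
    unfolding curve_length_def
  proof (rule integral_nonneg_except_finite)
    show "finite (K \<union> {0, 1})" using K by simp
    fix t assume t: "t \<in> {0..1} - (K \<union> {0, 1})"
    have "velocity A 0 1 \<gamma> t \<in> tangent_space A (\<gamma> t)"
      by (rule velocity_in_tangent_space[OF \<gamma> K]) (use t sm in auto)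
    moreover have "\<gamma> t \<in> C" using \<gamma>(2) t by auto
    ultimately show "0 \<le> F (\<gamma> t) (velocity A 0 1 \<gamma> t)"
      using finsler unfolding finsler_metric_def by blast
  qed
qed

lemma systole_le: "reach x (x + (of_int k, 0)) r \<Longrightarrow> k \<noteq> 0 \<Longrightarrow> systole C A F \<le> r"
proof -
  assume r: "reach x (x + (of_int k, 0)) r" and k: "k \<noteq> 0"
  obtain \<sigma> where \<sigma>: "continuous_on {0..1} \<sigma>" "\<sigma> ` {0..1} \<subseteq> strip" "\<sigma> 0 = x" "\<sigma> 1 = x + (of_int k, 0)"
    "piecewise_smooth C A 0 1 (q \<circ> \<sigma>)" "curve_length A F 0 1 (q \<circ> \<sigma>) = r"
    by (rule reach_curve[OF r])
  have "(q \<circ> \<sigma>) 0 = (q \<circ> \<sigma>) 1" using \<sigma> q_shift by simp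
  moreover have "\<not> contractible_loop C (q \<circ> \<sigma>)"
    by (rule winding_loop_noncontractible[OF \<sigma>(1,2) _ k]) (simp add: \<sigma>)
  ultimately show "systole C A F \<le> r"
    unfolding systole_def
    by (intro cInf_lower) (use \<sigma>(5,6) in \<open>auto intro!: bdd_belowI[of _ 0] curve_length_nonneg\<close>)
qed

text \<open>The infimum is informative only over a nonempty set, so a noncontractible loop is
  exhibited: the image of a horizontal unit segment.\<close>

lemma systole_nonneg: "0 \<le> systole C A F"
proof -
  have r: "reach (0,0) ((0,0) + (of_int 1, 0)) (seg (0,0) ((0,0) + (of_int 1, 0)))"
    by (rule reach_seg) (auto simp: mem_strip)
  obtain \<sigma> where \<sigma>: "continuous_on {0..1} \<sigma>" "\<sigma> ` {0..1} \<subseteq> strip" "\<sigma> 0 = (0,0)" "\<sigma> 1 = (0,0) + (of_int 1, 0)"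
    "piecewise_smooth C A 0 1 (q \<circ> \<sigma>)"
    "curve_length A F 0 1 (q \<circ> \<sigma>) = seg (0,0) ((0,0) + (of_int 1, 0))"
    by (rule reach_curve[OF r])
  have "(q \<circ> \<sigma>) 0 = (q \<circ> \<sigma>) 1" using \<sigma> q_shift[of "(0,0)" 1] by simp
  moreover have "\<not> contractible_loop C (q \<circ> \<sigma>)"
    by (rule winding_loop_noncontractible[OF \<sigma>(1,2), of 1]) (simp_all add: \<sigma>)
  ultimately have "{curve_length A F 0 1 \<gamma> |\<gamma>. piecewise_smooth C A 0 1 \<gamma> \<and> \<gamma> 0 = \<gamma> 1 \<and> \<not> contractible_loop C \<gamma>} \<noteq> {}"
    using \<sigma>(5) by blast
  then show ?thesis
    unfolding systole_def by (rule cInf_greatest) (use curve_length_nonneg in auto)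
qed

text \<open>A polygon from the bottom to the top projects to an arc with endpoints at different
  levels, hence a competitor for the height; a vertical segment shows that competitors
  exist.\<close>

lemma height_le: "reach (a, 0) (b, 1) r \<Longrightarrow> height C A F \<le> r"
  and height_nonneg: "0 \<le> height C A F"
proof -
  have curve: "\<exists>\<gamma>. piecewise_smooth C A 0 1 \<gamma> \<and> \<gamma> 0 \<in> surface_boundary A \<and> \<gamma> 1 \<in> surface_boundary A \<and>
      \<not> trivial_rel_boundary C (surface_boundary A) \<gamma> \<and> curve_length A F 0 1 \<gamma> = r"
    if r: "reach (a, 0) (b, 1) r" for a b r
  proof -
    obtain \<sigma> where \<sigma>: "continuous_on {0..1} \<sigma>" "\<sigma> ` {0..1} \<subseteq> strip" "\<sigma> 0 = (a, 0)" "\<sigma> 1 = (b, 1)"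
      "piecewise_smooth C A 0 1 (q \<circ> \<sigma>)" "curve_length A F 0 1 (q \<circ> \<sigma>) = r"
      by (rule reach_curve[OF r])
    have s: "(a, 0) \<in> strip" "(b, 1) \<in> strip" by (auto simp: mem_strip)
    have "(q \<circ> \<sigma>) 0 \<in> surface_boundary A" "(q \<circ> \<sigma>) 1 \<in> surface_boundary A"
      using boundary_iff[OF s(1)] boundary_iff[OF s(2)] \<sigma> by auto
    moreover have "\<not> trivial_rel_boundary C (surface_boundary A) (q \<circ> \<sigma>)"
      by (rule crossing_arc_nontrivial) (use Phi_q[OF s(1)] Phi_q[OF s(2)] \<sigma> in \<open>simp add: wrap_def\<close>)
    ultimately show ?thesis using \<sigma>(5,6) by blast
  qed
  let ?S = "{curve_length A F 0 1 \<gamma> |\<gamma>. piecewise_smooth C A 0 1 \<gamma> \<and> \<gamma> 0 \<in> surface_boundary A \<and> \<gamma> 1 \<in> surface_boundary A \<and>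
      \<not> trivial_rel_boundary C (surface_boundary A) \<gamma>}"
  have bdd: "bdd_below ?S" by (rule bdd_belowI[of _ 0]) (use curve_length_nonneg in auto)
  have mem: "r \<in> ?S" if "reach (a, 0) (b, 1) r" for a b r using curve[OF that] by blast
  show "reach (a, 0) (b, 1) r \<Longrightarrow> height C A F \<le> r"
    unfolding height_def by (rule cInf_lower[OF mem bdd])
  have "reach (0, 0) (0, 1) (seg (0, 0) (0, 1))" by (rule reach_seg) (auto simp: mem_strip)
  then have "?S \<noteq> {}" using mem by blast
  then show "0 \<le> height C A F"
    unfolding height_def by (rule cInf_greatest) (use curve_length_nonneg in auto)
qed

lemma area_integral_ge_systole_height:
  "2 * (systole C A F * height C A F) \<le> integral (cbox (0,0) (1,1)) area"
proof -
  interpret strip_systole G "systole C A F" "height C A F"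
    by unfold_locales (rule systole_nonneg height_nonneg systole_le height_le; assumption)+
  show ?thesis by (rule area_integral_ge)
qed

end

section \<open>The Holmes-Thompson volume in strip coordinates\<close>

lemma continuous_preimage_borel:
  fixes f :: "'a::euclidean_space \<Rightarrow> 'b::euclidean_space"
  assumes "continuous_on D f" "D \<in> sets borel" "Y \<in> sets borel"
  shows "{x \<in> D. f x \<in> Y} \<in> sets borel"
proof -
  have "f \<in> borel_measurable (restrict_space borel D)"
    by (rule borel_measurable_continuous_on_restrict[OF assms(1)])
  then have "f -` Y \<inter> space (restrict_space borel D) \<in> sets (restrict_space borel D)"
    using assms(3) by (rule measurable_sets)
  moreover have "f -` Y \<inter> space (restrict_space borel D) = {x \<in> D. f x \<in> Y}"
    by (auto simp: space_restrict_space)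
  ultimately show ?thesis using sets_restrict_space_iff[of D borel] assms(2) by simp
qed

lemma openin_borel:
  fixes S :: "'a::euclidean_space set"
  assumes "S \<in> sets borel" "openin (top_of_set S) T"
  shows "T \<in> sets borel"
  using assms unfolding openin_open by auto

lemma strip_borel: "strip \<in> sets borel"
  unfolding strip_def by (intro borel_closed closed_Times) auto

lemma half_plane_borel: "half_plane \<in> sets borel"
  unfolding half_plane_def by (intro borel_closed closed_Collect_le continuous_intros)

text \<open>Half-open in the first coordinate, so that \<open>q\<close> maps it bijectively onto
  \<open>C\<close>.\<close>

definition fundamental :: "(real \<times> real) set" where
  "fundamental = {0..<1} \<times> {0..1}"

lemma fundamental_borel: "fundamental \<in> sets borel"
proof -
  have "fundamental = strip \<inter> ({x. 0 \<le> fst x} \<inter> {x. fst x < 1})"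
    by (auto simp: fundamental_def strip_def)
  moreover have "{x::real \<times> real. 0 \<le> fst x} \<in> sets borel" "{x::real \<times> real. fst x < 1} \<in> sets borel"
    by (intro borel_closed borel_open closed_Collect_le open_Collect_less continuous_intros)+
  ultimately show ?thesis using strip_borel by (metis sets.Int)
qed

lemma fundamental_strip: "fundamental \<subseteq> strip"
  by (auto simp: fundamental_def strip_def)

lemma mem_fundamental: "x \<in> fundamental \<longleftrightarrow> x \<in> strip \<and> 0 \<le> fst x \<and> fst x < 1"
  by (cases x) (auto simp: fundamental_def strip_def)

context finsler_cylinder_chart
begin

lemma q_inj_fundamental: "inj_on q fundamental"
proof (rule inj_onI)
  fix x y assume x: "x \<in> fundamental" and y: "y \<in> fundamental" and e: "q x = q y"
  have "x \<in> strip" "y \<in> strip" using x y fundamental_strip by blast+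
  from q_eqD[OF this e] obtain k :: int where k: "y = x + (of_int k, 0)" by blast
  have "fst y = fst x + of_int k" "0 \<le> fst x" "fst x < 1" "0 \<le> fst y" "fst y < 1"
    using x y k by (auto simp: mem_fundamental)
  then have "\<bar>real_of_int k\<bar> < 1" by linarith
  then have "k = 0" by linarith
  with k show "x = y" by (simp add: zero_prod_def[symmetric])
qed

lemma q_fundamental: "q ` fundamental = C"
proof
  show "q ` fundamental \<subseteq> C" using q_C fundamental_strip by blast
  show "C \<subseteq> q ` fundamental"
  proof
    fix p assume "p \<in> C"
    from q_surj[OF this] obtain x where "x \<in> strip" "0 \<le> fst x" "fst x < 1" "q x = p" by blast
    then show "p \<in> q ` fundamental" using mem_fundamental by blast
  qed
qed

lemma HT_density_eq:
  assumes "c \<in> A" "y \<in> chart_img c"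
  shows "HT_density A F c y = measure lborel (polar_body (in_chart A F c y)) / pi"
  using dual_ball_eq_polar_body[OF in_chart_normlike[OF assms]]
  unfolding HT_density_def dual_norm_def by simp

text \<open>The transformation law of polar areas, applied to \<open>J c x\<close>, expresses the
  density in strip coordinates through the one in the chart.\<close>

lemma area_eq_jac:
  assumes c: "c \<in> A" and x: "x \<in> cdom c"
  shows "area x / pi = \<bar>jac (J c x)\<bar> * HT_density A F c (kap c x)"
proof -
  have "G x = (\<lambda>v. in_chart A F c (kap c x) (J c x v))" using G_in_chart[OF c x] by blast
  then show ?thesis
    using polar_area_linear[OF in_chart_normlike[OF c kap_img[OF c x]] J_linear[OF c x] J_inj[OF c x]]
      HT_density_eq[OF c kap_img[OF c x]]
    by (simp add: area_def)
qed

lemma area_integrable: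
  assumes E: "E \<in> sets borel" "E \<subseteq> fundamental"
  shows "integrable lborel (\<lambda>x. indicator E x * (area x / pi))"
proof -
  have "cbox (0,0) (1,1) \<subseteq> strip" by (auto simp: mem_strip)
  then have "continuous_on (cbox (0,0) (1,1)) area" by (rule continuous_on_subset[OF continuous_area])
  then have "set_integrable lborel (cbox (0,0) (1,1)) area"
    unfolding set_integrable_def by (intro borel_integrable_compact) auto
  then have "set_integrable lborel E area"
    by (rule set_integrable_subset) (use E in \<open>auto simp: fundamental_def\<close>)
  then show ?thesis unfolding set_integrable_def by simp
qed

text \<open>\<open>kap c\<close> maps the lift \<open>E\<close> bijectively onto the coordinate
  image of the piece, and the Jacobian of this change of variables is the one in
  \<open>area_eq_jac\<close>.\<close>

lemma piece_integral:
  assumes c: "c \<in> A" and B: "B \<subseteq> chart_dom c" "chart_map c ` B \<in> sets borel"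
  defines "E \<equiv> {x \<in> fundamental. q x \<in> B}"
  shows "E \<in> sets borel"
    and "set_lebesgue_integral lborel (chart_map c ` B) (HT_density A F c) =
         integral\<^sup>L lborel (\<lambda>x. indicator E x * (area x / pi))"
proof -
  let ?Y = "chart_map c ` B"
  have cd: "cdom c \<in> sets borel" by (rule openin_borel[OF strip_borel cdom_openin[OF c]])
  have Edom: "E \<subseteq> cdom c" using B(1) fundamental_strip by (auto simp: E_def cdom_def)
  \<comment> \<open>Measurability of \<open>B\<close> is given in coordinates only, so membership in
    \<open>B\<close> is expressed through \<open>kap c\<close>.\<close>
  have Eeq: "E = fundamental \<inter> {x \<in> cdom c. kap c x \<in> ?Y}"
  proof (intro set_eqI iffI)
    fix x assume "x \<in> E"
    then show "x \<in> fundamental \<inter> {x \<in> cdom c. kap c x \<in> ?Y}"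
      using Edom by (auto simp: E_def kap_def)
  next
    fix x assume x: "x \<in> fundamental \<inter> {x \<in> cdom c. kap c x \<in> ?Y}"
    then obtain p where "p \<in> B" "chart_map c (q x) = chart_map c p" by (auto simp: kap_def)
    moreover have "q x \<in> chart_dom c" using x by (simp add: cdom_def)
    ultimately have "q x = p" using chart_map_inj[OF c] B(1) by (blast dest: inj_onD)
    then show "x \<in> E" using x \<open>p \<in> B\<close> by (simp add: E_def)
  qed
  show E: "E \<in> sets borel"
    unfolding Eeq by (intro sets.Int fundamental_borel continuous_preimage_borel[OF kap_cont[OF c] cd B(2)])
  have Yimg: "?Y \<subseteq> chart_img c" using B(1) by blast
  have im: "kap c ` E = ?Y"
  proof
    show "kap c ` E \<subseteq> ?Y" by (auto simp: E_def kap_def)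
    show "?Y \<subseteq> kap c ` E"
    proof
      fix y assume "y \<in> ?Y"
      then obtain p where p: "p \<in> B" "y = chart_map c p" by blast
      have "p \<in> C" using p(1) B(1) chart_dom_subset[OF c] by blast
      then obtain x where "x \<in> fundamental" "p = q x" using q_fundamental by blast
      then have "x \<in> E" "y = kap c x" using p by (simp_all add: E_def kap_def)
      then show "y \<in> kap c ` E" by blast
    qed
  qed
  have inj: "inj_on (kap c) E"
  proof (rule inj_onI)
    fix x y assume x: "x \<in> E" and y: "y \<in> E" and e: "kap c x = kap c y"
    have "q x = q y"
      using e inj_onD[OF chart_map_inj[OF c]] x y B(1) unfolding kap_def E_def by blast
    then show "x = y" using inj_onD[OF q_inj_fundamental] x y unfolding E_def by blast
  qed
  have der: "(kap c has_derivative J c x) (at x within E)" if "x \<in> E" for x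
    by (rule has_derivative_subset[OF J_has_derivative[OF c]]) (use that Edom in \<open>auto simp: cdom_def\<close>)
  have "continuous_on (chart_img c) (\<lambda>y. measure lborel (polar_body (in_chart A F c y)))"
    by (rule continuous_on_polar_area[OF in_chart_cont[OF c] in_chart_normlike[OF c]])
  then have "continuous_on (chart_img c) (\<lambda>y. measure lborel (polar_body (in_chart A F c y)) / pi)"
    by (intro continuous_intros) auto
  then have "continuous_on (chart_img c) (HT_density A F c)"
    by (rule continuous_on_eq) (simp add: HT_density_eq[OF c])
  then have dcont: "continuous_on ?Y (HT_density A F c)" by (rule continuous_on_subset[OF _ Yimg])
  have meas: "(\<lambda>y. indicator ?Y y * HT_density A F c y) \<in> borel_measurable borel"
    using borel_measurable_continuous_on_indicator[OF B(2) dcont] unfolding real_scaleR_def .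
  have eq: "indicator E x * (\<bar>jac (J c x)\<bar> * HT_density A F c (kap c x)) = indicator E x * (area x / pi)" for x
  proof (cases "x \<in> E")
    case True
    then have "x \<in> cdom c" using Edom by blast
    from area_eq_jac[OF c this] show ?thesis by simp
  qed simp
  have int: "integrable lborel (\<lambda>x. indicator E x * (\<bar>jac (J c x)\<bar> * HT_density A F c (kap c x)))"
    unfolding eq by (rule area_integrable[OF E]) (auto simp: E_def)
  have "integral\<^sup>L lborel (\<lambda>y. indicator (kap c ` E) y * HT_density A F c y) =
     integral\<^sup>L lborel (\<lambda>x. indicator E x * (\<bar>jac (J c x)\<bar> * HT_density A F c (kap c x)))"
    by (rule plane_change_of_variables(2)[OF E der inj _ int]) (use meas in \<open>simp_all add: im\<close>)
  then show "set_lebesgue_integral lborel ?Y (HT_density A F c) =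
         integral\<^sup>L lborel (\<lambda>x. indicator E x * (area x / pi))"
    unfolding eq im by (simp add: set_lebesgue_integral_def)
qed

text \<open>The lifts of the pieces partition the fundamental domain, so every partition computes
  the same integral over it.\<close>

lemma partition_sum:
  assumes part: "chart_partition C A n c B"
  shows "(\<Sum>i<n. set_lebesgue_integral lborel (chart_map (c i) ` B i) (HT_density A F (c i))) =
    integral\<^sup>L lborel (\<lambda>x. indicator fundamental x * (area x / pi))"
proof -
  have cB: "c i \<in> A" "B i \<subseteq> chart_dom (c i)" "chart_map (c i) ` B i \<in> sets borel" if "i < n" for i
    using part that unfolding chart_partition_def by auto
  have disj: "disjoint_family_on B {..<n}" and union: "(\<Union>i<n. B i) = C"
    using part unfolding chart_partition_def by auto
  define E where "E i = {x \<in> fundamental. q x \<in> B i}" for i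
  have pieces: "set_lebesgue_integral lborel (chart_map (c i) ` B i) (HT_density A F (c i)) =
      integral\<^sup>L lborel (\<lambda>x. indicator (E i) x * (area x / pi))" "E i \<in> sets borel" if "i < n" for i
    unfolding E_def using piece_integral[OF cB[OF that]] by auto
  have Edisj: "disjoint_family_on E {..<n}"
    using disj unfolding disjoint_family_on_def E_def by blast
  have Eunion: "(\<Union>i<n. E i) = fundamental"
  proof
    show "fundamental \<subseteq> (\<Union>i<n. E i)"
    proof
      fix x assume x: "x \<in> fundamental"
      then have "q x \<in> (\<Union>i<n. B i)" using q_fundamental union by blast
      then show "x \<in> (\<Union>i<n. E i)" using x by (auto simp: E_def)
    qed
  qed (auto simp: E_def)
  have ind: "indicator fundamental x * (area x / pi) = (\<Sum>i<n. indicator (E i) x * (area x / pi))" for x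
    unfolding Eunion[symmetric] indicator_UN_disjoint[OF finite_lessThan Edisj] by (rule sum_distrib_right)
  have "integral\<^sup>L lborel (\<lambda>x. indicator fundamental x * (area x / pi)) =
     (\<Sum>i<n. integral\<^sup>L lborel (\<lambda>x. indicator (E i) x * (area x / pi)))"
    unfolding ind
    by (rule Bochner_Integration.integral_sum, rule area_integrable) (use pieces(2) in \<open>auto simp: E_def\<close>)
  also have "\<dots> = (\<Sum>i<n. set_lebesgue_integral lborel (chart_map (c i) ` B i) (HT_density A F (c i)))"
    by (rule sum.cong) (simp_all add: pieces)
  finally show ?thesis by simp
qed

text \<open>If there were no partition, every number would satisfy the condition in
  \<open>HT_volume\<close>. A finite cover by chart domains is made disjoint by removing the earlier
  domains from each.\<close>

lemma partition_exists: "\<exists>n c B. chart_partition C A n c B"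
proof -
  have "\<exists>T. open T \<and> chart_dom c = C \<inter> T" if "c \<in> A" for c
    using chart_open[OF that] unfolding openin_open by blast
  then obtain T where T: "\<And>c. c \<in> A \<Longrightarrow> open (T c) \<and> chart_dom c = C \<inter> T c" by metis
  have "C \<subseteq> (\<Union>c\<in>A. T c)" using chart_cover T by blast
  from compactE_image[OF compact_C, of A T, OF _ this] T
  obtain A' where A': "A' \<subseteq> A" "finite A'" "C \<subseteq> (\<Union>c\<in>A'. T c)" by metis
  obtain l where l: "set l = A'" using finite_list[OF A'(2)] by blast
  define B where "B i = chart_dom (l ! i) - (\<Union>j<i. chart_dom (l ! j))" for i
  have lA: "l ! i \<in> A" if "i < length l" for i using that l A'(1) nth_mem by blast
  have "chart_partition C A (length l) (\<lambda>i. l ! i) B"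
    unfolding chart_partition_def
  proof (intro conjI allI impI)
    fix i assume i: "i < length l"
    show "l ! i \<in> A" by (rule lA[OF i])
    show "B i \<subseteq> chart_dom (l ! i)" by (auto simp: B_def)
    \<comment> \<open>Overlaps have relatively open images in the half-plane, so in coordinates only
      Borel sets are subtracted.\<close>
    have img: "openin (top_of_set half_plane) (chart_map (l ! i) ` (chart_dom (l ! i) \<inter> chart_dom (l ! j)))" if j: "j < i" for j
    proof -
      have lj: "l ! j \<in> A" using i j by (intro lA) simp
      have "chart_dom (l ! i) \<inter> chart_dom (l ! j) = chart_dom (l ! i) \<inter> T (l ! j)"
        using T[OF lj] chart_dom_subset[OF lA[OF i]] by blast
      then have "openin (top_of_set (chart_dom (l ! i))) (chart_dom (l ! i) \<inter> chart_dom (l ! j))"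
        using T[OF lj] unfolding openin_open by blast
      from homeomorphism_imp_open_map[OF chart_homeo[OF lA[OF i]] this]
      show ?thesis using openin_trans[OF _ chart_img_open[OF lA[OF i]]] by blast
    qed
    have "B i = chart_dom (l ! i) - (\<Union>j<i. chart_dom (l ! i) \<inter> chart_dom (l ! j))" by (auto simp: B_def)
    then have "chart_map (l ! i) ` B i = chart_map (l ! i) ` chart_dom (l ! i) - chart_map (l ! i) ` (\<Union>j<i. chart_dom (l ! i) \<inter> chart_dom (l ! j))"
      using inj_on_image_set_diff[OF chart_map_inj[OF lA[OF i]], of "chart_dom (l ! i)" "\<Union>j<i. chart_dom (l ! i) \<inter> chart_dom (l ! j)"]
      by auto
    also have "\<dots> = chart_img (l ! i) - (\<Union>j<i. chart_map (l ! i) ` (chart_dom (l ! i) \<inter> chart_dom (l ! j)))"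
      by (simp only: image_UN)
    also have "\<dots> \<in> sets borel"
    proof (intro sets.Diff sets.countable_UN'')
      show "chart_img (l ! i) \<in> sets borel" by (rule openin_borel[OF half_plane_borel chart_img_open[OF lA[OF i]]])
      show "chart_map (l ! i) ` (chart_dom (l ! i) \<inter> chart_dom (l ! j)) \<in> sets borel" if "j \<in> {..<i}" for j
        by (rule openin_borel[OF half_plane_borel img]) (use that in simp)
    qed auto
    finally show "chart_map (l ! i) ` B i \<in> sets borel" .
  next
    show "disjoint_family_on B {..<length l}"
      unfolding disjoint_family_on_def
    proof (intro ballI impI)
      fix i j :: nat assume "i \<noteq> j"
      then consider "i < j" | "j < i" by linarith
      then show "B i \<inter> B j = {}" by cases (auto simp: B_def)
    qed
    show "(\<Union>i<length l. B i) = C"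
    proof
      show "(\<Union>i<length l. B i) \<subseteq> C" 
      proof (rule UN_least)
        fix i assume "i \<in> {..<length l}"
        then have "chart_dom (l ! i) \<subseteq> C" by (intro chart_dom_subset lA) simp
        then show "B i \<subseteq> C" unfolding B_def by blast
      qed
      show "C \<subseteq> (\<Union>i<length l. B i)"
      proof
        fix p assume p: "p \<in> C"
        then obtain c where c: "c \<in> A'" "p \<in> T c" using A'(3) by blast
        then have "c \<in> A" using A'(1) by blast
        then have "p \<in> chart_dom c" using T[of c] c(2) p by blast
        moreover obtain i where "i < length l" "l ! i = c" using c(1) l by (metis in_set_conv_nth)
        ultimately have ex: "\<exists>i. i < length l \<and> p \<in> chart_dom (l ! i)" by blast
        \<comment> \<open>The first chart domain in the list that contains \<open>p\<close>
          determines its piece.\<close>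
        define m where "m = (LEAST i. i < length l \<and> p \<in> chart_dom (l ! i))"
        have m: "m < length l" "p \<in> chart_dom (l ! m)" using LeastI_ex[OF ex] unfolding m_def by auto
        have "p \<notin> chart_dom (l ! j)" if "j < m" for j
          using not_less_Least[of j "\<lambda>i. i < length l \<and> p \<in> chart_dom (l ! i)"] that m(1) unfolding m_def[symmetric] by simp
        then have "p \<in> B m" using m by (simp add: B_def)
        then show "p \<in> (\<Union>i<length l. B i)" using m by blast
      qed
    qed
  qed
  then show ?thesis by blast
qed

text \<open>For the definite description, \<open>partition_sum\<close> provides existence and
  \<open>partition_exists\<close> uniqueness.\<close>

lemma HT_volume_eq:
  "HT_volume C A F = integral (cbox (0,0) (1,1)) area / pi"
proof -
  let ?I = "integral\<^sup>L lborel (\<lambda>x. indicator fundamental x * (area x / pi))"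
  have "HT_volume C A F = ?I"
    unfolding HT_volume_def
  proof (rule the_equality)
    show "\<forall>n c B. chart_partition C A n c B \<longrightarrow>
        ?I = (\<Sum>i<n. set_lebesgue_integral lborel (chart_map (c i) ` B i) (HT_density A F (c i)))"
      using partition_sum by simp
    fix v
    assume v: "\<forall>n c B. chart_partition C A n c B \<longrightarrow>
        v = (\<Sum>i<n. set_lebesgue_integral lborel (chart_map (c i) ` B i) (HT_density A F (c i)))"
    obtain n c B where part: "chart_partition C A n c B" using partition_exists by blast
    with v partition_sum[OF part] show "v = ?I" by simp
  qed
  also have "\<dots> = integral fundamental (\<lambda>x. area x / pi)"
    by (rule integral_on_borel_eq[symmetric, OF area_integrable[OF fundamental_borel]]) simp
  also have "\<dots> = integral (cbox (0,0) (1,1)) (\<lambda>x. area x / pi)"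
  proof (rule integral_spike_set)
    have b: "(1, 0) \<in> (Basis :: (real \<times> real) set)" by (simp add: Basis_prod_def)
    have n: "negligible {x. x \<bullet> (1::real, 0::real) = 1}"
      by (rule negligible_standard_hyperplane[OF b])
    \<comment> \<open>Closed square and fundamental domain differ only on the edge where the first
      coordinate is 1.\<close>
    have s: "(cbox (0,0) (1,1) - fundamental) \<union> (fundamental - cbox (0,0) (1,1)) \<subseteq> {x. x \<bullet> (1::real, 0::real) = 1}"
      by (auto simp: fundamental_def)
    show "negligible {x \<in> fundamental - cbox (0, 0) (1, 1). area x / pi \<noteq> 0}"
      "negligible {x \<in> cbox (0, 0) (1, 1) - fundamental. area x / pi \<noteq> 0}"
      by (rule negligible_subset[OF n], use s in blast)+
  qed
  finally show ?thesis by simp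
qed

end

theorem proposition3p5:
  fixes C :: "'a::topological_space set"
    and A :: "'a chart set"
    and F :: "'a \<Rightarrow> 'a tvec \<Rightarrow> real"
  assumes "finsler_cylinder C A F"
  shows "HT_volume C A F \<ge> 2 / pi * systole C A F * height C A F"
proof -
  obtain \<Phi> \<Psi> where "homeomorphism C standard_cylinder \<Phi> \<Psi>"
    "\<forall>c\<in>A. smooth_on (chart_img c) (\<Phi> \<circ> chart_inv c) \<and> smooth_on (\<Phi> ` chart_dom c) (chart_map c \<circ> \<Psi>)"
    using assms unfolding finsler_cylinder_def diffeomorphic_to_def by blast
  then interpret finsler_cylinder_chart C A F \<Phi> \<Psi>
    using assms unfolding finsler_cylinder_def by unfold_locales blast+
  have "2 * (systole C A F * height C A F) / pi \<le> integral (cbox (0,0) (1,1)) area / pi"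
    by (intro divide_right_mono area_integral_ge_systole_height) simp
  then show ?thesis by (simp add: HT_volume_eq)
qed

end
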